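(* Consider the stable $M^X/G/1$ retrial queue ($\rho=\lambda\beta_1\chi_1<1$) under the tail assumptions A1 and A2 given in the context, where one of the following three cases holds: (1) $d_X>d_B>1$; (2) $1<d_X<d_B$ and $c_X>0$; (3) $d_X=d_B>1$ and $c_X>0$. Put $a=\min(d_B,d_X)>1$, $\psi=\dfrac{\lambda(\rho+\chi_1-1)}{\mu(1-\rho)}$, $$c_{K}=\begin{cases}\dfrac{(\lambda\chi_1)^{a}\chi_1}{(a-1)(1-\rho)(\rho+\chi_1-1)} & \text{in case (1)},\\[2mm] \dfrac{c_X}{(a-1)(1-\rho)(\rho+\chi_1-1)} & \text{in case (2)},\\[2mm] \dfrac{(\lambda\chi_1)^{a}\chi_1+c_X}{(a-1)(1-\rho)(\rho+\chi_1-1)} & \text{in case (3)},\end{cases}\qquad c_{D^{(0)}}=\begin{cases}\dfrac{(\lambda\chi_1)^{a+1}}{a\mu(1-\rho)^2} & \text{in case (1)},\\[2mm] \dfrac{\lambda c_X}{a\mu(1-\rho)^2} & \text{in case (2)},\\[2mm] \dfrac{(\lambda\chi_1)^{a+1}+\lambda c_X}{a\mu(1-\rho)^2} & \text{in case (3)}.\end{cases}$$ Then, as $j\to\infty$, $$P\{D^{(0)}>j\}\sim(1-1/a)\,c_K\psi\cdot j^{-a}L(j)=c_{D^{(0)}}\cdot j^{-a}L(j).$$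
   Context: The $M^X/G/1$ retrial queue: primary customers arrive in batches at the epochs of a Poisson process of rate $\lambda>0$; batch sizes are i.i.d. copies of a random variable $X$ with values in $\{1,2,\dots\}$, finite mean $\chi_1=E(X)$ and generating function $X(z)=E(z^X)$. If the server is free at an arrival epoch, one customer of the batch starts service immediately and the others join the orbit; if the server is busy, all customers of the batch join the orbit. Each customer in the orbit independently retries after exponential times of rate $\mu>0$ until it finds the server idle, and then starts service immediately. Service times are i.i.d. copies of $B$ with distribution function $B(x)$, $B(0)=0$, finite mean $\beta_1$ and Laplace–Stieltjes transform $\beta(s)=E(e^{-sB})$. Let $\rho=\lambda\beta_1\chi_1$; the system is stable iff $\rho<1$, which is assumed. In stationarity let $N_{orb}$ be the number of customers in the orbit and $C_{ser}\in\{0,1\}$ the indicator that the server is busy. $D^{(0)}$ is a random variable with the conditional distribution of $N_{orb}$ given $C_{ser}=0$; it takes nonnegative integer values and its generating function is given by the known formula $$D^{(0)}(z)=E(z^{D^{(0)}})=\exp\left\{-\frac{\lambda}{\mu}\int_z^1\frac{1-\beta(\lambda-\lambda X(u))X_0(u)}{\beta(\lambda-\lambda X(u))-u}\,du\right\},\qquad X_0(u)=X(u)/u.$$ Tail assumptions, with $L(\cdot)$ a slowly varying function at $\infty$ (positive, measurable, $L(tx)/L(x)\to1$ as $x\to\infty$ for all $t>0$), the same in both: A1. $P\{B>x\}\sim x^{-d_B}L(x)$ as $x\to\infty$, where $d_B>1$. A2. $P\{X>j\}\sim c_X\, j^{-d_X}L(j)$ as $j\to\infty$, where $d_X>1$ and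 $c_X\ge0$; when $c_X=0$ this means $\lim_{j\to\infty}P\{X>j\}/(j^{-d_X}L(j))=0$. $f\sim g$ means $f/g\to1$. *)

theory Defs
  imports "HOL-Probability.Probability" "HOL-Library.Landau_Symbols"
begin

definition slowly_varying :: "(real \<Rightarrow> real) \<Rightarrow> bool" where
  "slowly_varying L \<longleftrightarrow>
     L \<in> borel_measurable (restrict_space borel {0<..}) \<and> (\<forall>x>0. L x > 0) \<and>
     (\<forall>t>0. ((\<lambda>x. L (t * x) / L x) \<longlongrightarrow> 1) at_top)"

definition pgf :: "nat pmf \<Rightarrow> real \<Rightarrow> real" where
  "pgf p z = (\<integral>k. z ^ k \<partial>measure_pmf p)"

definition lst :: "real measure \<Rightarrow> real \<Rightarrow> real" where
  "lst S s = (\<integral>b. exp (- s * b) \<partial>S)"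

text \<open>
  The queue is the Markov process whose state is \<open>(n, r)\<close>: \<open>n\<close> is the number of customers in
  the orbit and \<open>r \<ge> 0\<close> is the residual service time, with \<open>r = 0\<close> meaning that the server is free.
  While \<open>r > 0\<close>, \<open>r\<close> decreases at unit speed and a batch of size \<open>k\<close> moves \<open>(n, r)\<close> to \<open>(n + k, r)\<close>.
  When the server is free, a batch of size \<open>k\<close> moves \<open>(n, 0)\<close> to \<open>(n + k - 1, b)\<close>, and at rate
  \<open>n * mu\<close> a retrial moves it to \<open>(n - 1, b)\<close>, where \<open>b\<close> is a fresh service time.
  \<open>PX\<close> is the law of the batch size and \<open>SB\<close> that of the service time.
\<close>
definition retrial_generator ::
  "real \<Rightarrow> real \<Rightarrow> nat pmf \<Rightarrow> real measure \<Rightarrow> (nat \<Rightarrow> real \<Rightarrow> real) \<Rightarrow> nat \<Rightarrow> real \<Rightarrow> real" where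
  "retrial_generator lam mu PX SB f n r =
     (if r = 0
      then lam * ((\<integral>k. (\<integral>b. f (n + k - 1) b \<partial>SB) \<partial>measure_pmf PX) - f n 0)
           + real n * mu * ((\<integral>b. f (n - 1) b \<partial>SB) - f n 0)
      else lam * ((\<integral>k. f (n + k) r \<partial>measure_pmf PX) - f n r) - deriv (f n) r)"

text \<open>
  Continuity of \<open>f n\<close> at \<open>0\<close> is the boundary condition of the process: a service that ends with
  \<open>n\<close> customers in the orbit leaves the queue in the state \<open>(n, 0)\<close>. The values of \<open>f n\<close> on
  negative arguments play no role.
\<close>
definition retrial_domain ::
  "real \<Rightarrow> real \<Rightarrow> nat pmf \<Rightarrow> real measure \<Rightarrow> (nat \<Rightarrow> real \<Rightarrow> real) set" where
  "retrial_domain lam mu PX SB =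
     {f. (\<forall>n. f n \<in> borel_measurable borel \<and> continuous_on {0..} (f n) \<and>
              f n differentiable_on {0<..} \<and> continuous_on {0<..} (deriv (f n))) \<and>
         (\<exists>K. \<forall>n. \<forall>r\<ge>0. \<bar>f n r\<bar> \<le> K \<and> \<bar>retrial_generator lam mu PX SB f n r\<bar> \<le> K)}"

text \<open>
  \<open>(Cser, Norb, Res)\<close>, defined on \<open>M\<close>, is the state of the queue in stationarity: its law is
  an invariant probability measure, that is, it annihilates the generator.
\<close>
definition retrial_stationary ::
  "real \<Rightarrow> real \<Rightarrow> nat pmf \<Rightarrow> real measure \<Rightarrow>
     'a measure \<Rightarrow> ('a \<Rightarrow> nat) \<Rightarrow> ('a \<Rightarrow> nat) \<Rightarrow> ('a \<Rightarrow> real) \<Rightarrow> bool" where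
  "retrial_stationary lam mu PX SB M Cser Norb Res \<longleftrightarrow>
     prob_space M \<and>
     Cser \<in> measurable M (count_space UNIV) \<and>
     Norb \<in> measurable M (count_space UNIV) \<and>
     Res \<in> borel_measurable M \<and>
     (\<forall>w\<in>space M. Res w \<ge> 0 \<and> Cser w = (if Res w > 0 then 1 else 0)) \<and>
     (\<forall>f\<in>retrial_domain lam mu PX SB.
        (\<integral>w. retrial_generator lam mu PX SB f (Norb w) (Res w) \<partial>M) = 0)"

definition idle_orbit_law :: "'a measure \<Rightarrow> ('a \<Rightarrow> nat) \<Rightarrow> ('a \<Rightarrow> nat) \<Rightarrow> nat measure" where
  "idle_orbit_law M Cser Norb =
     distr (uniform_measure M {w \<in> space M. Cser w = 0}) (count_space UNIV) Norb"

definition c_K :: "real \<Rightarrow> real \<Rightarrow> real \<Rightarrow> real \<Rightarrow> real \<Rightarrow> real \<Rightarrow> real" where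
  "c_K lam chi1 rho dB dX cX =
     (let a = min dB dX in
      if dX > dB then (lam * chi1) powr a * chi1 / ((a - 1) * (1 - rho) * (rho + chi1 - 1))
      else if dX < dB then cX / ((a - 1) * (1 - rho) * (rho + chi1 - 1))
      else ((lam * chi1) powr a * chi1 + cX) / ((a - 1) * (1 - rho) * (rho + chi1 - 1)))"

definition c_D0 :: "real \<Rightarrow> real \<Rightarrow> real \<Rightarrow> real \<Rightarrow> real \<Rightarrow> real \<Rightarrow> real \<Rightarrow> real" where
  "c_D0 lam mu chi1 rho dB dX cX =
     (let a = min dB dX in
      if dX > dB then (lam * chi1) powr (a + 1) / (a * mu * (1 - rho)\<^sup>2)
      else if dX < dB then lam * cX / (a * mu * (1 - rho)\<^sup>2)
      else ((lam * chi1) powr (a + 1) + lam * cX) / (a * mu * (1 - rho)\<^sup>2))"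

lemma lst_bounds:
  assumes "real_distribution SB" "cdf SB 0 = 0" "integrable SB (\<lambda>x. x)" "s \<ge> 0"
  shows "AE b in SB. b > 0"
    and "integrable SB (\<lambda>b. exp (- s * b))"
    and "1 - s * (\<integral>x. x \<partial>SB) \<le> lst SB s" "lst SB s \<le> 1" "0 \<le> lst SB s"
proof -
  interpret S: real_distribution SB by fact
  have "measure SB {..0} = 0" using assms(2) by (simp add: cdf_def)
  then have "AE b in SB. b \<notin> {..0}"
    by (intro AE_not_in) (auto simp: null_sets_def S.emeasure_eq_measure)
  then show pos: "AE b in SB. b > 0" by eventually_elim auto
  show int: "integrable SB (\<lambda>b. exp (- s * b))"
    by (rule S.integrable_const_bound[where B = 1]) (use pos assms(4) in auto)
  have "(\<integral>x. 1 - s * x \<partial>SB) \<le> lst SB s"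
    unfolding lst_def
  proof (rule integral_mono)
    show "integrable SB (\<lambda>x. 1 - s * x)" using assms(3) by simp
    show "1 - s * x \<le> exp (- s * x)" for x using exp_ge_add_one_self[of "- s * x"] by simp
  qed (rule int)
  then show "1 - s * (\<integral>x. x \<partial>SB) \<le> lst SB s" using assms(3) S.prob_space by simp
  have "lst SB s \<le> (\<integral>x. 1 \<partial>SB)" unfolding lst_def
    by (rule integral_mono_AE) (use int pos assms(4) in auto)
  then show "lst SB s \<le> 1" using S.prob_space by simp
  show "0 \<le> lst SB s" unfolding lst_def by simp
qed

lemma pgf_bounds:
  assumes "set_pmf PX \<subseteq> {1..}" "integrable (measure_pmf PX) real" "0 < z" "z < 1"
  shows "pgf PX z \<le> z" "1 - (\<integral>k. real k \<partial>measure_pmf PX) * (1 - z) \<le> pgf PX z"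
    and "0 \<le> pgf PX z" "integrable (measure_pmf PX) (\<lambda>k. z ^ k)"
    and "(\<integral>k. z ^ (n + k - 1) \<partial>measure_pmf PX) = z ^ n * (pgf PX z / z)"
    and "(\<integral>k. z ^ (n + k) \<partial>measure_pmf PX) = z ^ n * pgf PX z"
proof -
  show int: "integrable (measure_pmf PX) (\<lambda>k. z ^ k)"
    by (rule measure_pmf.integrable_const_bound[where B = 1])
       (use assms in \<open>auto simp: power_le_one\<close>)
  have "pgf PX z \<le> (\<integral>k. z \<partial>measure_pmf PX)" unfolding pgf_def
  proof (rule integral_mono_AE)
    show "AE k in measure_pmf PX. z ^ k \<le> z"
    proof (rule AE_pmfI)
      fix k assume "k \<in> set_pmf PX"
      then have "1 \<le> k" using assms(1) by auto
      from power_decreasing[OF this, of z] assms(3,4) show "z ^ k \<le> z" by simp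
    qed
  qed (use int in auto)
  then show "pgf PX z \<le> z" by simp
  have "(\<integral>k. 1 - real k * (1 - z) \<partial>measure_pmf PX) \<le> pgf PX z" unfolding pgf_def
  proof (rule integral_mono)
    show "integrable (measure_pmf PX) (\<lambda>k. 1 - real k * (1 - z))" using assms(2) by simp
    show "1 - real k * (1 - z) \<le> z ^ k" for k
      using Bernoulli_inequality[of "z - 1" k] assms(3) by (simp add: algebra_simps)
  qed (rule int)
  then show "1 - (\<integral>k. real k \<partial>measure_pmf PX) * (1 - z) \<le> pgf PX z"
    using assms(2) by simp
  show "0 \<le> pgf PX z" unfolding pgf_def using assms(3) by simp
  have "(\<integral>k. z ^ (n + k - 1) \<partial>measure_pmf PX) = (\<integral>k. z ^ n / z * z ^ k \<partial>measure_pmf PX)"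
  proof (rule integral_cong_AE)
    show "AE k in measure_pmf PX. z ^ (n + k - 1) = z ^ n / z * z ^ k"
    proof (rule AE_pmfI)
      fix k assume "k \<in> set_pmf PX"
      then have "1 \<le> k" using assms(1) by auto
      then obtain m where "k = Suc m" by (cases k) auto
      then show "z ^ (n + k - 1) = z ^ n / z * z ^ k" using assms(3) by (simp add: power_add)
    qed
  qed auto
  then show "(\<integral>k. z ^ (n + k - 1) \<partial>measure_pmf PX) = z ^ n * (pgf PX z / z)"
    by (simp add: pgf_def)
  show "(\<integral>k. z ^ (n + k) \<partial>measure_pmf PX) = z ^ n * pgf PX z"
    by (simp add: pgf_def power_add)
qed

lemma nat_power_bound:
  fixes z :: real assumes "0 < z" "z < 1"
  obtains K where "K \<ge> 0" "\<And>n. real n * z ^ n \<le> K"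
proof -
  have "(\<lambda>n. real n * z ^ n) \<longlonglongrightarrow> 0"
    using powser_times_n_limit_0[of z] assms by simp
  then have "Bseq (\<lambda>n. real n * z ^ n)" by (rule convergentI[THEN convergent_imp_Bseq])
  then obtain K where K: "0 < K" "\<forall>n. norm (real n * z ^ n) \<le> K" by (rule BseqE)
  have "real n * z ^ n \<le> K" for n using spec[OF K(2), of n] by (auto simp: abs_le_iff)
  then show thesis using that[of K] K(1) by auto
qed

lemma balance:
  assumes lam: "lam > 0" "mu > 0"
    and batch: "set_pmf PX \<subseteq> {1..}" "integrable (measure_pmf PX) real"
    and service: "real_distribution SB" "cdf SB 0 = 0" "integrable SB (\<lambda>x. x)"
    and st: "retrial_stationary lam mu PX SB M Cser Norb Res"
    and Q: "prob_space Q" "D0 \<in> measurable Q (count_space UNIV)"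
      "distr Q (count_space UNIV) D0 = idle_orbit_law M Cser Norb"
    and z: "0 < z" "z < 1"
  defines "bz \<equiv> lst SB (lam - lam * pgf PX z)"
  shows "(\<integral>x. lam * (z ^ D0 x * (pgf PX z / z) * bz - z ^ D0 x)
            + real (D0 x) * mu * (z ^ (D0 x - 1) * bz - z ^ D0 x) \<partial>Q) = 0"
proof -
  interpret S: real_distribution SB by fact
  interpret Q: prob_space Q by fact
  define kap where "kap = lam - lam * pgf PX z"
  note P = pgf_bounds[OF batch z]
  have "pgf PX z < 1" using P(1) z by linarith
  then have kap: "kap > 0" using lam unfolding kap_def by (simp add: algebra_simps)
  note B = lst_bounds[OF service less_imp_le[OF kap]]
  define f where "f = (\<lambda>(n::nat) r. z ^ n * exp (- kap * r))"
  define h where "h = (\<lambda>n. lam * (z ^ n * (pgf PX z / z) * bz - z ^ n)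
            + real n * mu * (z ^ (n - 1) * bz - z ^ n))"
  have bz: "bz = lst SB kap" by (simp add: bz_def kap_def)
  have fB: "(\<integral>b. f n b \<partial>SB) = z ^ n * bz" for n
    by (simp add: f_def bz lst_def)
  have der: "((f n) has_real_derivative (- kap * f n r)) (at r)" for n r
    unfolding f_def by (auto intro!: derivative_eq_intros)
  have dr: "deriv (f n) r = - kap * f n r" for n r by (rule DERIV_imp_deriv[OF der])
  have g: "retrial_generator lam mu PX SB f n r = (if r = 0 then h n else 0)" for n r
  proof -
    have "(\<integral>k. z ^ (n + k - 1) * bz \<partial>measure_pmf PX) = z ^ n * (pgf PX z / z) * bz"
      using P(5)[of n] by simp
    moreover have "(\<integral>k. f (n + k) r \<partial>measure_pmf PX) = z ^ n * pgf PX z * exp (- kap * r)"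
      unfolding f_def using P(6)[of n] by simp
    ultimately show ?thesis
      unfolding retrial_generator_def fB dr
      by (simp add: h_def) (simp add: f_def kap_def algebra_simps)
  qed
  obtain K where K: "K \<ge> 0" "\<And>n. real n * z ^ n \<le> K" using nat_power_bound[OF z] by blast
  have hb: "\<bar>h n\<bar> \<le> lam * 2 + mu * (K / z + K)" for n
  proof -
    have zn: "0 \<le> z ^ n" "z ^ n \<le> 1" using z by (auto simp: power_le_one)
    have "0 \<le> pgf PX z / z" "pgf PX z / z \<le> 1" using P(1,3) z by auto
    then have q: "0 \<le> pgf PX z / z * bz \<and> pgf PX z / z * bz \<le> 1"
      unfolding bz using B(4,5) mult_le_one[of "pgf PX z / z" "lst SB kap"]
        mult_nonneg_nonneg[of "pgf PX z / z" "lst SB kap"] by fast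
    have e1: "z ^ n * (pgf PX z / z) * bz - z ^ n = z ^ n * (pgf PX z / z * bz - 1)"
      by (simp add: algebra_simps)
    have "\<bar>pgf PX z / z * bz - 1\<bar> \<le> 1" using q by (simp only: abs_le_iff) linarith
    then have "\<bar>z ^ n * (pgf PX z / z * bz - 1)\<bar> \<le> 1 * 1"
      unfolding abs_mult using zn by (intro mult_mono) auto
    then have 1: "\<bar>lam * (z ^ n * (pgf PX z / z) * bz - z ^ n)\<bar> \<le> lam * 2"
      unfolding e1 abs_mult[of lam] using lam by (intro mult_mono) auto
    have a: "real n * z ^ (n - 1) \<le> K / z"
    proof (cases n)
      case (Suc m)
      have "real n * z ^ (n - 1) = real n * z ^ n / z" using Suc z by simp
      also have "\<dots> \<le> K / z" using K(2)[of n] z by (intro divide_right_mono) auto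
      finally show ?thesis .
    qed (use K z in auto)
    have b: "0 \<le> real n * z ^ (n - 1) * bz" "real n * z ^ (n - 1) * bz \<le> K / z"
    proof -
      show "0 \<le> real n * z ^ (n - 1) * bz" using z B(5) bz by auto
      have "real n * z ^ (n - 1) * bz \<le> K / z * 1"
        using a z B(4,5) bz K by (intro mult_mono) auto
      then show "real n * z ^ (n - 1) * bz \<le> K / z" by simp
    qed
    have "real n * mu * (z ^ (n - 1) * bz - z ^ n) = mu * (real n * z ^ (n - 1) * bz - real n * z ^ n)"
      by (simp add: algebra_simps)
    moreover have "\<bar>real n * z ^ (n - 1) * bz - real n * z ^ n\<bar> \<le> K / z + K"
    proof -
      have "0 \<le> real n * z ^ n" "real n * z ^ n \<le> K" using z K(2) by auto
      with b K(1) show ?thesis by (simp only: abs_le_iff) linarith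
    qed
    ultimately have 2: "\<bar>real n * mu * (z ^ (n - 1) * bz - z ^ n)\<bar> \<le> mu * (K / z + K)"
      using lam by (simp add: abs_mult)
    show ?thesis unfolding h_def using 1 2 by linarith
  qed
  have "f \<in> retrial_domain lam mu PX SB"
    unfolding retrial_domain_def
  proof (intro CollectI conjI allI exI impI)
    fix n
    have "continuous_on A (f n)" for A
      unfolding f_def by (intro continuous_intros)
    then show "continuous_on {0..} (f n)" "continuous_on {0<..} (deriv (f n))"
      unfolding dr by (auto intro!: continuous_intros)
    show "f n \<in> borel_measurable borel" unfolding f_def by measurable
    show "f n differentiable_on {0<..}"
      unfolding differentiable_on_def real_differentiable_def
      using der has_field_derivative_at_within by blast
  next
    fix n and r :: real assume r: "r \<ge> 0"
    let ?K = "1 + lam * 2 + mu * (K / z + K)"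
    have pos: "0 \<le> lam * 2" "0 \<le> mu * (K / z + K)" using lam K z by auto
    have "\<bar>f n r\<bar> \<le> 1 * 1"
      unfolding f_def abs_mult using z r kap by (intro mult_mono) (auto simp: power_le_one)
    then show "\<bar>f n r\<bar> \<le> ?K" using pos by linarith
    show "\<bar>retrial_generator lam mu PX SB f n r\<bar> \<le> ?K"
      unfolding g using hb[of n] pos by auto
  qed
  with st have "(\<integral>w. retrial_generator lam mu PX SB f (Norb w) (Res w) \<partial>M) = 0"
    unfolding retrial_stationary_def by blast
  then have 0: "(\<integral>w. (if Res w = 0 then h (Norb w) else 0) \<partial>M) = 0" unfolding g .
  have C[measurable]: "Cser \<in> measurable M (count_space UNIV)"
      "Norb \<in> measurable M (count_space UNIV)"
    and Cs: "\<And>w. w \<in> space M \<Longrightarrow> Res w \<ge> 0 \<and> Cser w = (if Res w > 0 then 1 else 0)"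
    using st unfolding retrial_stationary_def by auto
  define A where "A = {w \<in> space M. Cser w = 0}"
  have A[measurable]: "A \<in> sets M" unfolding A_def by measurable
  note [measurable] = Q(2)
  have "(\<integral>x. h (D0 x) \<partial>Q) = (\<integral>n. h n \<partial>distr Q (count_space UNIV) D0)"
    by (subst integral_distr) auto
  also have "\<dots> = (\<integral>w. h (Norb w) \<partial>uniform_measure M A)"
    unfolding Q(3) idle_orbit_law_def A_def[symmetric] by (subst integral_distr) auto
  also have "\<dots> = 0"
  proof -
    interpret M: prob_space M using st unfolding retrial_stationary_def by auto
    show ?thesis
    proof (cases "measure M A = 0")
      case True
      have "prob_space (idle_orbit_law M Cser Norb)"
        using Q.prob_space_distr[OF Q(2)] Q(3) by simp
      then have "emeasure (idle_orbit_law M Cser Norb) UNIV = 1"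
        using prob_space.emeasure_space_1[of "idle_orbit_law M Cser Norb"]
        by (simp add: idle_orbit_law_def)
      moreover have "emeasure (idle_orbit_law M Cser Norb) UNIV
          = emeasure M (A \<inter> space M) / emeasure M A"
        unfolding idle_orbit_law_def A_def[symmetric]
        by (subst emeasure_distr) auto
      moreover have "A \<inter> space M = A" unfolding A_def by auto
      ultimately have False using True by (simp add: M.emeasure_eq_measure)
      then show ?thesis ..
    next
      case False
      have "uniform_measure M A = density M (\<lambda>w. ennreal (indicator A w / measure M A))"
        unfolding uniform_measure_def
      proof (rule density_cong)
        show "AE w in M. indicator A w / emeasure M A = ennreal (indicator A w / measure M A)"
        proof (rule AE_I2)
          fix w assume "w \<in> space M"
          show "indicator A w / emeasure M A = ennreal (indicator A w / measure M A)"
            using False unfolding M.emeasure_eq_measure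
            by (cases "w \<in> A") (auto simp: divide_ennreal[symmetric] zero_less_measure_iff)
        qed
      qed auto
      then have "(\<integral>w. h (Norb w) \<partial>uniform_measure M A)
          = (\<integral>w. indicator A w / measure M A * h (Norb w) \<partial>M)"
        by (simp add: integral_density)
      also have "\<dots> = (\<integral>w. (if Res w = 0 then h (Norb w) else 0) / measure M A \<partial>M)"
      proof (rule Bochner_Integration.integral_cong[OF refl])
        fix w assume w: "w \<in> space M"
        show "indicator A w / measure M A * h (Norb w)
          = (if Res w = 0 then h (Norb w) else 0) / measure M A"
          using Cs[OF w] w unfolding A_def by (auto simp: indicator_def split: if_splits)
      qed
      finally show ?thesis using 0 by simp
    qed
  qed
  finally show ?thesis unfolding h_def .
qed


lemma pmf_nat_sums:
  fixes g :: "nat \<Rightarrow> real"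
  assumes "integrable (measure_pmf p) g"
  shows "(\<lambda>n. pmf p n * g n) sums (\<integral>n. g n \<partial>measure_pmf p)"
proof -
  have "integrable (count_space UNIV) (\<lambda>n. pmf p n * g n)"
    using assms unfolding measure_pmf_eq_density by (simp add: integrable_density)
  moreover have "(\<integral>n. g n \<partial>measure_pmf p) = (\<integral>n. pmf p n * g n \<partial>count_space UNIV)"
    unfolding measure_pmf_eq_density by (simp add: integral_density)
  ultimately show ?thesis using sums_integral_count_space_nat[of "\<lambda>n. pmf p n * g n"] by simp
qed

lemma pgf_has_derivative:
  assumes z: "0 < z" "z < 1"
  shows "integrable (measure_pmf p) (\<lambda>n. z ^ n)"
    and "integrable (measure_pmf p) (\<lambda>n. real n * z ^ (n - 1))"
    and "(pgf p has_real_derivative (\<integral>n. real n * z ^ (n - 1) \<partial>measure_pmf p)) (at z)"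
    and "pgf p z > 0"
proof -
  have int: "integrable (measure_pmf p) (\<lambda>n. x ^ n)" if "0 < x" "x < 1" for x :: real
    by (rule measure_pmf.integrable_const_bound[where B = 1])
       (use that in \<open>auto simp: power_le_one\<close>)
  show "integrable (measure_pmf p) (\<lambda>n. z ^ n)" using int z .
  obtain K where K: "K \<ge> 0" "\<And>n. real n * z ^ n \<le> K" using nat_power_bound[OF z] by blast
  show int': "integrable (measure_pmf p) (\<lambda>n. real n * z ^ (n - 1))"
  proof (rule measure_pmf.integrable_const_bound[where B = "K / z"], rule AE_pmfI)
    fix n
    show "norm (real n * z ^ (n - 1)) \<le> K / z"
    proof (cases n)
      case (Suc m)
      have "real n * z ^ (n - 1) = real n * z ^ n / z" using Suc z by simp
      also have "\<dots> \<le> K / z" using K(2)[of n] z by (intro divide_right_mono) auto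
      finally show ?thesis using z by simp
    qed (use K z in auto)
  qed auto
  let ?D = "\<integral>n. real n * z ^ (n - 1) \<partial>measure_pmf p"
  have "(\<lambda>n. pmf p n * (real n * z ^ (n - 1))) sums ?D" by (rule pmf_nat_sums[OF int'])
  then have "(\<lambda>n. pmf p (Suc n) * (real (Suc n) * z ^ (Suc n - 1))) sums ?D"
    by (subst sums_Suc_iff) simp
  then have D: "(\<Sum>n. diffs (pmf p) n * z ^ n) = ?D"
    by (simp add: sums_iff diffs_def mult_ac)
  define y where "y = (z + 1) / 2"
  have y: "0 < y" "y < 1" "z < y" using z by (auto simp: y_def)
  have "((\<lambda>x. \<Sum>n. pmf p n * x ^ n) has_real_derivative ?D) (at z)"
    unfolding D[symmetric]
    by (rule termdiffs_strong[where K = y])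
       (use pmf_nat_sums[OF int[OF y(1,2)]] y z in \<open>auto simp: sums_iff\<close>)
  then show "(pgf p has_real_derivative ?D) (at z)"
  proof (rule DERIV_cong_ev[THEN iffD1, rotated -1])
    have "eventually (\<lambda>x. x \<in> {0<..<1}) (nhds z)"
      using z by (intro eventually_nhds_in_open) auto
    then show "eventually (\<lambda>x. (\<Sum>n. pmf p n * x ^ n) = pgf p x) (nhds z)"
    proof eventually_elim
      case (elim x)
      then show ?case using pmf_nat_sums[OF int, of x] by (auto simp: sums_iff pgf_def)
    qed
  qed auto
  obtain k where k: "k \<in> set_pmf p" using set_pmf_not_empty[of p] by auto
  have s: "(\<lambda>n. pmf p n * z ^ n) sums pgf p z"
    unfolding pgf_def by (rule pmf_nat_sums[OF int[OF z]])
  have "0 < (\<Sum>n. pmf p n * z ^ n)"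
    by (rule suminf_pos2[where i = k]) (use s z k in \<open>auto simp: sums_iff pmf_positive\<close>)
  then show "pgf p z > 0" using s by (simp add: sums_iff)
qed

lemma pgf_continuous: "continuous_on {0..1} (pgf p)"
  unfolding continuous_on_sequentially
proof (intro allI ballI impI, elim conjE)
  fix x :: "nat \<Rightarrow> real" and a assume x: "\<forall>n. x n \<in> {0..1}" "x \<longlonglongrightarrow> a"
  have "(\<lambda>i. \<integral>n. x i ^ n \<partial>measure_pmf p) \<longlonglongrightarrow> (\<integral>n. a ^ n \<partial>measure_pmf p)"
  proof (rule integral_dominated_convergence[where w = "\<lambda>_. 1"])
    show "AE n in measure_pmf p. (\<lambda>i. x i ^ n) \<longlonglongrightarrow> a ^ n"
      using x(2) by (intro AE_I2 tendsto_intros)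
    show "AE n in measure_pmf p. norm (x i ^ n) \<le> 1" for i
      using x(1) by (intro AE_I2) (auto simp: power_abs intro!: power_le_one)
  qed auto
  then show "(pgf p \<circ> x) \<longlonglongrightarrow> pgf p a" by (simp add: o_def pgf_def)
qed

text \<open>
  The known formula for the generating function of the number of customers in the orbit given
  that the server is free, obtained by applying the invariance of the stationary law to the
  functions \<open>z ^ n * exp (- (lam - lam * pgf PX z) * r)\<close>.
\<close>
theorem idle_orbit_pgf:
  fixes D0 :: "'b \<Rightarrow> nat"
  assumes "lam > 0" "mu > 0"
    and batch: "set_pmf PX \<subseteq> {1..}" "integrable (measure_pmf PX) real"
    and service: "real_distribution SB" "cdf SB 0 = 0" "integrable SB (\<lambda>x. x)"
    and stable: "lam * (\<integral>x. x \<partial>SB) * (\<integral>k. real k \<partial>measure_pmf PX) < 1"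
    and st: "retrial_stationary lam mu PX SB M Cser Norb Res"
    and Q: "prob_space Q" "D0 \<in> measurable Q (count_space UNIV)"
      "distr Q (count_space UNIV) D0 = idle_orbit_law M Cser Norb"
    and z: "0 < z" "z \<le> 1"
  shows "(\<integral>x. z ^ D0 x \<partial>Q) =
    exp (- (lam / mu) * integral {z..1} (\<lambda>u.
      (1 - lst SB (lam - lam * pgf PX u) * (pgf PX u / u)) / (lst SB (lam - lam * pgf PX u) - u)))"
proof -
  interpret Q: prob_space Q by fact
  note [measurable] = Q(2)
  define N where "N = distr Q (count_space UNIV) D0"
  interpret N: prob_space N unfolding N_def by (rule Q.prob_space_distr) fact
  have "N \<in> {M. prob_space M \<and> sets M = UNIV \<and> (AE x in M. measure M {x} \<noteq> 0)}"
  proof (intro CollectI conjI)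
    have "sets N = UNIV" by (simp add: N_def)
    then show "AE x in N. measure N {x} \<noteq> 0"
      using N.AE_support_countable by (auto intro!: exI[of _ UNIV])
  qed (use N.prob_space_axioms in \<open>auto simp: N_def\<close>)
  then have p: "measure_pmf (Abs_pmf N) = N" by (rule Abs_pmf_inverse)
  define p where "p = Abs_pmf N"
  note p = p[folded p_def]
  have tr: "(\<integral>x. g (D0 x) \<partial>Q) = (\<integral>n. g n \<partial>measure_pmf p)" for g :: "nat \<Rightarrow> real"
    unfolding p N_def by (subst integral_distr) auto
  define b where "b = (\<lambda>u. lst SB (lam - lam * pgf PX u))"
  define F where "F = (\<lambda>u. (1 - b u * (pgf PX u / u)) / (b u - u))"
  have der: "((\<lambda>u. ln (pgf p u)) has_real_derivative lam / mu * F u) (at u)"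
    if u: "0 < u" "u < 1" for u
  proof -
    note G = pgf_has_derivative[OF u, of p]
    note P = pgf_bounds[OF batch u]
    let ?D = "\<integral>n. real n * u ^ (n - 1) \<partial>measure_pmf p"
    let ?chi = "\<integral>k. real k \<partial>measure_pmf PX" and ?beta = "\<integral>x. x \<partial>SB"
    have s: "lam - lam * pgf PX u \<ge> 0" using P(1) u \<open>lam > 0\<close> by simp
    note B = lst_bounds[OF service s]
    have beta: "?beta \<ge> 0" using B(1) by (intro integral_nonneg_AE) auto
    have "lam - lam * pgf PX u = lam * (1 - pgf PX u)" by (simp add: algebra_simps)
    also have "\<dots> \<le> lam * (?chi * (1 - u))"
      using P(2) \<open>lam > 0\<close> by (intro mult_left_mono) auto
    finally have "(lam - lam * pgf PX u) * ?beta \<le> lam * (?chi * (1 - u)) * ?beta"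
      using beta by (rule mult_right_mono)
    also have "\<dots> = lam * ?beta * ?chi * (1 - u)" by (simp add: algebra_simps)
    also have "\<dots> < 1 * (1 - u)" using stable u by (intro mult_strict_right_mono) auto
    finally have "u < 1 - (lam - lam * pgf PX u) * ?beta" by (simp only: mult_1 less_diff_eq add.commute)
    also note B(3)
    finally have bu: "b u > u" unfolding b_def .
    have "(\<integral>n. lam * (u ^ n * (pgf PX u / u) * b u - u ^ n)
        + real n * mu * (u ^ (n - 1) * b u - u ^ n) \<partial>measure_pmf p) = 0"
      using balance[OF \<open>lam > 0\<close> \<open>mu > 0\<close> batch service st Q u] unfolding tr[symmetric] b_def .
    moreover have "lam * (u ^ n * (pgf PX u / u) * b u - u ^ n)
        + real n * mu * (u ^ (n - 1) * b u - u ^ n)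
      = lam * (pgf PX u / u * b u - 1) * u ^ n + mu * (b u - u) * (real n * u ^ (n - 1))" for n
      by (cases n) (simp_all add: algebra_simps)
    ultimately have "lam * (pgf PX u / u * b u - 1) * pgf p u + mu * (b u - u) * ?D = 0"
      using G(1,2) by (simp add: pgf_def)
    then have "mu * (b u - u) * ?D = lam * (1 - b u * (pgf PX u / u)) * pgf p u"
      by (simp add: algebra_simps)
    moreover have "mu * (b u - u) > 0" using bu \<open>mu > 0\<close> by simp
    ultimately have "?D = lam * (1 - b u * (pgf PX u / u)) * pgf p u / (mu * (b u - u))"
      by (auto simp: eq_divide_eq mult_ac)
    then have "?D = lam / mu * F u * pgf p u" unfolding F_def by simp
    then have "inverse (pgf p u) * ?D = lam / mu * F u" using G(4) by simp
    then show ?thesis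
      using DERIV_chain2[OF DERIV_ln[OF G(4)] G(3)] by simp
  qed
  have pos: "pgf p u > 0" if "u \<in> {z..1}" for u
    using pgf_has_derivative(4)[of u p] that z by (cases "u = 1") (auto simp: pgf_def)
  have cont: "continuous_on {z..1} (\<lambda>u. ln (pgf p u))"
  proof (rule continuous_on_ln)
    show "continuous_on {z..1} (pgf p)"
      by (rule continuous_on_subset[OF pgf_continuous]) (use z in auto)
    show "\<forall>u\<in>{z..1}. pgf p u \<noteq> 0" using pos by (metis less_irrefl)
  qed
  have "((\<lambda>u. lam / mu * F u) has_integral (ln (pgf p 1) - ln (pgf p z))) {z..1}"
    by (rule fundamental_theorem_of_calculus_interior)
       (use z der cont in \<open>simp_all add: has_real_derivative_iff_has_vector_derivative\<close>)
  then have "integral {z..1} (\<lambda>u. lam / mu * F u) = ln (pgf p 1) - ln (pgf p z)"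
    by (rule integral_unique)
  moreover have "pgf p 1 = 1" by (simp add: pgf_def)
  moreover have "integral {z..1} (\<lambda>u. lam / mu * F u) = lam / mu * integral {z..1} F"
    by (rule integral_mult_right)
  ultimately have ln: "ln (pgf p z) = - (lam / mu) * integral {z..1} F" by simp
  have "pgf p z = exp (ln (pgf p z))" using pos[of z] z by simp
  then have "pgf p z = exp (- (lam / mu) * integral {z..1} F)" unfolding ln .
  then show ?thesis unfolding tr by (simp add: pgf_def F_def b_def)
qed

end

theory Submission
  imports Defs "HOL-Real_Asymp.Real_Asymp"
begin

text \<open>
  The proof works with coefficients instead of transforms, so no Tauberian theorem is involved and
  integer values of \<open>a\<close> need no special treatment. Let \<open>A\<close> and \<open>Y\<close> be the generating functions of
  the number of customers that arrive during a service and of the batch size minus one. The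
  logarithmic derivative of the generating function of the idle orbit law is \<open>lam / mu\<close> times
  \<open>(1 - A u * Y u) / (A u - u)\<close>. After division of both parts of the fraction by \<open>1 - u\<close>, this
  is a quotient \<open>G / (1 - H)\<close>, where \<open>G\<close> and \<open>H\<close> have tail probabilities as coefficients and those
  of \<open>H\<close> add up to \<open>rho < 1\<close>.

  There are three steps. First, the tail of the number of arrivals during a service is found
  (\<open>arr_tail_asymp\<close>): it is large if the service is long, by the law of large numbers, or if one
  batch is. The uniformity in the service time that this needs is provided by a truncated
  exponential bound (\<open>cp_tail_uniform\<close>). Secondly, the coefficients \<open>f\<close> of \<open>G / (1 - H)\<close> solve the
  linear fixed point equation \<open>f = G + H * f\<close>, and their tail, of index \<open>1 - a\<close> by Karamata's theorem, is
  obtained by passing to the limit in it (\<open>tail_fixed_point_asymp\<close>). Thirdly, a law whose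
  generating function has logarithmic derivative \<open>f\<close> satisfies \<open>(n + 1) * p (n + 1) = (f * p) n\<close>.
  Hence its size-biased tail is a convolution tail, to which only \<open>f\<close> contributes, and undoing
  the size bias by summation by parts produces the factor \<open>1 - 1 / a\<close>
  (\<open>tail_panjer_asymp\<close>). The compound Poisson law of the arrivals during a fixed time has the same
  structure, so its tail comes from the same lemma.

  Regular variation is needed in locally uniform form. Assumption A1 supplies it, because
  \<open>P{B > x}\<close> is monotone and equivalent to \<open>x powr (- dB) * L x\<close> in all three cases.
\<close>

section \<open>Tails and convolutions of sequences\<close>

definition tail :: "(nat \<Rightarrow> real) \<Rightarrow> nat \<Rightarrow> real" where
  "tail f j = (\<Sum>n. f (n + j))"

definition conv :: "(nat \<Rightarrow> real) \<Rightarrow> (nat \<Rightarrow> real) \<Rightarrow> nat \<Rightarrow> real" where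
  "conv f g n = (\<Sum>i\<le>n. f i * g (n - i))"

lemma tail_0 [simp]: "tail f 0 = suminf f"
  by (simp add: tail_def)

lemma tail_eq_diff: "summable f \<Longrightarrow> tail f j = suminf f - sum f {..<j}"
  unfolding tail_def by (rule suminf_minus_initial_segment)

lemma tail_diff: "summable f \<Longrightarrow> j \<le> k \<Longrightarrow> sum f {j..<k} = tail f j - tail f k"
  by (simp add: tail_eq_diff sum_diff_nat_ivl[of 0 j k f, symmetric] atLeast0LessThan)

lemma tail_Suc: "summable f \<Longrightarrow> tail f j = f j + tail f (Suc j)"
  by (simp add: tail_eq_diff)

lemma tail_nonneg: "summable f \<Longrightarrow> (\<And>n. 0 \<le> f n) \<Longrightarrow> 0 \<le> tail f j"
  unfolding tail_def by (intro suminf_nonneg) (auto simp: summable_iff_shift)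

lemma tail_antimono:
  assumes "summable f" "\<And>n. 0 \<le> f n" "j \<le> k"
  shows "tail f k \<le> tail f j"
  using tail_diff[OF assms(1,3)] sum_nonneg[of "{j..<k}" f] assms(2) by auto

lemma tail_le_suminf: "summable f \<Longrightarrow> (\<And>n. 0 \<le> f n) \<Longrightarrow> tail f j \<le> suminf f"
  using tail_antimono[of f 0 j] by simp

lemma tail_mono:
  assumes "summable g" "summable f" "\<And>n. n \<ge> j \<Longrightarrow> f n \<le> g n"
  shows "tail f j \<le> tail g j"
  unfolding tail_def by (intro suminf_le) (use assms in \<open>auto simp: summable_iff_shift\<close>)

lemma tail_cmult: "summable f \<Longrightarrow> tail (\<lambda>n. c * f n) j = c * tail f j"
  unfolding tail_def by (intro suminf_mult) (auto simp: summable_iff_shift)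

lemma tail_add: "summable f \<Longrightarrow> summable g \<Longrightarrow> tail (\<lambda>n. f n + g n) j = tail f j + tail g j"
  unfolding tail_def by (intro suminf_add[symmetric]) (auto simp: summable_iff_shift)

lemma tail_tendsto_0: "summable f \<Longrightarrow> tail f \<longlonglongrightarrow> 0"
  unfolding tail_def by (rule suminf_exist_split2)

lemma conv_nonneg: "(\<And>n. 0 \<le> f n) \<Longrightarrow> (\<And>n. 0 \<le> g n) \<Longrightarrow> 0 \<le> conv f g n"
  unfolding conv_def by (intro sum_nonneg mult_nonneg_nonneg) auto

lemma conv_sums:
  assumes "summable f" "summable g" "\<And>n. 0 \<le> f n" "\<And>n. 0 \<le> g n"
  shows "summable (conv f g)" "suminf (conv f g) = suminf f * suminf g"
proof -
  have "conv f g sums (suminf f * suminf g)"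
    unfolding conv_def by (rule Cauchy_product_sums) (use assms in auto)
  then show "summable (conv f g)" "suminf (conv f g) = suminf f * suminf g"
    by (auto simp: sums_iff)
qed

lemma conv_power:
  "conv f g n * z ^ n = conv (\<lambda>n. f n * z ^ n) (\<lambda>n. g n * z ^ n) n"
  unfolding conv_def sum_distrib_right
  by (intro sum.cong) (auto simp: mult_ac power_add[symmetric])

lemma sum_conv_lessThan: "sum (conv f g) {..<j} = (\<Sum>i<j. f i * sum g {..<j - i})"
proof -
  have "sum (conv f g) {..<j} = (\<Sum>n<j. \<Sum>i\<le>n. f i * g (n - i))"
    by (simp add: conv_def)
  also have "\<dots> = (\<Sum>(i, m)\<in>{(i, m). i + m < j}. f i * g m)"
    by (rule sum.triangle_reindex[symmetric])
  also have "{(i, m). i + m < j} = (SIGMA i:{..<j}. {..<j - i})" by auto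
  also have "(\<Sum>(i, m)\<in>(SIGMA i:{..<j}. {..<j - i}). f i * g m) = (\<Sum>i<j. \<Sum>m<j - i. f i * g m)"
    by (rule sum.Sigma[symmetric]) auto
  finally show ?thesis by (simp add: sum_distrib_left)
qed

text \<open>The first term collects the pairs of indices whose first entry is at least \<open>j\<close>.\<close>

lemma tail_conv:
  assumes f: "summable f" "\<And>n. 0 \<le> f n" and g: "summable g" "\<And>n. 0 \<le> g n"
  shows "tail (conv f g) j = suminf g * tail f j + (\<Sum>i<j. f i * tail g (j - i))"
proof -
  have "(\<Sum>i<j. f i * tail g (j - i)) = sum f {..<j} * suminf g - sum (conv f g) {..<j}"
    by (simp add: tail_eq_diff[OF g(1)] sum_conv_lessThan algebra_simps sum_subtractf sum_distrib_left)
  then show ?thesis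
    using conv_sums[OF f(1) g(1) f(2) g(2)] by (simp add: tail_eq_diff f(1) algebra_simps)
qed

lemma tail_conv_lower:
  assumes f: "summable f" "\<And>n. 0 \<le> f n" and g: "summable g" "\<And>n. 0 \<le> g n"
  shows "suminf f * tail g j + suminf g * tail f j - tail f j * tail g j \<le> tail (conv f g) j"
proof -
  have "sum f {..<j} * tail g j \<le> (\<Sum>i<j. f i * tail g (j - i))"
    unfolding sum_distrib_right by (intro sum_mono mult_left_mono tail_antimono g f) auto
  then show ?thesis
    unfolding tail_conv[OF assms] by (simp add: tail_eq_diff[OF f(1), of j] algebra_simps)
qed

text \<open>If two indices add up to at least \<open>j\<close>, then one of them is at least \<open>j - k\<close>, or both are
  at least \<open>k\<close>.\<close>

lemma tail_conv_upper:
  assumes f: "summable f" "\<And>n. 0 \<le> f n" and g: "summable g" "\<And>n. 0 \<le> g n" and k: "2 * k \<le> j"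
  shows "tail (conv f g) j
    \<le> suminf f * tail g (j - k) + suminf g * tail f (j - k) + tail f k * tail g k"
proof -
  let ?h = "\<lambda>i. f i * tail g (j - i)"
  have split: "sum ?h {..<j} = sum ?h {..<k} + sum ?h {k..<j - k} + sum ?h {j - k..<j}"
    using k sum.atLeastLessThan_concat[of 0 k "j - k" ?h] sum.atLeastLessThan_concat[of 0 "j - k" j ?h]
    by (simp add: atLeast0LessThan)
  have t0: "0 \<le> tail g i" "0 \<le> tail f i" for i using tail_nonneg f g by auto
  have "sum ?h {..<k} \<le> sum f {..<k} * tail g (j - k)"
    unfolding sum_distrib_right by (intro sum_mono mult_left_mono tail_antimono g f) auto
  also have "\<dots> \<le> suminf f * tail g (j - k)"
    by (intro mult_right_mono t0 sum_le_suminf f) auto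
  finally have 1: "sum ?h {..<k} \<le> suminf f * tail g (j - k)" .
  have "sum ?h {k..<j - k} \<le> sum f {k..<j - k} * tail g k"
    unfolding sum_distrib_right by (intro sum_mono mult_left_mono tail_antimono g f) auto
  also have "\<dots> \<le> tail f k * tail g k"
    using k t0(2)[of "j - k"] by (intro mult_right_mono t0) (auto simp: tail_diff[OF f(1)])
  finally have 2: "sum ?h {k..<j - k} \<le> tail f k * tail g k" .
  have "sum ?h {j - k..<j} \<le> sum f {j - k..<j} * suminf g"
    unfolding sum_distrib_right by (intro sum_mono mult_left_mono tail_le_suminf g f)
  also have "\<dots> = (tail f (j - k) - tail f j) * suminf g"
    by (simp add: tail_diff[OF f(1)])
  finally show ?thesis
    unfolding tail_conv[OF f g] split using 1 2 by (simp add: algebra_simps)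
qed

lemma tail_gf_sums:
  assumes a: "summable a" "\<And>n. 0 \<le> a n" and u: "0 \<le> u" "u < (1::real)"
  shows "(\<lambda>n. tail a (Suc n) * u ^ n) sums ((suminf a - (\<Sum>n. a n * u ^ n)) / (1 - u))"
proof -
  have au: "summable (\<lambda>n. a n * u ^ n)"
    by (rule summable_comparison_test'[OF a(1), of 0])
       (use a u in \<open>auto simp: abs_mult power_le_one intro!: mult_left_le\<close>)
  have gs: "(\<lambda>n. u ^ n) sums (1 / (1 - u))" using u by (intro geometric_sums) auto
  have "(\<lambda>n. \<Sum>i\<le>n. (a i * u ^ i) * u ^ (n - i)) sums ((\<Sum>n. a n * u ^ n) * (\<Sum>n. u ^ n))"
    by (rule Cauchy_product_sums) (use au gs a u in \<open>auto simp: sums_iff abs_mult\<close>)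
  also have "(\<lambda>n. \<Sum>i\<le>n. (a i * u ^ i) * u ^ (n - i)) = (\<lambda>n. sum a {..<Suc n} * u ^ n)"
    unfolding sum_distrib_right lessThan_Suc_atMost
    by (intro ext sum.cong) (auto simp: mult_ac power_add[symmetric])
  finally have "(\<lambda>n. suminf a * u ^ n - sum a {..<Suc n} * u ^ n) sums
      (suminf a * (1 / (1 - u)) - (\<Sum>n. a n * u ^ n) * (\<Sum>n. u ^ n))"
    by (intro sums_diff sums_mult gs)
  moreover have "suminf a * (1 / (1 - u)) - (\<Sum>n. a n * u ^ n) * (\<Sum>n. u ^ n)
      = (suminf a - (\<Sum>n. a n * u ^ n)) / (1 - u)"
    unfolding sums_unique[OF gs, symmetric] by (simp add: diff_divide_distrib)
  moreover have "(\<lambda>n. suminf a * u ^ n - sum a {..<Suc n} * u ^ n) = (\<lambda>n. tail a (Suc n) * u ^ n)"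
    by (simp only: tail_eq_diff[OF a(1)] left_diff_distrib)
  ultimately show ?thesis by simp
qed

section \<open>Regular variation and Karamata sums\<close>

text \<open>
  A limit from one-sided bounds that depend on a parameter \<open>e\<close>: each pair of bounds may miss the
  limit by an error that only vanishes when \<open>e\<close> tends to \<open>0\<close>. Every asymptotic statement below
  that involves a splitting point or a tolerance is proved this way.
\<close>

lemma tendsto_by_bounds:
  fixes f :: "'c \<Rightarrow> real" and U V :: "real \<Rightarrow> real"
  assumes up: "\<forall>\<^sub>F e in at_right 0. \<exists>h. (h \<longlongrightarrow> U e) F \<and> (\<forall>\<^sub>F n in F. f n \<le> h n)" "(U \<longlongrightarrow> c) (at_right 0)"
    and low: "\<forall>\<^sub>F e in at_right 0. \<exists>h. (h \<longlongrightarrow> V e) F \<and> (\<forall>\<^sub>F n in F. h n \<le> f n)" "(V \<longlongrightarrow> c) (at_right 0)"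
  shows "(f \<longlongrightarrow> c) F"
proof (rule order_tendstoI)
  fix b assume "b > c"
  then have "\<forall>\<^sub>F e in at_right 0. U e < b" using up(2) by (rule order_tendstoD(2)[rotated])
  with up(1) have "\<forall>\<^sub>F e in at_right 0. U e < b \<and> (\<exists>h. (h \<longlongrightarrow> U e) F \<and> (\<forall>\<^sub>F n in F. f n \<le> h n))"
    by eventually_elim auto
  then obtain e h where h: "U e < b" "(h \<longlongrightarrow> U e) F" "\<forall>\<^sub>F n in F. f n \<le> h n"
    using eventually_happens'[of "at_right (0::real)"] trivial_limit_at_right_real by blast
  have "\<forall>\<^sub>F n in F. h n < b" using order_tendstoD(2)[OF h(2,1)] .
  with h(3) show "\<forall>\<^sub>F n in F. f n < b" by eventually_elim auto
next
  fix b assume "b < c"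
  then have "\<forall>\<^sub>F e in at_right 0. b < V e" using low(2) by (rule order_tendstoD(1)[rotated])
  with low(1) have "\<forall>\<^sub>F e in at_right 0. b < V e \<and> (\<exists>h. (h \<longlongrightarrow> V e) F \<and> (\<forall>\<^sub>F n in F. h n \<le> f n))"
    by eventually_elim auto
  then obtain e h where h: "b < V e" "(h \<longlongrightarrow> V e) F" "\<forall>\<^sub>F n in F. h n \<le> f n"
    using eventually_happens'[of "at_right (0::real)"] trivial_limit_at_right_real by blast
  have "\<forall>\<^sub>F n in F. b < h n" using order_tendstoD(1)[OF h(2,1)] .
  with h(3) show "\<forall>\<^sub>F n in F. b < f n" by eventually_elim auto
qed

text \<open>
  Regular variation with index \<open>\<alpha>\<close>, with the uniformity in \<open>t\<close> on compact subsets of the positive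
  half-line built into the definition by letting the quotient of the arguments merely converge. It is
  needed because arguments are rounded to integers. For measurable functions it follows from
  pointwise convergence by the uniform convergence theorem; here it comes from monotonicity.
\<close>

definition regvar :: "real \<Rightarrow> (real \<Rightarrow> real) \<Rightarrow> bool" where
  "regvar \<alpha> r \<longleftrightarrow> (\<forall>\<^sub>F x in at_top. 0 < r x) \<and>
     (\<forall>(x :: nat \<Rightarrow> real) y t. filterlim x at_top sequentially \<longrightarrow> 0 < t \<longrightarrow>
        (\<lambda>n. y n / x n) \<longlonglongrightarrow> t \<longrightarrow> (\<lambda>n. r (y n) / r (x n)) \<longlonglongrightarrow> t powr \<alpha>)"

lemma regvar_pos: "regvar \<alpha> r \<Longrightarrow> \<forall>\<^sub>F x in at_top. 0 < r x"
  by (simp add: regvar_def)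

lemma regvar_pos_nat: "regvar \<alpha> r \<Longrightarrow> \<forall>\<^sub>F j in sequentially. 0 < r (real j)"
  by (rule eventually_compose_filterlim[OF regvar_pos filterlim_real_sequentially])

lemma regvar_ratio:
  "regvar \<alpha> r \<Longrightarrow> filterlim x at_top sequentially \<Longrightarrow> 0 < t \<Longrightarrow> (\<lambda>n. y n / x n) \<longlonglongrightarrow> t \<Longrightarrow>
     (\<lambda>n::nat. r (y n) / r (x n)) \<longlonglongrightarrow> t powr \<alpha>"
  by (auto simp: regvar_def)

lemma ratio_at_top:
  assumes "filterlim x at_top F" "((\<lambda>n. y n / x n) \<longlongrightarrow> t) F" "0 < (t::real)"
  shows "filterlim y at_top F"
proof -
  have "filterlim (\<lambda>n. y n / x n * x n) at_top F"
    by (rule filterlim_tendsto_pos_mult_at_top[OF assms(2,3,1)])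
  moreover have "\<forall>\<^sub>F n in F. y n / x n * x n = y n"
    using filterlim_at_top_dense[THEN iffD1, rule_format, OF assms(1), of 0] by eventually_elim simp
  ultimately show ?thesis by (simp cong: filterlim_cong)
qed

text \<open>
  Monotonicity squeezes the value at \<open>y n\<close> between those at two fixed multiples of \<open>x n\<close>; this
  is what makes the convergence locally uniform.
\<close>

lemma regvar_of_antimono:
  assumes mono: "\<And>x y. x \<le> y \<Longrightarrow> T y \<le> T x" and pos: "\<forall>\<^sub>F x in at_top. 0 < T x"
    and lim: "\<And>t. t > 0 \<Longrightarrow> ((\<lambda>x. T (t * x) / T x) \<longlongrightarrow> t powr \<alpha>) at_top"
  shows "regvar \<alpha> T"
  unfolding regvar_def
proof (intro conjI allI impI pos)
  fix x y :: "nat \<Rightarrow> real" and t :: real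
  assume x: "filterlim x at_top sequentially" and t: "0 < t" and yx: "(\<lambda>n. y n / x n) \<longlonglongrightarrow> t"
  have xpos: "\<forall>\<^sub>F n in sequentially. 0 < x n" "\<forall>\<^sub>F n in sequentially. 0 < T (x n)"
    using filterlim_at_top_dense[THEN iffD1, rule_format, OF x, of 0]
      eventually_compose_filterlim[OF pos x] by auto
  have lim': "(\<lambda>n. T (s * x n) / T (x n)) \<longlonglongrightarrow> s powr \<alpha>" if "s > 0" for s
    by (rule filterlim_compose[OF lim[OF that] x])
  have c: "((\<lambda>s. s powr \<alpha>) \<longlongrightarrow> t powr \<alpha>) (at t)" using t by (intro tendsto_intros) auto
  show "(\<lambda>n. T (y n) / T (x n)) \<longlonglongrightarrow> t powr \<alpha>"
  proof (rule order_tendstoI)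
    fix b assume "b < t powr \<alpha>"
    then have "\<forall>\<^sub>F s in at t. b < s powr \<alpha>" by (rule order_tendstoD(1)[OF c])
    then have "\<forall>\<^sub>F s in at_right t. b < s powr \<alpha>" by (rule filter_leD[OF at_le, rotated]) auto
    then obtain s where s: "s > t" "b < s powr \<alpha>"
      using eventually_happens'[OF _ eventually_conj[OF _ eventually_at_right_less[of t]]] by (metis trivial_limit_at_right_real)
    have "\<forall>\<^sub>F n in sequentially. y n / x n < s" by (rule order_tendstoD(2)[OF yx s(1)])
    moreover have "\<forall>\<^sub>F n in sequentially. b < T (s * x n) / T (x n)"
      by (rule order_tendstoD(1)[OF lim' s(2)]) (use s t in auto)
    ultimately show "\<forall>\<^sub>F n in sequentially. b < T (y n) / T (x n)" using xpos
    proof eventually_elim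
      case (elim n)
      then have "T (s * x n) \<le> T (y n)" by (intro mono) (simp add: field_simps)
      then have "T (s * x n) / T (x n) \<le> T (y n) / T (x n)" using elim by (intro divide_right_mono) auto
      then show ?case using elim by linarith
    qed
  next
    fix b assume "b > t powr \<alpha>"
    then have "\<forall>\<^sub>F s in at t. s powr \<alpha> < b" by (rule order_tendstoD(2)[OF c])
    then have "\<forall>\<^sub>F s in at_left t. s powr \<alpha> < b" by (rule filter_leD[OF at_le, rotated]) auto
    moreover have "\<forall>\<^sub>F s in at_left t. 0 < s \<and> s < t"
      using t by (intro eventually_at_leftI[of 0]) auto
    ultimately have "\<forall>\<^sub>F s in at_left t. s powr \<alpha> < b \<and> 0 < s \<and> s < t" by eventually_elim auto
    then obtain s where s: "0 < s" "s < t" "s powr \<alpha> < b"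
      using eventually_happens'[of "at_left t"] trivial_limit_at_left_real by blast
    have "\<forall>\<^sub>F n in sequentially. s < y n / x n" by (rule order_tendstoD(1)[OF yx s(2)])
    moreover have "\<forall>\<^sub>F n in sequentially. T (s * x n) / T (x n) < b"
      by (rule order_tendstoD(2)[OF lim'[OF s(1)] s(3)])
    ultimately show "\<forall>\<^sub>F n in sequentially. T (y n) / T (x n) < b" using xpos
    proof eventually_elim
      case (elim n)
      then have "T (y n) \<le> T (s * x n)" by (intro mono) (simp add: field_simps)
      then have "T (y n) / T (x n) \<le> T (s * x n) / T (x n)" using elim by (intro divide_right_mono) auto
      then show ?case using elim by linarith
    qed
  qed
qed

lemma regvar_equiv:
  assumes T: "regvar \<alpha> T" and pos: "\<forall>\<^sub>F x in at_top. 0 < s x" and lim: "((\<lambda>x. T x / s x) \<longlongrightarrow> 1) at_top"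
  shows "regvar \<alpha> s"
  unfolding regvar_def
proof (intro conjI allI impI pos)
  fix x y :: "nat \<Rightarrow> real" and t :: real
  assume x: "filterlim x at_top sequentially" and t: "0 < t" and yx: "(\<lambda>n. y n / x n) \<longlonglongrightarrow> t"
  have y: "filterlim y at_top sequentially" by (rule ratio_at_top[OF x yx t])
  have "(\<lambda>n. T (y n) / T (x n) * (T (x n) / s (x n)) / (T (y n) / s (y n))) \<longlonglongrightarrow> t powr \<alpha> * 1 / 1"
    by (intro tendsto_intros regvar_ratio[OF T x t yx] filterlim_compose[OF lim x]
        filterlim_compose[OF lim y]) auto
  then have "(\<lambda>n. T (y n) / T (x n) * (T (x n) / s (x n)) / (T (y n) / s (y n))) \<longlonglongrightarrow> t powr \<alpha>" by simp
  moreover have "\<forall>\<^sub>F n in sequentially. T (y n) / T (x n) * (T (x n) / s (x n)) / (T (y n) / s (y n)) = s (y n) / s (x n)"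
    using eventually_compose_filterlim[OF pos x] eventually_compose_filterlim[OF pos y]
      eventually_compose_filterlim[OF regvar_pos[OF T] x] eventually_compose_filterlim[OF regvar_pos[OF T] y]
    by eventually_elim (simp add: field_simps)
  ultimately show "(\<lambda>n. s (y n) / s (x n)) \<longlonglongrightarrow> t powr \<alpha>" by (simp cong: filterlim_cong)
qed

lemma regvar_powr_mult:
  assumes r: "regvar \<alpha> r"
  shows "regvar (\<beta> + \<alpha>) (\<lambda>x. x powr \<beta> * r x)"
  unfolding regvar_def
proof (intro conjI allI impI)
  show "\<forall>\<^sub>F x in at_top. 0 < x powr \<beta> * r x"
    using regvar_pos[OF r] eventually_gt_at_top[of 0] by eventually_elim simp
  fix x y :: "nat \<Rightarrow> real" and t :: real
  assume x: "filterlim x at_top sequentially" and t: "0 < t" and yx: "(\<lambda>n. y n / x n) \<longlonglongrightarrow> t"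
  have y: "filterlim y at_top sequentially" by (rule ratio_at_top[OF x yx t])
  have "(\<lambda>n. (y n / x n) powr \<beta> * (r (y n) / r (x n))) \<longlonglongrightarrow> t powr \<beta> * t powr \<alpha>"
    by (intro tendsto_intros regvar_ratio[OF r x t yx] yx) (use t in auto)
  then show "(\<lambda>n. y n powr \<beta> * r (y n) / (x n powr \<beta> * r (x n))) \<longlonglongrightarrow> t powr (\<beta> + \<alpha>)"
    unfolding powr_add
    by (rule Lim_transform_eventually)
       (use filterlim_at_top_dense[THEN iffD1, rule_format, OF x, of 0]
         filterlim_at_top_dense[THEN iffD1, rule_format, OF y, of 0] in eventually_elim, simp add: powr_divide)
qed

lemma regvar_inverse:
  assumes r: "regvar \<alpha> r"
  shows "regvar (- \<alpha>) (\<lambda>x. 1 / r x)"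
  unfolding regvar_def
proof (intro conjI allI impI)
  show "\<forall>\<^sub>F x in at_top. 0 < 1 / r x"
    using regvar_pos[OF r] by eventually_elim simp
  fix x y :: "nat \<Rightarrow> real" and t :: real
  assume x: "filterlim x at_top sequentially" and t: "0 < t" and yx: "(\<lambda>n. y n / x n) \<longlonglongrightarrow> t"
  have "(\<lambda>n. 1 / (r (y n) / r (x n))) \<longlonglongrightarrow> 1 / t powr \<alpha>"
    by (intro tendsto_intros regvar_ratio[OF r x t yx]) (use t in auto)
  then show "(\<lambda>n. 1 / r (y n) / (1 / r (x n))) \<longlonglongrightarrow> t powr (- \<alpha>)"
    by (simp add: powr_minus_divide)
qed

text \<open>One octave of the bound below: compactness of \<open>{1..2}\<close> turns the sequential definition into
  uniformity there.\<close>

lemma regvar_octave: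
  assumes r: "regvar \<alpha> r" and e: "\<epsilon> > 0"
  obtains x0 where "x0 \<ge> 1" "\<And>x. x \<ge> x0 \<Longrightarrow> 0 < r x"
    "\<And>x l. x \<ge> x0 \<Longrightarrow> 1 \<le> l \<Longrightarrow> l \<le> 2 \<Longrightarrow> r (l * x) \<le> (1 + \<epsilon>) * l powr \<alpha> * r x"
proof -
  obtain x1 where x1: "\<And>x. x \<ge> x1 \<Longrightarrow> 0 < r x"
    using regvar_pos[OF r] by (auto simp: eventually_at_top_linorder)
  have "\<exists>x0. \<forall>x\<ge>x0. \<forall>l\<in>{1..2}. r (l * x) \<le> (1 + \<epsilon>) * l powr \<alpha> * r x"
  proof (rule ccontr)
    assume "\<not> ?thesis"
    then have "\<forall>n::nat. \<exists>x l. x \<ge> real n \<and> l \<in> {1..2} \<and> r (l * x) > (1 + \<epsilon>) * l powr \<alpha> * r x"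
      by (meson not_le)
    then obtain X l where X: "\<And>n. X n \<ge> real n" and l: "\<And>n. l n \<in> {1..2}"
      and gt: "\<And>n. r (l n * X n) > (1 + \<epsilon>) * l n powr \<alpha> * r (X n)" by metis
    have "seq_compact {1..2::real}" by (simp add: compact_eq_seq_compact_metric[symmetric])
    then obtain t \<phi> where t: "t \<in> {1..2}" and \<phi>: "strict_mono \<phi>" "(l \<circ> \<phi>) \<longlonglongrightarrow> t"
      using l unfolding seq_compact_def by metis
    have X': "filterlim X at_top sequentially"
      by (rule filterlim_at_top_mono[OF filterlim_real_sequentially]) (use X in auto)
    have x: "filterlim (X \<circ> \<phi>) at_top sequentially"
      unfolding comp_def by (rule filterlim_compose[OF X' filterlim_subseq[OF \<phi>(1)]])
    have xp: "\<forall>\<^sub>F n in sequentially. 0 < (X \<circ> \<phi>) n"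
      using filterlim_at_top_dense[THEN iffD1, rule_format, OF x, of 0] .
    have "(\<lambda>n. (l (\<phi> n) * X (\<phi> n)) / (X \<circ> \<phi>) n) \<longlonglongrightarrow> t"
      using \<phi>(2) by (rule Lim_transform_eventually) (use xp in eventually_elim, auto)
    then have 1: "(\<lambda>n. r (l (\<phi> n) * X (\<phi> n)) / r ((X \<circ> \<phi>) n)) \<longlonglongrightarrow> t powr \<alpha>"
      using t by (intro regvar_ratio[OF r x]) auto
    have 2: "(\<lambda>n. (1 + \<epsilon>) * (l \<circ> \<phi>) n powr \<alpha>) \<longlonglongrightarrow> (1 + \<epsilon>) * t powr \<alpha>"
      using t by (intro tendsto_intros \<phi>(2)) auto
    have "(1 + \<epsilon>) * t powr \<alpha> \<le> t powr \<alpha>"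
    proof (rule tendsto_le[OF _ 1 2])
      show "\<forall>\<^sub>F n in sequentially. (1 + \<epsilon>) * (l \<circ> \<phi>) n powr \<alpha> \<le> r (l (\<phi> n) * X (\<phi> n)) / r ((X \<circ> \<phi>) n)"
        using eventually_compose_filterlim[OF regvar_pos[OF r] x]
        by eventually_elim (use gt in \<open>auto simp: le_divide_eq less_imp_le\<close>)
    qed auto
    moreover have "0 < \<epsilon> * t powr \<alpha>" using t e by simp
    ultimately show False by (simp add: algebra_simps)
  qed
  then obtain x0 where "\<forall>x\<ge>x0. \<forall>l\<in>{1..2}. r (l * x) \<le> (1 + \<epsilon>) * l powr \<alpha> * r x" ..
  then show thesis using that[of "max 1 (max x0 x1)"] x1 by auto
qed

text \<open>
  Potter's bound. An octave costs a factor \<open>1 + e'\<close> in addition to \<open>2 powr \<alpha>\<close>; since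
  \<open>1 + e' \<le> 2 powr \<epsilon>\<close>, these factors are absorbed by the exponent, except for the one of the
  last, incomplete octave. The leading constant thus tends to \<open>1\<close>, which makes the bound sharp
  enough to give Karamata's theorem directly.
\<close>

lemma potter_upper:
  assumes r: "regvar \<alpha> r" and e: "\<epsilon> > 0"
  obtains x0 where "x0 \<ge> 1" "\<And>x. x \<ge> x0 \<Longrightarrow> 0 < r x"
    "\<And>x y. x \<ge> x0 \<Longrightarrow> y \<ge> x \<Longrightarrow> r y \<le> (1 + \<epsilon>) * (y / x) powr (\<alpha> + \<epsilon>) * r x"
proof -
  define e' where "e' = min \<epsilon> (2 powr \<epsilon> - 1)"
  have "1 < 2 powr \<epsilon>" using e by simp
  then have e': "e' > 0" "e' \<le> \<epsilon>" "1 + e' \<le> 2 powr \<epsilon>" using e by (auto simp: e'_def)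
  obtain x0 where x0: "x0 \<ge> 1" "\<And>x. x \<ge> x0 \<Longrightarrow> 0 < r x"
    "\<And>x l. x \<ge> x0 \<Longrightarrow> 1 \<le> l \<Longrightarrow> l \<le> 2 \<Longrightarrow> r (l * x) \<le> (1 + e') * l powr \<alpha> * r x"
    using regvar_octave[OF r e'(1)] by metis
  have *: "r y \<le> (1 + e') * (y / x) powr (\<alpha> + \<epsilon>) * r x" if "x \<ge> x0" "x \<le> y" "y \<le> 2 ^ i * x" for i x y
    using that
  proof (induction i arbitrary: x)
    case 0
    then have "y = x" "r x > 0" using x0(2) by auto
    then show ?case using 0 e'(1) x0(1) by simp
  next
    case (Suc i)
    have xp: "x > 0" "r x > 0" using Suc x0(1) x0(2) by auto
    show ?case
    proof (cases "y \<le> 2 * x")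
      case True
      have "r (y / x * x) \<le> (1 + e') * (y / x) powr \<alpha> * r x"
        by (rule x0(3)) (use Suc xp True in \<open>auto simp: field_simps\<close>)
      also have "\<dots> \<le> (1 + e') * (y / x) powr (\<alpha> + \<epsilon>) * r x"
        using Suc xp e'(1) e by (intro mult_right_mono mult_left_mono powr_mono) auto
      finally show ?thesis using xp by simp
    next
      case False
      have "r y \<le> (1 + e') * (y / (2 * x)) powr (\<alpha> + \<epsilon>) * r (2 * x)"
        by (rule Suc.IH) (use Suc.prems False xp in auto)
      also have "\<dots> \<le> (1 + e') * (y / (2 * x)) powr (\<alpha> + \<epsilon>) * ((1 + e') * 2 powr \<alpha> * r x)"
        using x0(3)[of x 2] Suc.prems e' by (intro mult_left_mono) auto
      also have "\<dots> \<le> (1 + e') * (y / (2 * x)) powr (\<alpha> + \<epsilon>) * (2 powr \<epsilon> * 2 powr \<alpha> * r x)"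
        using e' xp by (intro mult_left_mono mult_right_mono) auto
      also have "\<dots> = (1 + e') * ((y / (2 * x)) powr (\<alpha> + \<epsilon>) * 2 powr (\<alpha> + \<epsilon>)) * r x"
        by (simp add: powr_add)
      also have "(y / (2 * x)) powr (\<alpha> + \<epsilon>) * 2 powr (\<alpha> + \<epsilon>) = (y / x) powr (\<alpha> + \<epsilon>)"
        using xp Suc.prems by (subst powr_mult[symmetric]) auto
      finally show ?thesis .
    qed
  qed
  show thesis
  proof (rule that[OF x0(1,2)])
    fix x y assume xy: "x \<ge> x0" "y \<ge> x"
    then have xp: "x > 0" using x0(1) by auto
    obtain i where "y / x < 2 ^ i" using real_arch_pow[of 2 "y / x"] by auto
    then have "y \<le> 2 ^ i * x" using xp by (simp add: field_simps)
    from *[OF xy this] have "r y \<le> (1 + e') * (y / x) powr (\<alpha> + \<epsilon>) * r x" .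
    also have "\<dots> \<le> (1 + \<epsilon>) * (y / x) powr (\<alpha> + \<epsilon>) * r x"
      using e' x0(2)[OF xy(1)] by (intro mult_right_mono) auto
    finally show "r y \<le> (1 + \<epsilon>) * (y / x) powr (\<alpha> + \<epsilon>) * r x" .
  qed
qed

lemma potter_lower:
  assumes r: "regvar \<alpha> r" and e: "\<epsilon> > 0"
  obtains x0 where "x0 \<ge> 1" "\<And>x. x \<ge> x0 \<Longrightarrow> 0 < r x"
    "\<And>x y. x \<ge> x0 \<Longrightarrow> y \<ge> x \<Longrightarrow> (y / x) powr (\<alpha> - \<epsilon>) * r x / (1 + \<epsilon>) \<le> r y"
proof -
  obtain x0 where x0: "x0 \<ge> 1" "\<And>x. x \<ge> x0 \<Longrightarrow> 0 < 1 / r x"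
    "\<And>x y. x \<ge> x0 \<Longrightarrow> y \<ge> x \<Longrightarrow> 1 / r y \<le> (1 + \<epsilon>) * (y / x) powr (- \<alpha> + \<epsilon>) * (1 / r x)"
    using potter_upper[OF regvar_inverse[OF r] e] by metis
  show thesis
  proof (rule that[OF x0(1)])
    show "0 < r x" if "x \<ge> x0" for x using x0(2)[OF that] by simp
    fix x y assume xy: "x \<ge> x0" "y \<ge> x"
    have p: "0 < r x" "0 < r y" "0 < y / x" using x0(2)[of x] x0(2)[of y] xy x0(1) by auto
    have m: "(y / x) powr (- \<alpha> + \<epsilon>) = 1 / (y / x) powr (\<alpha> - \<epsilon>)"
      using powr_minus_divide[of "y / x" "\<alpha> - \<epsilon>"] by (simp add: algebra_simps)
    define Z where "Z = (y / x) powr (\<alpha> - \<epsilon>)"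
    have "Z > 0" using p(3) unfolding Z_def powr_gt_zero by linarith
    from x0(3)[OF xy] show "(y / x) powr (\<alpha> - \<epsilon>) * r x / (1 + \<epsilon>) \<le> r y"
      unfolding m Z_def[symmetric] using p e \<open>Z > 0\<close> by (simp add: field_simps)
  qed
qed

lemma regvar_le_powr:
  assumes r: "regvar \<alpha> r" and b: "\<alpha> < \<beta>"
  shows "\<forall>\<^sub>F x in at_top. r x \<le> x powr \<beta>"
proof -
  define e where "e = (\<beta> - \<alpha>) / 2"
  have e: "e > 0" using b by (simp add: e_def)
  obtain x0 where x0: "x0 \<ge> 1" "\<And>x. x \<ge> x0 \<Longrightarrow> 0 < r x"
    "\<And>x y. x \<ge> x0 \<Longrightarrow> y \<ge> x \<Longrightarrow> r y \<le> (1 + e) * (y / x) powr (\<alpha> + e) * r x"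
    using potter_upper[OF r e] by metis
  define C where "C = (1 + e) * r x0 / x0 powr (\<alpha> + e)"
  have "filterlim (\<lambda>x::real. x powr e) at_top at_top" using e by real_asymp
  then have "\<forall>\<^sub>F x in at_top. C \<le> x powr e" by (simp add: filterlim_at_top)
  then show ?thesis using eventually_ge_at_top[of x0]
  proof eventually_elim
    case (elim x)
    have "r x \<le> (1 + e) * (x / x0) powr (\<alpha> + e) * r x0" using x0(3)[of x0 x] elim by auto
    also have "\<dots> = C * x powr (\<alpha> + e)"
      using x0(1) elim by (simp add: C_def powr_divide)
    also have "\<dots> \<le> x powr e * x powr (\<alpha> + e)" using elim by (intro mult_right_mono) auto
    also have "\<dots> = x powr \<beta>" by (simp add: e_def powr_add[symmetric])
    finally show ?case .
  qed
qed

lemma regvar_ge_powr: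
  assumes r: "regvar \<alpha> r" and b: "\<beta> < \<alpha>"
  shows "\<forall>\<^sub>F x in at_top. x powr \<beta> \<le> r x"
proof -
  have "\<forall>\<^sub>F x in at_top. 1 / r x \<le> x powr (- \<beta>)"
    using regvar_le_powr[OF regvar_inverse[OF r], of "- \<beta>"] b by simp
  then show ?thesis using regvar_pos[OF r] eventually_gt_at_top[of 0]
  proof eventually_elim
    case (elim x)
    have "1 / r x \<le> 1 / x powr \<beta>" using elim(1) by (simp only: powr_minus_divide)
    then show ?case using elim by (simp add: frac_le_eq divide_le_cancel) (simp add: field_simps)
  qed
qed

text \<open>
  The form in which regular variation is used below: the arguments of a sequence \<open>u\<close> may be replaced
  by proportional ones, at the price of a power of the factor.
\<close>

lemma quot_reindex:
  assumes r: "regvar \<alpha> r" and u: "(\<lambda>j. u j / r (real j)) \<longlonglongrightarrow> c"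
    and k: "(\<lambda>j. real (k j) / real j) \<longlonglongrightarrow> t" "t > 0"
  shows "(\<lambda>j. u (k j) / r (real j)) \<longlonglongrightarrow> c * t powr \<alpha>"
proof -
  have k': "filterlim (\<lambda>j. real (k j)) at_top sequentially"
    by (rule ratio_at_top[OF filterlim_real_sequentially k])
  then have k'': "filterlim k sequentially sequentially"
    by (simp add: filterlim_sequentially_iff_filterlim_real)
  have "(\<lambda>j. u (k j) / r (real (k j)) * (r (real (k j)) / r (real j))) \<longlonglongrightarrow> c * t powr \<alpha>"
    by (intro tendsto_mult filterlim_compose[OF u k'']
        regvar_ratio[OF r filterlim_real_sequentially k(2,1)])
  then show ?thesis
    by (rule Lim_transform_eventually)
       (use eventually_compose_filterlim[OF regvar_pos[OF r] k'] in eventually_elim, auto)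
qed

lemma quot_Suc_iff:
  assumes r: "regvar \<alpha> r"
  shows "(\<lambda>j. u (Suc j) / r (real j)) \<longlonglongrightarrow> c \<longleftrightarrow> (\<lambda>j. u j / r (real j)) \<longlonglongrightarrow> c"
proof
  assume "(\<lambda>j. u j / r (real j)) \<longlonglongrightarrow> c"
  moreover have "(\<lambda>j. real (Suc j) / real j) \<longlonglongrightarrow> 1" by real_asymp
  ultimately show "(\<lambda>j. u (Suc j) / r (real j)) \<longlonglongrightarrow> c"
    using quot_reindex[OF r, of u c Suc 1] by simp
next
  assume *: "(\<lambda>j. u (Suc j) / r (real j)) \<longlonglongrightarrow> c"
  have "(\<lambda>j. real (j - 1) / real j) \<longlonglongrightarrow> 1"
    by (rule Lim_transform_eventually[of "\<lambda>j. (real j - 1) / real j"])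
       (real_asymp, use eventually_ge_at_top[of 1] in eventually_elim, auto)
  then have "(\<lambda>j. u (Suc (j - 1)) / r (real j)) \<longlonglongrightarrow> c"
    using quot_reindex[OF r *, of "\<lambda>j. j - 1" 1] by simp
  then show "(\<lambda>j. u j / r (real j)) \<longlonglongrightarrow> c"
    by (rule Lim_transform_eventually) (use eventually_ge_at_top[of 1] in eventually_elim, auto)
qed

lemma powr_telescope_bounds:
  fixes x s :: real
  assumes "x > 0" "s > 1"
  shows "(x + 1) powr (- s) \<le> (x powr (1 - s) - (x + 1) powr (1 - s)) / (s - 1)"
    and "(x powr (1 - s) - (x + 1) powr (1 - s)) / (s - 1) \<le> x powr (- s)"
proof -
  have "\<exists>\<xi>>x. \<xi> < x + 1 \<and> (x + 1) powr (1 - s) - x powr (1 - s) = (x + 1 - x) * ((1 - s) * \<xi> powr (1 - s - 1))"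
    by (rule MVT2) (use assms has_real_derivative_powr[of _ "1 - s"] in auto)
  then obtain \<xi> where \<xi>: "x < \<xi>" "\<xi> < x + 1"
    "(x + 1) powr (1 - s) - x powr (1 - s) = (1 - s) * \<xi> powr (- s)" by auto
  have "x powr (1 - s) - (x + 1) powr (1 - s) = (s - 1) * \<xi> powr (- s)"
    using \<xi>(3) by (simp add: algebra_simps)
  then have eq: "(x powr (1 - s) - (x + 1) powr (1 - s)) / (s - 1) = \<xi> powr (- s)" using assms by simp
  show "(x + 1) powr (- s) \<le> (x powr (1 - s) - (x + 1) powr (1 - s)) / (s - 1)"
    unfolding eq using \<xi> assms by (intro powr_mono2') auto
  show "(x powr (1 - s) - (x + 1) powr (1 - s)) / (s - 1) \<le> x powr (- s)"
    unfolding eq using \<xi> assms by (intro powr_mono2') auto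
qed

lemma tail_powr_bounds:
  assumes s: "s > 1" and j: "j \<ge> 1"
  shows "summable (\<lambda>n. real n powr (- s))"
    and "tail (\<lambda>n. real n powr (- s)) (Suc j) \<le> real j powr (1 - s) / (s - 1)"
    and "real j powr (1 - s) / (s - 1) \<le> tail (\<lambda>n. real n powr (- s)) j"
proof -
  show sm: "summable (\<lambda>n. real n powr (- s))" using s by (simp add: summable_real_powr_iff)
  have lim: "(\<lambda>n. real (n + j) powr (1 - s) / (s - 1)) \<longlonglongrightarrow> 0" using s by real_asymp
  have t: "(\<lambda>n. (real (n + j) powr (1 - s) - (real (n + j) + 1) powr (1 - s)) / (s - 1)) sums (real j powr (1 - s) / (s - 1))"
    using telescope_sums'[OF lim] by (simp add: diff_divide_distrib add_ac)
  have p: "real (n + j) > 0" for n using j by simp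
  note b = powr_telescope_bounds[OF p s]
  show "tail (\<lambda>n. real n powr (- s)) (Suc j) \<le> real j powr (1 - s) / (s - 1)"
    unfolding tail_def sums_unique[OF t]
  proof (rule suminf_le)
    show "real (n + Suc j) powr (- s) \<le> (real (n + j) powr (1 - s) - (real (n + j) + 1) powr (1 - s)) / (s - 1)" for n
      using b(1)[of n] by (simp add: add_ac)
  qed (use t sm in \<open>auto simp: sums_iff simp del: of_nat_add add_Suc_right intro: summable_ignore_initial_segment\<close>)
  show "real j powr (1 - s) / (s - 1) \<le> tail (\<lambda>n. real n powr (- s)) j"
    unfolding tail_def sums_unique[OF t]
    by (rule suminf_le[OF b(2)])
       (use t sm in \<open>auto simp: sums_iff simp del: of_nat_add intro: summable_ignore_initial_segment\<close>)
qed

text \<open>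
  Karamata's theorem for sums. The sharp Potter bounds compare the summands with multiples of
  \<open>n powr (- s + e)\<close> and \<open>n powr (- s - e)\<close>, whose tails are known up to a telescoping error.
\<close>

lemma karamata_sum_self:
  assumes r: "regvar (- s) r" and s: "s > 1"
  shows "summable (\<lambda>n. r (real n))"
    and "(\<lambda>j. tail (\<lambda>n. r (real n)) j / (real j * r (real j))) \<longlonglongrightarrow> 1 / (s - 1)"
proof -
  have "\<forall>\<^sub>F x in at_top. r x \<le> x powr (- ((s + 1) / 2)) \<and> 0 < r x"
    using regvar_le_powr[OF r, of "- ((s + 1) / 2)"] regvar_pos[OF r] s
    by (intro eventually_conj) auto
  then have ev: "\<forall>\<^sub>F n in sequentially. norm (r (real n)) \<le> real n powr (- ((s + 1) / 2))"
    by (rule eventually_compose_filterlim[OF _ filterlim_real_sequentially, THEN eventually_mono]) auto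
  show sm: "summable (\<lambda>n. r (real n))"
    by (rule summable_comparison_test_ev[OF ev]) (use s in \<open>simp add: summable_real_powr_iff\<close>)
  let ?f = "\<lambda>j. tail (\<lambda>n. r (real n)) j / (real j * r (real j))"
  have e: "\<forall>\<^sub>F e in at_right 0. 0 < e \<and> e < s - 1"
    using s by (intro eventually_at_rightI[of 0 "s - 1"]) auto
  show "?f \<longlonglongrightarrow> 1 / (s - 1)"
  proof (rule tendsto_by_bounds[where U = "\<lambda>e. (1 + e) / (s - e - 1)" and V = "\<lambda>e. 1 / ((1 + e) * (s + e - 1))"])
    show "((\<lambda>e. (1 + e) / (s - e - 1)) \<longlongrightarrow> 1 / (s - 1)) (at_right 0)"
      using s by (auto intro!: tendsto_eq_intros)
    show "((\<lambda>e. 1 / ((1 + e) * (s + e - 1))) \<longlongrightarrow> 1 / (s - 1)) (at_right 0)"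
      using s by (auto intro!: tendsto_eq_intros)
    from e show "\<forall>\<^sub>F e in at_right 0. \<exists>h. h \<longlonglongrightarrow> (1 + e) / (s - e - 1) \<and> (\<forall>\<^sub>F n in sequentially. ?f n \<le> h n)"
    proof eventually_elim
      case (elim e)
      note eps = elim
      then have "0 < e" by simp
      from potter_upper[OF r this] obtain x0 where x0: "x0 \<ge> 1" "\<And>x. x \<ge> x0 \<Longrightarrow> 0 < r x"
        "\<And>x y. x \<ge> x0 \<Longrightarrow> y \<ge> x \<Longrightarrow> r y \<le> (1 + e) * (y / x) powr (- s + e) * r x" by metis
      show ?case
      proof (intro exI conjI)
        show "(\<lambda>j. 1 / real j + (1 + e) / (s - e - 1)) \<longlonglongrightarrow> (1 + e) / (s - e - 1)" by real_asymp
        have "\<forall>\<^sub>F j in sequentially. real j \<ge> x0"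
          using filterlim_real_sequentially by (simp add: filterlim_at_top)
        then show "\<forall>\<^sub>F j in sequentially. ?f j \<le> 1 / real j + (1 + e) / (s - e - 1)"
        proof eventually_elim
          case (elim j)
          have j: "j \<ge> 1" "real j > 0" using elim x0(1) by auto
          have rj: "r (real j) > 0" using x0(2) elim by auto
          let ?C = "(1 + e) * r (real j) * real j powr (s - e)"
          have "tail (\<lambda>n. r (real n)) (Suc j) \<le> tail (\<lambda>n. ?C * real n powr (- (s - e))) (Suc j)"
          proof (rule tail_mono)
            show "summable (\<lambda>n. ?C * real n powr (- (s - e)))"
              using eps by (intro summable_mult) (simp add: summable_real_powr_iff)
            fix n assume n: "n \<ge> Suc j"
            have "r (real n) \<le> (1 + e) * (real n / real j) powr (- s + e) * r (real j)"
              using n elim by (intro x0(3)) auto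
            also have "(real n / real j) powr (- s + e) = real n powr (- s + e) / real j powr (- s + e)"
              by (rule powr_divide)
            also have "- s + e = - (s - e)" by simp
            finally show "r (real n) \<le> ?C * real n powr (- (s - e))"
              by (simp only: powr_minus_divide[of "real j"]) (simp add: mult_ac)
          qed (rule sm)
          also have "\<dots> = ?C * tail (\<lambda>n. real n powr (- (s - e))) (Suc j)"
            using eps by (intro tail_cmult) (simp add: summable_real_powr_iff)
          also have "\<dots> \<le> ?C * (real j powr (1 - (s - e)) / (s - e - 1))"
            using eps j rj tail_powr_bounds(2)[of "s - e" j] by (intro mult_left_mono) auto
          also have "\<dots> = (1 + e) * r (real j) * (real j powr (s - e) * real j powr (1 - (s - e))) / (s - e - 1)"
            by simp
          also have "real j powr (s - e) * real j powr (1 - (s - e)) = real j"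
            using j by (subst powr_add[symmetric]) simp
          finally have "tail (\<lambda>n. r (real n)) j \<le> r (real j) + (1 + e) * r (real j) * real j / (s - e - 1)"
            by (simp add: tail_Suc[OF sm, of j])
          then have "?f j \<le> (r (real j) + (1 + e) * r (real j) * real j / (s - e - 1)) / (real j * r (real j))"
            using rj j by (intro divide_right_mono) auto
          also have "\<dots> = 1 / real j + (1 + e) / (s - e - 1)"
          proof -
            have "(q + X * q * x / d) / (x * q) = 1 / x + X / d" if "q > 0" "x > 0" for q x X d :: real
              using that by (simp add: add_divide_distrib)
            from this[OF rj j(2)] show ?thesis .
          qed
          finally show ?case .
        qed
      qed
    qed
    from e show "\<forall>\<^sub>F e in at_right 0. \<exists>h. h \<longlonglongrightarrow> 1 / ((1 + e) * (s + e - 1)) \<and> (\<forall>\<^sub>F n in sequentially. h n \<le> ?f n)"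
    proof eventually_elim
      case (elim e)
      note eps = elim
      then have "0 < e" by simp
      from potter_lower[OF r this] obtain x0 where x0: "x0 \<ge> 1" "\<And>x. x \<ge> x0 \<Longrightarrow> 0 < r x"
        "\<And>x y. x \<ge> x0 \<Longrightarrow> y \<ge> x \<Longrightarrow> (y / x) powr (- s - e) * r x / (1 + e) \<le> r y" by metis
      show ?case
      proof (intro exI conjI)
        show "(\<lambda>j. 1 / ((1 + e) * (s + e - 1))) \<longlonglongrightarrow> 1 / ((1 + e) * (s + e - 1))" by simp
        have "\<forall>\<^sub>F j in sequentially. real j \<ge> x0"
          using filterlim_real_sequentially by (simp add: filterlim_at_top)
        then show "\<forall>\<^sub>F j in sequentially. 1 / ((1 + e) * (s + e - 1)) \<le> ?f j"
        proof eventually_elim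
          case (elim j)
          have j: "j \<ge> 1" "real j > 0" using elim x0(1) by auto
          have rj: "r (real j) > 0" using x0(2) elim by auto
          let ?C = "r (real j) * real j powr (s + e) / (1 + e)"
          have "1 / ((1 + e) * (s + e - 1)) * (real j * r (real j)) = r (real j) * (real j powr (s + e) * real j powr (1 - (s + e))) / (1 + e) / (s + e - 1)"
            using j by (subst powr_add[symmetric]) simp
          also have "\<dots> = ?C * (real j powr (1 - (s + e)) / (s + e - 1))" by simp
          also have "\<dots> \<le> ?C * tail (\<lambda>n. real n powr (- (s + e))) j"
            using eps s j rj by (intro mult_left_mono tail_powr_bounds(3)) auto
          also have "\<dots> = tail (\<lambda>n. ?C * real n powr (- (s + e))) j"
            using eps s by (intro tail_cmult[symmetric]) (simp add: summable_real_powr_iff)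
          also have "\<dots> \<le> tail (\<lambda>n. r (real n)) j"
          proof (rule tail_mono)
            show "summable (\<lambda>n. ?C * real n powr (- (s + e)))"
              using eps s by (intro summable_mult) (simp add: summable_real_powr_iff)
            fix n assume n: "n \<ge> j"
            have "?C * real n powr (- (s + e)) = (real n powr (- (s + e)) / real j powr (- (s + e))) * r (real j) / (1 + e)"
              by (simp only: powr_minus_divide[of "real j"]) (simp add: mult_ac)
            also have "real n powr (- (s + e)) / real j powr (- (s + e)) = (real n / real j) powr (- (s + e))"
              by (rule powr_divide[symmetric])
            also have "(real n / real j) powr (- (s + e)) * r (real j) / (1 + e) \<le> r (real n)"
              using x0(3)[of "real j" "real n"] n elim by simp
            finally show "?C * real n powr (- (s + e)) \<le> r (real n)" .
          qed (rule sm)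
          finally show ?case using j rj by (simp add: le_divide_eq)
        qed
      qed
    qed
  qed
qed

lemma karamata_sum:
  assumes r: "regvar (- s) r" and s: "s > 1" and v: "(\<lambda>n. v n / r (real n)) \<longlonglongrightarrow> c"
  shows "summable v"
    and "(\<lambda>j. tail v j / (real j * r (real j))) \<longlonglongrightarrow> c / (s - 1)"
proof -
  note sr = karamata_sum_self[OF r s]
  have close: "\<forall>\<^sub>F n in sequentially. \<bar>v n - c * r (real n)\<bar> \<le> e * r (real n)" if "e > 0" for e
  proof -
    have "\<forall>\<^sub>F n in sequentially. \<bar>v n / r (real n) - c\<bar> < e"
      using tendstoD[OF v that] by (simp add: dist_real_def)
    then show ?thesis using regvar_pos_nat[OF r]
    proof eventually_elim
      case (elim n)
      have "\<bar>v n - c * r (real n)\<bar> = \<bar>v n / r (real n) - c\<bar> * r (real n)"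
        using elim by (simp add: abs_if field_simps)
      then show ?case using elim by (auto intro: mult_right_mono)
    qed
  qed
  have sd: "summable (\<lambda>n. \<bar>v n - c * r (real n)\<bar>)"
    by (rule summable_comparison_test_ev[of _ "\<lambda>n. 1 * r (real n)"])
       (use close[of 1] sr(1) in auto)
  have sd': "summable (\<lambda>n. v n - c * r (real n))" by (rule summable_rabs_cancel[OF sd])
  have "summable (\<lambda>n. (v n - c * r (real n)) + c * r (real n))"
    by (intro summable_add sd' summable_mult sr)
  then show sv: "summable v" by simp
  let ?D = "\<lambda>j. tail (\<lambda>n. \<bar>v n - c * r (real n)\<bar>) j / (real j * r (real j))"
  have D0: "\<forall>\<^sub>F j in sequentially. 0 \<le> ?D j"
    using regvar_pos_nat[OF r] by eventually_elim (auto intro!: divide_nonneg_nonneg tail_nonneg sd)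
  have D: "?D \<longlonglongrightarrow> 0"
  proof (rule tendsto_by_bounds[where U = "\<lambda>e. e * (1 / (s - 1))" and V = "\<lambda>_. 0"])
    show "((\<lambda>e. e * (1 / (s - 1))) \<longlongrightarrow> 0) (at_right 0)"
      using s by (auto intro!: tendsto_eq_intros)
    show "\<forall>\<^sub>F e in at_right (0::real). \<exists>h. h \<longlonglongrightarrow> 0 \<and> (\<forall>\<^sub>F n in sequentially. h n \<le> ?D n)"
      using D0 by (intro always_eventually allI exI[of _ "\<lambda>_. 0"]) auto
    show "\<forall>\<^sub>F e in at_right 0. \<exists>h. h \<longlonglongrightarrow> e * (1 / (s - 1)) \<and> (\<forall>\<^sub>F n in sequentially. ?D n \<le> h n)"
      using eventually_at_right_less[of "0::real"]
    proof eventually_elim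
      case (elim e)
      obtain N where N: "\<And>n. n \<ge> N \<Longrightarrow> \<bar>v n - c * r (real n)\<bar> \<le> e * r (real n)"
        using close[OF elim] by (auto simp: eventually_sequentially)
      have "\<forall>\<^sub>F j in sequentially. ?D j \<le> e * (tail (\<lambda>n. r (real n)) j / (real j * r (real j)))"
        using eventually_ge_at_top[of N] regvar_pos_nat[OF r]
      proof eventually_elim
        case (elim j)
        have "tail (\<lambda>n. \<bar>v n - c * r (real n)\<bar>) j \<le> tail (\<lambda>n. e * r (real n)) j"
          using elim N by (intro tail_mono sd summable_mult sr) auto
        also have "\<dots> = e * tail (\<lambda>n. r (real n)) j" by (rule tail_cmult[OF sr(1)])
        finally show ?case using elim by (simp add: divide_right_mono)
      qed
      moreover have "(\<lambda>j. e * (tail (\<lambda>n. r (real n)) j / (real j * r (real j)))) \<longlonglongrightarrow> e * (1 / (s - 1))"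
        by (intro tendsto_mult tendsto_const sr)
      ultimately show ?case by blast
    qed
  qed auto
  have "(\<lambda>j. tail (\<lambda>n. v n - c * r (real n)) j / (real j * r (real j))) \<longlonglongrightarrow> 0"
  proof (rule Lim_null_comparison[OF _ D])
    show "\<forall>\<^sub>F j in sequentially. norm (tail (\<lambda>n. v n - c * r (real n)) j / (real j * r (real j))) \<le> ?D j"
      using regvar_pos_nat[OF r]
    proof eventually_elim
      case (elim j)
      have "\<bar>tail (\<lambda>n. v n - c * r (real n)) j\<bar> \<le> tail (\<lambda>n. \<bar>v n - c * r (real n)\<bar>) j"
        unfolding tail_def
        by (intro summable_rabs summable_ignore_initial_segment[OF sd])
      then show ?case using elim by (simp add: abs_mult divide_right_mono)
    qed
  qed
  from tendsto_add[OF this tendsto_mult[OF tendsto_const[of c] sr(2)]]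
  have "(\<lambda>j. tail (\<lambda>n. v n - c * r (real n)) j / (real j * r (real j)) + c * (tail (\<lambda>n. r (real n)) j / (real j * r (real j)))) \<longlonglongrightarrow> c / (s - 1)"
    by simp
  moreover have "tail (\<lambda>n. v n - c * r (real n)) j / (real j * r (real j)) + c * (tail (\<lambda>n. r (real n)) j / (real j * r (real j))) = tail v j / (real j * r (real j))" for j
    using tail_add[OF sd' summable_mult[OF sr(1), of c], of j] tail_cmult[OF sr(1), of c j]
    by (simp add: add_divide_distrib)
  ultimately show "(\<lambda>j. tail v j / (real j * r (real j))) \<longlonglongrightarrow> c / (s - 1)" by simp
qed

section \<open>Tails of convolutions, fixed points and Panjer recursions\<close>

lemma nat_floor_ratio:
  assumes "0 < e" "e < 1"
  shows "(\<lambda>j. real (nat \<lfloor>e * real j\<rfloor>) / real j) \<longlonglongrightarrow> e"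
    and "(\<lambda>j. real (j - nat \<lfloor>e * real j\<rfloor>) / real j) \<longlonglongrightarrow> 1 - e"
    and "real (nat \<lfloor>e * real j\<rfloor>) \<le> e * real j" "nat \<lfloor>e * real j\<rfloor> \<le> j"
proof -
  have n: "real (nat \<lfloor>e * real j\<rfloor>) = real_of_int \<lfloor>e * real j\<rfloor>" for j using assms by simp
  show 1: "(\<lambda>j. real (nat \<lfloor>e * real j\<rfloor>) / real j) \<longlonglongrightarrow> e"
    unfolding n using assms by real_asymp
  show b: "real (nat \<lfloor>e * real j\<rfloor>) \<le> e * real j" for j unfolding n by linarith
  have "e * real j \<le> 1 * real j" for j using assms by (intro mult_right_mono) auto
  with b have "real (nat \<lfloor>e * real j\<rfloor>) \<le> real j" for j by (metis order_trans mult_1)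
  then show le: "nat \<lfloor>e * real j\<rfloor> \<le> j" for j by simp
  have "(\<lambda>j. 1 - real (nat \<lfloor>e * real j\<rfloor>) / real j) \<longlonglongrightarrow> 1 - e"
    by (intro tendsto_intros 1)
  then show "(\<lambda>j. real (j - nat \<lfloor>e * real j\<rfloor>) / real j) \<longlonglongrightarrow> 1 - e"
    by (rule Lim_transform_eventually)
       (use eventually_gt_at_top[of 0] in eventually_elim, use le in \<open>simp add: of_nat_diff diff_divide_distrib\<close>)
qed

lemma nat_floor_half:
  assumes "0 < e" "e < 1/2"
  shows "2 * nat \<lfloor>e * real j\<rfloor> \<le> j"
proof -
  have "real (nat \<lfloor>e * real j\<rfloor>) \<le> e * real j" using assms by (intro nat_floor_ratio(3)) auto
  also have "\<dots> \<le> 1/2 * real j" using assms by (intro mult_right_mono) auto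
  finally show ?thesis by linarith
qed

lemma nat_floor_at_top:
  assumes "0 < e" "e < 1"
  shows "filterlim (\<lambda>j. nat \<lfloor>e * real j\<rfloor>) at_top sequentially"
    and "filterlim (\<lambda>j. j - nat \<lfloor>e * real j\<rfloor>) at_top sequentially"
  using ratio_at_top[OF filterlim_real_sequentially nat_floor_ratio(1)[OF assms]]
    ratio_at_top[OF filterlim_real_sequentially nat_floor_ratio(2)[OF assms]] assms
  by (auto simp: filterlim_sequentially_iff_filterlim_real)

text \<open>
  A convolution is large when one of its factors is: two large indices at once contribute a product
  of two tails, which is of smaller order, and an index below \<open>e * j\<close> leaves at least \<open>(1 - e) * j\<close>
  for the other one, which costs only the factor \<open>(1 - e) powr \<alpha>\<close>. A limit \<open>c = 0\<close> is allowed and stands for a lighter tail.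
\<close>

lemma tail_conv_asymp:
  assumes r: "regvar \<alpha> r"
    and f: "summable f" "\<And>n. 0 \<le> f n" and g: "summable g" "\<And>n. 0 \<le> g n"
    and lf: "(\<lambda>j. tail f j / r (real j)) \<longlonglongrightarrow> c" and lg: "(\<lambda>j. tail g j / r (real j)) \<longlonglongrightarrow> d"
  shows "(\<lambda>j. tail (conv f g) j / r (real j)) \<longlonglongrightarrow> suminf f * d + suminf g * c"
proof (rule tendsto_by_bounds[where U = "\<lambda>e. suminf f * (d * (1 - e) powr \<alpha>) + suminf g * (c * (1 - e) powr \<alpha>)"
      and V = "\<lambda>_. suminf f * d + suminf g * c"])
  show "((\<lambda>e. suminf f * (d * (1 - e) powr \<alpha>) + suminf g * (c * (1 - e) powr \<alpha>)) \<longlongrightarrow> suminf f * d + suminf g * c) (at_right 0)"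
    by (auto intro!: tendsto_eq_intros)
  have "\<forall>\<^sub>F e in at_right 0. 0 < e \<and> e < (1/2 :: real)"
    by (intro eventually_at_rightI[of 0 "1/2"]) auto
  then show "\<forall>\<^sub>F e in at_right 0. \<exists>h. h \<longlonglongrightarrow> suminf f * (d * (1 - e) powr \<alpha>) + suminf g * (c * (1 - e) powr \<alpha>)
      \<and> (\<forall>\<^sub>F n in sequentially. tail (conv f g) n / r (real n) \<le> h n)"
  proof eventually_elim
    case (elim e)
    then have e: "0 < e" "e < 1" by auto
    define k where "k = (\<lambda>j. nat \<lfloor>e * real j\<rfloor>)"
    have k: "(\<lambda>j. real (k j) / real j) \<longlonglongrightarrow> e" "(\<lambda>j. real (j - k j) / real j) \<longlonglongrightarrow> 1 - e"
      unfolding k_def by (rule nat_floor_ratio(1,2)[OF e])+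
    have k2: "2 * k j \<le> j" for j unfolding k_def using elim by (intro nat_floor_half) auto
    have kt: "filterlim k sequentially sequentially" unfolding k_def by (rule nat_floor_at_top[OF e])
    let ?h = "\<lambda>j. suminf f * (tail g (j - k j) / r (real j)) + suminf g * (tail f (j - k j) / r (real j))
      + tail f (k j) / r (real j) * tail g (k j)"
    have "?h \<longlonglongrightarrow> suminf f * (d * (1 - e) powr \<alpha>) + suminf g * (c * (1 - e) powr \<alpha>) + (c * e powr \<alpha>) * 0"
      by (intro tendsto_add tendsto_mult tendsto_const quot_reindex[OF r lg k(2)] quot_reindex[OF r lf k(2)]
          quot_reindex[OF r lf k(1)] filterlim_compose[OF tail_tendsto_0[OF g(1)] kt]) (use e in auto)
    moreover have "\<forall>\<^sub>F n in sequentially. tail (conv f g) n / r (real n) \<le> ?h n"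
      using regvar_pos_nat[OF r]
    proof eventually_elim
      case (elim j)
      have "tail (conv f g) j / r (real j) \<le> (suminf f * tail g (j - k j) + suminf g * tail f (j - k j) + tail f (k j) * tail g (k j)) / r (real j)"
        using elim by (intro divide_right_mono tail_conv_upper f g k2) auto
      then show ?case by (simp add: add_divide_distrib)
    qed
    ultimately show ?case by auto
  qed
  let ?l = "\<lambda>j. suminf f * (tail g j / r (real j)) + suminf g * (tail f j / r (real j)) - tail f j * (tail g j / r (real j))"
  have "?l \<longlonglongrightarrow> suminf f * d + suminf g * c - 0 * d"
    by (intro tendsto_intros lf lg tail_tendsto_0 f)
  moreover have "\<forall>\<^sub>F n in sequentially. ?l n \<le> tail (conv f g) n / r (real n)"
    using regvar_pos_nat[OF r]
  proof eventually_elim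
    case (elim j)
    have "(suminf f * tail g j + suminf g * tail f j - tail f j * tail g j) / r (real j) \<le> tail (conv f g) j / r (real j)"
      using elim by (intro divide_right_mono tail_conv_lower f g) auto
    then show ?case by (simp add: add_divide_distrib diff_divide_distrib)
  qed
  ultimately show "\<forall>\<^sub>F e in at_right (0::real). \<exists>h. h \<longlonglongrightarrow> suminf f * d + suminf g * c \<and> (\<forall>\<^sub>F n in sequentially. h n \<le> tail (conv f g) n / r (real n))"
    by (intro always_eventually allI exI[of _ ?l]) auto
qed auto

text \<open>
  An a priori bound for a sequence whose terms are controlled by earlier ones; it makes the products
  of two tails in the arguments below negligible before any limit is known to exist.
\<close>

lemma bounded_by_contraction:
  fixes w :: "nat \<Rightarrow> real"
  assumes \<theta>: "0 \<le> \<theta>" "\<theta> < 1"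
    and step: "\<forall>\<^sub>F j in sequentially. \<forall>M. (\<forall>i<j. w i \<le> M) \<longrightarrow> w j \<le> C + \<theta> * M"
  shows "\<exists>M. \<forall>j. w j \<le> M"
proof -
  obtain j0 where j0: "\<And>j M. j \<ge> j0 \<Longrightarrow> (\<forall>i<j. w i \<le> M) \<Longrightarrow> w j \<le> C + \<theta> * M"
    using step by (auto simp: eventually_sequentially)
  define M where "M = max (C / (1 - \<theta>)) (Max (insert 0 (w ` {..<j0})))"
  have "C / (1 - \<theta>) \<le> M" by (simp add: M_def)
  then have C: "C + \<theta> * M \<le> M" using \<theta> by (simp add: field_simps)
  have "w j \<le> M" for j
  proof (induction j rule: less_induct)
    case (less j)
    show ?case
    proof (cases "j < j0")
      case True
      then have "w j \<le> Max (insert 0 (w ` {..<j0}))" by (intro Max_ge) auto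
      then show ?thesis by (simp add: M_def)
    next
      case False
      then show ?thesis using j0[of j M] less C by force
    qed
  qed
  then show ?thesis by blast
qed

text \<open>
  The upper limit \<open>l\<close> of \<open>w\<close> satisfies \<open>l \<le> B e + \<Theta> e * l\<close> for every small \<open>e\<close>, hence
  \<open>l \<le> c + \<rho> * l\<close>. The bound is stated through a majorant \<open>h\<close> that converges to \<open>c / (1 - \<rho>)\<close>.
\<close>

lemma limsup_contraction:
  fixes w :: "nat \<Rightarrow> real"
  assumes nonneg: "\<forall>\<^sub>F j in sequentially. 0 \<le> w j" and bdd: "\<And>j. w j \<le> M"
    and step: "\<forall>\<^sub>F e in at_right 0. \<exists>b \<theta> k. b \<longlonglongrightarrow> B e \<and> \<theta> \<longlonglongrightarrow> \<Theta> e \<and> filterlim k sequentially sequentially \<and>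
      (\<forall>\<^sub>F j in sequentially. 0 \<le> \<theta> j \<and> w j \<le> b j + \<theta> j * w (k j))"
    and B: "(B \<longlongrightarrow> c) (at_right 0)" and \<Theta>: "(\<Theta> \<longlongrightarrow> \<rho>) (at_right (0::real))" "\<rho> < 1"
  shows "\<exists>h. h \<longlonglongrightarrow> c / (1 - \<rho>) \<and> (\<forall>\<^sub>F j in sequentially. w j \<le> h j)"
proof -
  define S where "S = {m. \<forall>\<^sub>F j in sequentially. w j \<le> m}"
  define l where "l = Inf S"
  have S: "S \<noteq> {}" using bdd by (auto simp: S_def intro!: exI[of _ M])
  have S0: "0 \<le> m" if "m \<in> S" for m
  proof -
    have "\<forall>\<^sub>F j in sequentially. 0 \<le> m"
      using that[unfolded S_def, simplified] nonneg by eventually_elim auto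
    then show ?thesis by simp
  qed
  then have bb: "bdd_below S" by (rule bdd_belowI)
  have above: "\<forall>\<^sub>F j in sequentially. w j \<le> l + \<eta>" if "\<eta> > 0" for \<eta>
  proof -
    obtain m where "m \<in> S" "m < l + \<eta>"
      using cInf_lessD[OF S, of "l + \<eta>"] \<open>\<eta> > 0\<close> unfolding l_def by force
    then show ?thesis unfolding S_def by (auto elim!: eventually_mono)
  qed
  have "\<forall>\<^sub>F e in at_right 0. l \<le> B e + \<Theta> e * l"
    using step
  proof eventually_elim
    case (elim e)
    then obtain b \<theta> k where b: "b \<longlonglongrightarrow> B e" "\<theta> \<longlonglongrightarrow> \<Theta> e" "filterlim k sequentially sequentially"
      "\<forall>\<^sub>F j in sequentially. 0 \<le> \<theta> j \<and> w j \<le> b j + \<theta> j * w (k j)" by blast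
    have "l \<le> B e + \<Theta> e * (l + \<eta>) + \<eta>" if \<eta>: "\<eta> > 0" for \<eta>
    proof -
      have "(\<lambda>j. b j + \<theta> j * (l + \<eta>)) \<longlonglongrightarrow> B e + \<Theta> e * (l + \<eta>)"
        by (intro tendsto_intros b)
      from order_tendstoD(2)[OF this, of "B e + \<Theta> e * (l + \<eta>) + \<eta>"] \<eta>
      have "\<forall>\<^sub>F j in sequentially. b j + \<theta> j * (l + \<eta>) < B e + \<Theta> e * (l + \<eta>) + \<eta>" by simp
      moreover have "\<forall>\<^sub>F j in sequentially. w (k j) \<le> l + \<eta>"
        by (rule eventually_compose_filterlim[OF above[OF \<eta>] b(3)])
      ultimately have "\<forall>\<^sub>F j in sequentially. w j \<le> B e + \<Theta> e * (l + \<eta>) + \<eta>"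
        using b(4)
      proof eventually_elim
        case (elim j)
        have "\<theta> j * w (k j) \<le> \<theta> j * (l + \<eta>)" using elim by (intro mult_left_mono) auto
        then show ?case using elim by linarith
      qed
      then show ?thesis unfolding l_def by (intro cInf_lower bb) (simp add: S_def)
    qed
    then have "\<forall>\<^sub>F \<eta> in at_right 0. l \<le> B e + \<Theta> e * (l + \<eta>) + \<eta>"
      using eventually_at_right_less[of "0::real"] by (auto elim: eventually_mono)
    moreover have "((\<lambda>\<eta>. B e + \<Theta> e * (l + \<eta>) + \<eta>) \<longlongrightarrow> B e + \<Theta> e * (l + 0) + 0) (at_right 0)"
      by (intro tendsto_intros)
    ultimately show ?case using tendsto_lowerbound[of _ _ "at_right 0" l] by force
  qed
  moreover have "((\<lambda>e. B e + \<Theta> e * l) \<longlongrightarrow> c + \<rho> * l) (at_right 0)"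
    by (intro tendsto_intros B \<Theta>)
  ultimately have "l \<le> c + \<rho> * l" using tendsto_lowerbound[of _ _ "at_right 0" l] by force
  then have l: "l \<le> c / (1 - \<rho>)" using \<Theta>(2) by (simp add: field_simps)
  have *: "\<forall>\<^sub>F j in sequentially. w j \<le> x" if "x > c / (1 - \<rho>)" for x
    using above[of "x - l"] l that by auto
  show "\<exists>h. h \<longlonglongrightarrow> c / (1 - \<rho>) \<and> (\<forall>\<^sub>F j in sequentially. w j \<le> h j)"
  proof (intro exI conjI)
    show "(\<lambda>j. max (w j) (c / (1 - \<rho>))) \<longlonglongrightarrow> c / (1 - \<rho>)"
    proof (rule order_tendstoI)
      fix x assume "c / (1 - \<rho>) < x"
      moreover from dense[OF this] obtain y where y: "c / (1 - \<rho>) < y" "y < x" by auto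
      ultimately show "\<forall>\<^sub>F j in sequentially. max (w j) (c / (1 - \<rho>)) < x"
        using *[OF y(1)] by (auto elim!: eventually_mono)
    qed (auto simp: less_max_iff_disj)
  qed auto
qed

text \<open>
  The solution of \<open>f = g + a * f\<close> is the convolution of \<open>g\<close> with the geometric series of \<open>a\<close>. Instead
  of estimating convolution powers uniformly, the equation itself is passed to the limit: if \<open>l\<close> is
  the normalised tail of \<open>f\<close>, then \<open>l = cg + suminf f * ca + suminf a * l\<close>. Boundedness comes
  first, from \<open>suminf a * (1 - e) powr \<alpha> < 1\<close> for small \<open>e\<close>; then the lower bound holds for each \<open>j\<close>
  and the upper one in the limit.
\<close>

lemma tail_fixed_point_asymp:
  assumes r: "regvar \<alpha> r"
    and f: "summable f" "\<And>n. 0 \<le> f n" and g: "summable g" "\<And>n. 0 \<le> g n"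
    and a: "summable a" "\<And>n. 0 \<le> a n" "suminf a < 1"
    and eq: "\<And>n. f n = g n + conv a f n"
    and lg: "(\<lambda>j. tail g j / r (real j)) \<longlonglongrightarrow> cg" and la: "(\<lambda>j. tail a j / r (real j)) \<longlonglongrightarrow> ca"
  shows "(\<lambda>j. tail f j / r (real j)) \<longlonglongrightarrow> (cg + suminf f * ca) / (1 - suminf a)"
proof -
  let ?F = "suminf f" and ?A = "suminf a"
  define w where "w = (\<lambda>j. tail f j / r (real j))"
  note ca = conv_sums[OF a(1) f(1) a(2) f(2)]
  have feq: "tail f j = tail g j + tail (conv a f) j" for j
  proof -
    have "f = (\<lambda>n. g n + conv a f n)" using eq by auto
    then have "tail f j = tail (\<lambda>n. g n + conv a f n) j" by simp
    then show ?thesis using tail_add[OF g(1) ca(1)] by simp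
  qed
  have t0: "0 \<le> tail f j" "0 \<le> tail a j" for j using tail_nonneg f a by auto
  have A0: "0 \<le> ?A" and F0: "0 \<le> ?F" using a f suminf_nonneg by auto
  have wpos: "\<forall>\<^sub>F j in sequentially. 0 \<le> w j"
    using regvar_pos_nat[OF r] by eventually_elim (auto simp: w_def t0)
  have e_small: "\<forall>\<^sub>F e in at_right 0. 0 < e \<and> e < (1/2 :: real)"
    by (intro eventually_at_rightI[of 0 "1/2"]) auto
  have Th: "((\<lambda>e. ?A * (1 - e) powr \<alpha>) \<longlongrightarrow> ?A) (at_right 0)"
    by (auto intro!: tendsto_eq_intros)
  define b where "b = (\<lambda>e j. (tail g j + ?F * tail a (j - nat \<lfloor>e * real j\<rfloor>)) / r (real j))"
  define \<theta> where "\<theta> = (\<lambda>e j. ?A * (r (real (j - nat \<lfloor>e * real j\<rfloor>)) / r (real j)))"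
  have step: "\<forall>\<^sub>F j in sequentially. 0 \<le> \<theta> e j \<and> 0 < r (real (k j)) \<and> 0 < r (real (j - k j)) \<and> 0 < r (real j) \<and>
      w j \<le> b e j + \<theta> e j * w (j - k j) + tail a (k j) * tail f (k j) / r (real j)"
    and blim: "b e \<longlonglongrightarrow> cg + ?F * (ca * (1 - e) powr \<alpha>)"
    and \<theta>lim: "\<theta> e \<longlonglongrightarrow> ?A * (1 - e) powr \<alpha>"
    if e: "0 < e" "e < 1/2" and k: "k = (\<lambda>j. nat \<lfloor>e * real j\<rfloor>)" for e k
  proof -
    have e1: "0 < e" "e < 1" "0 < 1 - e" using e by auto
    have kr: "(\<lambda>j. real (k j) / real j) \<longlonglongrightarrow> e" "(\<lambda>j. real (j - k j) / real j) \<longlonglongrightarrow> 1 - e"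
      unfolding k by (rule nat_floor_ratio(1,2)[OF e1(1,2)])+
    have k2: "2 * k j \<le> j" for j unfolding k by (rule nat_floor_half[OF e])
    note kt = nat_floor_at_top[OF e1(1,2)]
    show "\<forall>\<^sub>F j in sequentially. 0 \<le> \<theta> e j \<and> 0 < r (real (k j)) \<and> 0 < r (real (j - k j)) \<and> 0 < r (real j) \<and>
      w j \<le> b e j + \<theta> e j * w (j - k j) + tail a (k j) * tail f (k j) / r (real j)"
      using regvar_pos_nat[OF r] eventually_compose_filterlim[OF regvar_pos_nat[OF r] kt(1)]
        eventually_compose_filterlim[OF regvar_pos_nat[OF r] kt(2)]
    proof eventually_elim
      case (elim j)
      have "w j \<le> (tail g j + (?A * tail f (j - k j) + ?F * tail a (j - k j) + tail a (k j) * tail f (k j))) / r (real j)"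
        unfolding w_def feq[of j] using elim by (intro divide_right_mono add_left_mono tail_conv_upper f a k2) auto
      then show ?case using elim A0
        by (simp add: b_def \<theta>_def k w_def add_divide_distrib)
    qed
    show "b e \<longlonglongrightarrow> cg + ?F * (ca * (1 - e) powr \<alpha>)"
    proof -
      have "(\<lambda>j. tail g j / r (real j) + ?F * (tail a (j - k j) / r (real j))) \<longlonglongrightarrow> cg + ?F * (ca * (1 - e) powr \<alpha>)"
        by (intro tendsto_add tendsto_mult tendsto_const lg quot_reindex[OF r la kr(2)] e1)
      then show ?thesis by (simp add: b_def k add_divide_distrib)
    qed
    show "\<theta> e \<longlonglongrightarrow> ?A * (1 - e) powr \<alpha>"
      using tendsto_mult[OF tendsto_const[of ?A] regvar_ratio[OF r filterlim_real_sequentially e1(3) kr(2)]]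
      by (simp add: \<theta>_def k)
  qed
  have "\<exists>M. \<forall>j. w j \<le> M"
  proof -
    \<comment> \<open>The coefficient of the contraction is a number between \<open>?A\<close> and \<open>1\<close>.\<close>
    have "\<forall>\<^sub>F e in at_right 0. ?A * (1 - e) powr \<alpha> < (?A + 1) / 2"
      using order_tendstoD(2)[OF Th, of "(?A + 1) / 2"] a(3) by auto
    then have "\<forall>\<^sub>F e in at_right 0. (0 < e \<and> e < 1/2) \<and> ?A * (1 - e) powr \<alpha> < (?A + 1) / 2"
      by (rule eventually_conj[OF e_small])
    then obtain e where e: "0 < e" "e < 1/2" "?A * (1 - e) powr \<alpha> < (?A + 1) / 2"
      using eventually_happens'[of "at_right (0::real)"] trivial_limit_at_right_real by blast
    define k where "k = (\<lambda>j. nat \<lfloor>e * real j\<rfloor>)"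
    have e1: "0 < e" "e < 1" using e by auto
    have kr: "(\<lambda>j. real (k j) / real j) \<longlonglongrightarrow> e"
      unfolding k_def by (rule nat_floor_ratio(1)[OF e1])
    have kt: "filterlim k sequentially sequentially" unfolding k_def by (rule nat_floor_at_top[OF e1])
    define \<theta>' where "\<theta>' = (\<lambda>j. \<theta> e j + tail a (k j) * (r (real (k j)) / r (real j)))"
    have "\<theta>' \<longlonglongrightarrow> ?A * (1 - e) powr \<alpha> + 0 * e powr \<alpha>"
      unfolding \<theta>'_def
      by (intro tendsto_add tendsto_mult tendsto_const \<theta>lim[OF e(1,2) refl] filterlim_compose[OF tail_tendsto_0[OF a(1)] kt]
         regvar_ratio[OF r filterlim_real_sequentially _ kr] e)
    then have th: "\<forall>\<^sub>F j in sequentially. \<theta>' j < (?A + 1) / 2"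
      using e(3) by (intro order_tendstoD(2)) auto
    define C where "C = cg + ?F * (ca * (1 - e) powr \<alpha>) + 1"
    have bb: "\<forall>\<^sub>F j in sequentially. b e j < C"
      unfolding C_def by (rule order_tendstoD(2)[OF blim[OF e(1,2) refl]]) simp
    have kpos: "\<forall>\<^sub>F j in sequentially. 1 \<le> k j"
      using kt by (simp add: filterlim_at_top)
    show ?thesis
    proof (rule bounded_by_contraction[where \<theta> = "(?A + 1) / 2" and C = C])
      show "\<forall>\<^sub>F j in sequentially. \<forall>M. (\<forall>i<j. w i \<le> M) \<longrightarrow> w j \<le> C + (?A + 1) / 2 * M"
        using step[OF e(1,2) k_def] th bb kpos eventually_compose_filterlim[OF wpos kt]
      proof eventually_elim
        case (elim j)
        show ?case
        proof (intro allI impI)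
          fix M assume M: "\<forall>i<j. w i \<le> M"
          have "2 * k j \<le> j" unfolding k_def by (rule nat_floor_half[OF e(1,2)])
          then have kj: "k j < j" "j - k j < j" using elim by auto
          have M0: "0 \<le> M" using M kj(1) elim by force
          have "tail a (k j) * tail f (k j) / r (real j) = tail a (k j) * (r (real (k j)) / r (real j)) * w (k j)"
            using elim by (simp add: w_def)
          also have "\<dots> \<le> tail a (k j) * (r (real (k j)) / r (real j)) * M"
          proof (rule mult_left_mono)
            show "w (k j) \<le> M" using M kj(1) by simp
            show "0 \<le> tail a (k j) * (r (real (k j)) / r (real j))"
              by (rule mult_nonneg_nonneg[OF t0(2)]) (use elim in simp)
          qed
          finally have "w j \<le> b e j + \<theta> e j * w (j - k j) + tail a (k j) * (r (real (k j)) / r (real j)) * M"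
            using elim by linarith
          also have "\<dots> \<le> C + \<theta> e j * M + tail a (k j) * (r (real (k j)) / r (real j)) * M"
            using elim M kj by (intro add_right_mono add_mono mult_left_mono) auto
          also have "\<dots> = C + \<theta>' j * M" by (simp add: \<theta>'_def algebra_simps)
          also have "\<dots> \<le> C + (?A + 1) / 2 * M"
            using elim M0 by (intro add_left_mono mult_right_mono) auto
          finally show "w j \<le> C + (?A + 1) / 2 * M" .
        qed
      qed
    qed (use a A0 in auto)
  qed
  then obtain M where M: "\<And>j. w j \<le> M" by blast
  have prod0: "(\<lambda>j. tail a j * tail f j / r (real j)) \<longlonglongrightarrow> 0"
  proof (rule Lim_null_comparison)
    show "\<forall>\<^sub>F j in sequentially. norm (tail a j * tail f j / r (real j)) \<le> tail a j * M"
      using wpos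
    proof eventually_elim
      case (elim j)
      have "norm (tail a j * tail f j / r (real j)) = tail a j * w j"
        using abs_of_nonneg[OF mult_nonneg_nonneg[OF t0(2)[of j] elim]] by (simp add: w_def)
      then show ?case using M[of j] t0(2)[of j] by (simp add: mult_left_mono)
    qed
    show "(\<lambda>j. tail a j * M) \<longlonglongrightarrow> 0"
      using tendsto_mult[OF tail_tendsto_0[OF a(1)] tendsto_const[of M]] by simp
  qed
  have up: "\<exists>h. h \<longlonglongrightarrow> (cg + ?F * ca) / (1 - ?A) \<and> (\<forall>\<^sub>F j in sequentially. w j \<le> h j)"
  proof (rule limsup_contraction[OF wpos M])
    show "((\<lambda>e. cg + ?F * (ca * (1 - e) powr \<alpha>)) \<longlongrightarrow> cg + ?F * ca) (at_right 0)"
      by (auto intro!: tendsto_eq_intros)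
    show "\<forall>\<^sub>F e in at_right 0. \<exists>b \<theta> k. b \<longlonglongrightarrow> cg + ?F * (ca * (1 - e) powr \<alpha>) \<and> \<theta> \<longlonglongrightarrow> ?A * (1 - e) powr \<alpha>
      \<and> filterlim k sequentially sequentially \<and> (\<forall>\<^sub>F j in sequentially. 0 \<le> \<theta> j \<and> w j \<le> b j + \<theta> j * w (k j))"
      using e_small
    proof eventually_elim
      case (elim e)
      then have e: "0 < e" "e < 1/2" "e < 1" by auto
      define k where "k = (\<lambda>j. nat \<lfloor>e * real j\<rfloor>)"
      have kr: "(\<lambda>j. real (k j) / real j) \<longlonglongrightarrow> e"
        unfolding k_def by (rule nat_floor_ratio(1)[OF e(1,3)])
      have "(\<lambda>j. b e j + tail a (k j) * tail f (k j) / r (real j)) \<longlonglongrightarrow> cg + ?F * (ca * (1 - e) powr \<alpha>) + 0 * e powr \<alpha>"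
        by (intro tendsto_add blim[OF e(1,2) refl] quot_reindex[OF r prod0 kr e(1)])
      moreover have "filterlim (\<lambda>j. j - k j) sequentially sequentially"
        unfolding k_def by (rule nat_floor_at_top[OF e(1,3)])
      moreover have "\<forall>\<^sub>F j in sequentially. 0 \<le> \<theta> e j \<and> w j \<le> (b e j + tail a (k j) * tail f (k j) / r (real j)) + \<theta> e j * w (j - k j)"
        using step[OF e(1,2) k_def] by eventually_elim auto
      ultimately show ?case using \<theta>lim[OF e(1,2) refl] by auto
    qed
  qed (use Th a in auto)
  then obtain h where h: "h \<longlonglongrightarrow> (cg + ?F * ca) / (1 - ?A)" "\<forall>\<^sub>F j in sequentially. w j \<le> h j" by blast
  have "w \<longlonglongrightarrow> (cg + ?F * ca) / (1 - ?A)"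
  proof (rule tendsto_sandwich[OF _ h(2) _ h(1)])
    let ?l = "\<lambda>j. (tail g j / r (real j) + ?F * (tail a j / r (real j))) / (1 - ?A + tail a j)"
    have "?l \<longlonglongrightarrow> (cg + ?F * ca) / (1 - ?A + 0)"
      by (intro tendsto_intros lg la tail_tendsto_0 a) (use a in auto)
    then show "?l \<longlonglongrightarrow> (cg + ?F * ca) / (1 - ?A)" by simp
    show "\<forall>\<^sub>F j in sequentially. ?l j \<le> w j"
      using regvar_pos_nat[OF r]
    proof eventually_elim
      case (elim j)
      have p: "0 < 1 - ?A + tail a j" using a(3) t0(2)[of j] by linarith
      have "tail g j + ?F * tail a j \<le> tail f j * (1 - ?A + tail a j)"
        using tail_conv_lower[OF a(1,2) f, of j] feq[of j] by (simp add: algebra_simps)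
      then have "(tail g j + ?F * tail a j) / r (real j) \<le> tail f j * (1 - ?A + tail a j) / r (real j)"
        using elim by (intro divide_right_mono) auto
      then have "tail g j / r (real j) + ?F * (tail a j / r (real j)) \<le> w j * (1 - ?A + tail a j)"
        by (simp add: w_def add_divide_distrib)
      then show ?case by (simp only: pos_divide_le_eq[OF p])
    qed
  qed
  then show ?thesis by (simp add: w_def)
qed

lemma tail_shift: "tail f (Suc j) = tail (\<lambda>n. f (Suc n)) j"
  by (simp add: tail_def)

text \<open>
  The recursion is the coefficient form of \<open>q' = f q\<close> for generating functions. It says that the
  size-biased weights \<open>n * q n\<close> are a convolution of \<open>f\<close> and \<open>q\<close>. Size-biasing gains a factor \<open>j\<close>,
  so the tail of \<open>q\<close> is at most \<open>1 / j\<close> times that of the convolution; by contraction it is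
  negligible against \<open>j * r j\<close>, and the tail of the convolution is asymptotically that of \<open>f\<close> times
  \<open>suminf q\<close>. Summation by parts removes the size bias: the boundary term contributes
  \<open>c * suminf q\<close> and the remaining sum takes away \<open>c * suminf q / a\<close>.
\<close>

lemma tail_panjer_asymp:
  assumes r: "regvar (- a) r" and a: "a > 1"
    and f: "summable f" "\<And>n. 0 \<le> f n" and q: "summable q" "\<And>n. 0 \<le> q n"
    and rec: "\<And>n. real (Suc n) * q (Suc n) = conv f q n"
    and lf: "(\<lambda>j. tail f j / (real j * r (real j))) \<longlonglongrightarrow> c"
  shows "(\<lambda>j. tail q j / r (real j)) \<longlonglongrightarrow> (1 - 1 / a) * c * suminf q"
proof -
  let ?F = "suminf f" and ?Q = "suminf q"
  define r1 where "r1 = (\<lambda>x. x powr 1 * r x)"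
  have r1: "regvar (1 + - a) r1" unfolding r1_def by (rule regvar_powr_mult[OF r])
  have r1n: "r1 (real j) = real j * r (real j)" for j by (simp add: r1_def)
  have lf1: "(\<lambda>j. tail f j / r1 (real j)) \<longlonglongrightarrow> c" using lf by (simp add: r1n)
  define W where "W = tail (conv f q)"
  note cs = conv_sums[OF f(1) q(1) f(2) q(2)]
  have c0: "0 \<le> conv f q n" for n by (rule conv_nonneg[OF f(2) q(2)])
  have W0: "0 \<le> W j" for j unfolding W_def by (rule tail_nonneg[OF cs(1) c0])
  have F0: "0 \<le> ?F" and Q0: "0 \<le> ?Q" using q f suminf_nonneg by auto
  have t0: "0 \<le> tail f j" "0 \<le> tail q j" for j using tail_nonneg f q by auto
  have sq: "summable (\<lambda>n. q (Suc n))" using q(1) by (subst summable_Suc_iff)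
  have qW: "real (Suc j) * tail q (Suc j) \<le> W j" for j
  proof -
    have "real (Suc j) * tail q (Suc j) = tail (\<lambda>n. real (Suc j) * q (Suc n)) j"
      unfolding tail_shift by (rule tail_cmult[OF sq, symmetric])
    also have "\<dots> \<le> W j" unfolding W_def
    proof (rule tail_mono[OF cs(1) summable_mult[OF sq]])
      fix n assume "j \<le> n"
      then have "real (Suc j) * q (Suc n) \<le> real (Suc n) * q (Suc n)" using q(2) by (intro mult_right_mono) auto
      then show "real (Suc j) * q (Suc n) \<le> conv f q n" by (simp only: rec)
    qed
    finally show ?thesis .
  qed
  define w where "w = (\<lambda>j. W j / r1 (real j))"
  \<comment> \<open>\<open>Suc (k j)\<close> is the splitting point \<open>j div 2\<close>; the shift matches the one in \<open>qW\<close>.\<close>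
  define k where "k = (\<lambda>j::nat. j div 2 - 1)"
  have kr: "(\<lambda>j. real (k j) / real j) \<longlonglongrightarrow> 1/2"
  proof (rule tendsto_sandwich)
    show "\<forall>\<^sub>F j in sequentially. (real j / 2 - 2) / real j \<le> real (k j) / real j"
      unfolding k_def by (intro always_eventually allI divide_right_mono) linarith+
    show "\<forall>\<^sub>F j in sequentially. real (k j) / real j \<le> (real j / 2) / real j"
      unfolding k_def by (intro always_eventually allI divide_right_mono) linarith+
  qed real_asymp+
  have kr': "(\<lambda>j. real (Suc (k j)) / real j) \<longlonglongrightarrow> 1/2"
    using tendsto_add[OF kr, of "\<lambda>j. 1 / real j" 0] by (simp add: add_divide_distrib add.commute lim_1_over_n)
  have kt: "filterlim k sequentially sequentially"
    using ratio_at_top[OF filterlim_real_sequentially kr] by (simp add: filterlim_sequentially_iff_filterlim_real)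
  have "\<exists>M. \<forall>j. w j \<le> M"
  proof -
    define b where "b = (\<lambda>j. ?Q * (tail f (Suc (k j)) / r1 (real j)))"
    define \<theta> where "\<theta> = (\<lambda>j. 2 * ?F / real (Suc (k j)) * (r1 (real (k j)) / r1 (real j)))"
    have b: "b \<longlonglongrightarrow> ?Q * (c * (1/2) powr (1 + - a))"
      unfolding b_def by (intro tendsto_mult tendsto_const quot_reindex[OF r1 lf1 kr']) auto
    have "(\<lambda>n. 2 * ?F * (1 / real (Suc n))) \<longlonglongrightarrow> 2 * ?F * 0" by (intro tendsto_mult tendsto_const) real_asymp
    then have "(\<lambda>n. 2 * ?F / real (Suc n)) \<longlonglongrightarrow> 0" by simp
    then have "(\<lambda>j. 2 * ?F / real (Suc (k j))) \<longlonglongrightarrow> 0" by (rule filterlim_compose[OF _ kt])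
    then have "\<theta> \<longlonglongrightarrow> 0 * (1/2) powr (1 + - a)"
      unfolding \<theta>_def by (intro tendsto_mult regvar_ratio[OF r1 filterlim_real_sequentially _ kr]) auto
    then have th: "\<forall>\<^sub>F j in sequentially. \<theta> j < 1/2" by (intro order_tendstoD(2)) auto
    define C where "C = ?Q * (c * (1/2) powr (1 + - a)) + 1"
    have bb: "\<forall>\<^sub>F j in sequentially. b j < C" unfolding C_def by (rule order_tendstoD(2)[OF b]) simp
    show ?thesis
    proof (rule bounded_by_contraction[where \<theta> = "1/2" and C = C])
      show "\<forall>\<^sub>F j in sequentially. \<forall>M. (\<forall>i<j. w i \<le> M) \<longrightarrow> w j \<le> C + 1/2 * M"
        using bb th regvar_pos_nat[OF r1] eventually_compose_filterlim[OF regvar_pos_nat[OF r1] kt] eventually_ge_at_top[of 2]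
      proof eventually_elim
        case (elim j)
        show ?case
        proof (intro allI impI)
          fix M assume M: "\<forall>i<j. w i \<le> M"
          let ?k = "Suc (k j)"
          have kj: "k j < j" "2 * ?k \<le> j" "?k \<le> j - ?k" using elim by (auto simp: k_def)
          have "0 \<le> w (k j)" using elim W0[of "k j"] by (simp add: w_def)
          then have M0: "0 \<le> M" using M kj(1) by (meson order_trans)
          have "W j \<le> ?F * tail q (j - ?k) + ?Q * tail f (j - ?k) + tail f ?k * tail q ?k"
            unfolding W_def by (rule tail_conv_upper[OF f q kj(2)])
          also have "\<dots> \<le> ?F * tail q ?k + ?Q * tail f ?k + ?F * tail q ?k"
            using kj F0 Q0 t0 by (intro add_mono mult_left_mono mult_right_mono tail_antimono f q tail_le_suminf) auto
          also have "\<dots> = ?Q * tail f ?k + 2 * ?F * tail q ?k" by simp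
          also have "\<dots> \<le> ?Q * tail f ?k + 2 * ?F * (W (k j) / real ?k)"
            using qW[of "k j"] F0 by (intro add_left_mono mult_left_mono) (auto simp: field_simps)
          finally have "w j \<le> (?Q * tail f ?k + 2 * ?F * (W (k j) / real ?k)) / r1 (real j)"
            unfolding w_def using elim by (intro divide_right_mono) auto
          also have "\<dots> = b j + \<theta> j * w (k j)"
            using elim by (simp add: b_def \<theta>_def w_def add_divide_distrib)
          also have "\<dots> \<le> b j + \<theta> j * M"
            using M kj(1) elim F0 by (intro add_left_mono mult_left_mono) (auto simp: \<theta>_def)
          also have "\<dots> \<le> C + 1/2 * M"
            using elim M0 by (intro add_mono mult_right_mono) auto
          finally show "w j \<le> C + 1/2 * M" .
        qed
      qed
    qed auto
  qed
  then obtain M where M: "\<And>j. w j \<le> M" by blast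
  have "(\<lambda>j. tail q (Suc j) / r1 (real j)) \<longlonglongrightarrow> 0"
  proof (rule Lim_null_comparison)
    show "(\<lambda>j. M / real (Suc j)) \<longlonglongrightarrow> 0" by real_asymp
    show "\<forall>\<^sub>F j in sequentially. norm (tail q (Suc j) / r1 (real j)) \<le> M / real (Suc j)"
      using regvar_pos_nat[OF r1]
    proof eventually_elim
      case (elim j)
      have "tail q (Suc j) / r1 (real j) \<le> W j / real (Suc j) / r1 (real j)"
        using qW[of j] elim by (intro divide_right_mono) (auto simp: field_simps)
      also have "\<dots> = w j / real (Suc j)" by (simp add: w_def)
      also have "\<dots> \<le> M / real (Suc j)" using M by (intro divide_right_mono) auto
      finally show ?case using elim t0(2)[of "Suc j"] by simp
    qed
  qed
  then have "(\<lambda>j. tail q j / r1 (real j)) \<longlonglongrightarrow> 0" by (simp add: quot_Suc_iff[OF r1])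
  from tail_conv_asymp[OF r1 f q lf1 this]
  have lW: "(\<lambda>j. W j / r1 (real j)) \<longlonglongrightarrow> ?Q * c" by (simp add: W_def)
  \<comment> \<open>The increments of \<open>1 / n\<close>, which summation by parts puts in front of \<open>W\<close>.\<close>
  define v where "v = (\<lambda>n. W (Suc n) / (real (Suc n) * real (Suc (Suc n))))"
  have r2: "regvar (- (a + 1)) (\<lambda>x. x powr (-1) * r x)"
    using regvar_powr_mult[OF r, of "-1"] by (simp only: minus_add_distrib add.commute)
  have "(\<lambda>n. W (Suc n) / r1 (real n) * (real n * real n / (real (Suc n) * real (Suc (Suc n))))) \<longlonglongrightarrow> ?Q * c * 1"
  proof (intro tendsto_mult)
    show "(\<lambda>n. W (Suc n) / r1 (real n)) \<longlonglongrightarrow> ?Q * c" using lW by (simp add: quot_Suc_iff[OF r1])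
    show "(\<lambda>n. real n * real n / (real (Suc n) * real (Suc (Suc n)))) \<longlonglongrightarrow> 1" by real_asymp
  qed
  then have "(\<lambda>n. v n / (real n powr (-1) * r (real n))) \<longlonglongrightarrow> ?Q * c * 1"
    by (rule Lim_transform_eventually)
       (use eventually_gt_at_top[of 0] in eventually_elim, simp add: v_def r1n powr_minus_divide)
  then have lv0: "(\<lambda>n. v n / (real n powr (-1) * r (real n))) \<longlonglongrightarrow> ?Q * c" by simp
  have a1: "a + 1 > 1" using a by simp
  note lv = karamata_sum[OF r2 a1 lv0]
  have lv': "(\<lambda>j. tail v j / r (real j)) \<longlonglongrightarrow> ?Q * c / a"
    using lv(2) unfolding add_diff_cancel_right' by (rule Lim_transform_eventually)
       (use eventually_gt_at_top[of 0] in eventually_elim, simp add: powr_minus_divide)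
  have tele: "tail q (Suc j) = W j / real (Suc j) - tail v j" for j
  proof -
    have lim: "(\<lambda>n. W (n + j) / real (Suc (n + j))) \<longlonglongrightarrow> 0"
    proof -
      have "(\<lambda>n. W n * (1 / real (Suc n))) \<longlonglongrightarrow> 0 * 0"
        unfolding W_def by (intro tendsto_mult tail_tendsto_0 cs) real_asymp
      then have "(\<lambda>n. W n / real (Suc n)) \<longlonglongrightarrow> 0" by simp
      then show ?thesis by (rule LIMSEQ_ignore_initial_segment)
    qed
    have "(\<lambda>n. W (n + j) / real (Suc (n + j)) - W (Suc n + j) / real (Suc (Suc n + j))) sums (W (0 + j) / real (Suc (0 + j)) - 0)"
      by (rule telescope_sums'[OF lim])
    moreover have "W (n + j) / real (Suc (n + j)) - W (Suc n + j) / real (Suc (Suc n + j)) = q (Suc (n + j)) + v (n + j)" for n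
    proof -
      have "W (n + j) = real (Suc (n + j)) * q (Suc (n + j)) + W (Suc (n + j))"
        unfolding W_def rec by (rule tail_Suc[OF cs(1)])
      then have "W (n + j) / real (Suc (n + j)) = q (Suc (n + j)) + W (Suc (n + j)) / real (Suc (n + j))"
        by (simp only: add_divide_distrib) simp
      moreover have "W (Suc (n + j)) / real (Suc (n + j)) - W (Suc (n + j)) / real (Suc (Suc (n + j))) = v (n + j)"
        by (simp add: v_def field_simps)
      ultimately show ?thesis by simp
    qed
    ultimately have 1: "(\<lambda>n. q (Suc (n + j)) + v (n + j)) sums (W j / real (Suc j))" by simp
    have 2: "(\<lambda>n. q (Suc (n + j))) sums tail q (Suc j)"
      unfolding tail_def using summable_ignore_initial_segment[OF q(1), of "Suc j"] by (simp add: summable_sums)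
    have 3: "(\<lambda>n. v (n + j)) sums tail v j"
      unfolding tail_def using summable_ignore_initial_segment[OF lv(1), of j] by (rule summable_sums)
    from sums_unique2[OF 1 sums_add[OF 2 3]] show ?thesis by simp
  qed
  have "(\<lambda>j. (W j / r1 (real j)) * (real j / real (Suc j)) - tail v j / r (real j)) \<longlonglongrightarrow> ?Q * c * 1 - ?Q * c / a"
    by (intro tendsto_diff tendsto_mult lW lv') real_asymp
  then have "(\<lambda>j. tail q (Suc j) / r (real j)) \<longlonglongrightarrow> ?Q * c * 1 - ?Q * c / a"
    by (rule Lim_transform_eventually)
       (use eventually_gt_at_top[of 0] in eventually_elim, simp add: tele r1n diff_divide_distrib)
  then show ?thesis by (simp add: quot_Suc_iff[OF r] algebra_simps)
qed

section \<open>Panjer sequences and compound Poisson laws\<close>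

lemma power_series_continuous:
  assumes "summable a" "\<And>n. 0 \<le> a n"
  shows "continuous_on {0..1::real} (\<lambda>z. \<Sum>n. a n * z ^ n)"
proof -
  have "uniform_limit {0..1::real} (\<lambda>N z. \<Sum>n<N. a n * z ^ n) (\<lambda>z. \<Sum>n. a n * z ^ n) sequentially"
    by (rule Weierstrass_m_test[OF _ assms(1)])
       (use assms(2) in \<open>auto simp: abs_mult power_abs intro!: mult_left_le power_le_one\<close>)
  then show ?thesis
    by (rule uniform_limit_theorem[rotated]) (auto intro!: continuous_intros always_eventually)
qed

lemma power_series_at_left_1:
  assumes "summable a" "\<And>n. 0 \<le> a n"
  shows "((\<lambda>z::real. \<Sum>n. a n * z ^ n) \<longlongrightarrow> suminf a) (at_left 1)"
proof -
  have "((\<lambda>z::real. \<Sum>n. a n * z ^ n) \<longlongrightarrow> (\<Sum>n. a n * 1 ^ n)) (at 1 within {0..1})"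
    by (rule power_series_continuous[OF assms, unfolded continuous_on_def, rule_format]) simp
  then show ?thesis by (simp add: at_within_Icc_at_left)
qed

lemma summable_power_le_1:
  assumes "summable a" "\<And>n. 0 \<le> a n" "0 \<le> (z::real)" "z \<le> 1"
  shows "summable (\<lambda>n. a n * z ^ n)"
  by (rule summable_comparison_test'[OF assms(1), of 0])
     (use assms in \<open>auto simp: abs_mult power_le_one intro!: mult_left_le\<close>)

lemma sum_tail_lessThan:
  "summable g \<Longrightarrow> (\<Sum>n<N. tail g n) = (\<Sum>n<N. real (Suc n) * g n) + real N * tail g N"
proof (induction N)
  case (Suc N)
  then show ?case using tail_Suc[OF Suc.prems, of N] by (simp add: algebra_simps)
qed simp

text \<open>
  Exchange of the order of summation; in terms of a random variable, the expectation is the sum of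
  the tail probabilities.
\<close>

lemma tail_of_tail:
  assumes g: "summable (\<lambda>n. real (Suc n) * g n)" "\<And>n. 0 \<le> g n"
  shows "summable g" "tail g sums (\<Sum>n. real (Suc n) * g n)"
    "tail (\<lambda>n. real (Suc n) * g n) N = real N * tail g N + tail (tail g) N"
proof -
  show sg: "summable g"
    by (rule summable_comparison_test'[OF g(1), of 0]) (use g(2) in \<open>auto simp: algebra_simps\<close>)
  have "(\<lambda>N. real N * tail g N) \<longlonglongrightarrow> 0"
  proof (rule tendsto_sandwich[OF _ _ tendsto_const tail_tendsto_0[OF g(1)]])
    show "\<forall>\<^sub>F n in sequentially. 0 \<le> real n * tail g n"
      by (intro always_eventually allI mult_nonneg_nonneg tail_nonneg sg g(2)) auto
    show "\<forall>\<^sub>F n in sequentially. real n * tail g n \<le> tail (\<lambda>n. real (Suc n) * g n) n"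
    proof (intro always_eventually allI)
      fix N
      have "real N * tail g N = tail (\<lambda>n. real N * g n) N" by (rule tail_cmult[OF sg, symmetric])
      also have "\<dots> \<le> tail (\<lambda>n. real (Suc n) * g n) N"
        by (rule tail_mono[OF g(1) summable_mult[OF sg]]) (use g(2) in \<open>auto intro!: mult_right_mono\<close>)
      finally show "real N * tail g N \<le> tail (\<lambda>n. real (Suc n) * g n) N" .
    qed
  qed
  then have "(\<lambda>N. (\<Sum>n<N. real (Suc n) * g n) + real N * tail g N) \<longlonglongrightarrow> (\<Sum>n. real (Suc n) * g n) + 0"
    by (intro tendsto_add summable_LIMSEQ[OF g(1)])
  then show s: "tail g sums (\<Sum>n. real (Suc n) * g n)"
    unfolding sums_def sum_tail_lessThan[OF sg] by simp
  then show "tail (\<lambda>n. real (Suc n) * g n) N = real N * tail g N + tail (tail g) N"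
    using tail_eq_diff[OF g(1), of N] tail_eq_diff[of "tail g" N] sum_tail_lessThan[OF sg, of N]
    by (simp add: sums_iff)
qed

text \<open>
  The power series with constant term \<open>c\<close> and logarithmic derivative \<open>\<Sum>i. f i * z ^ i\<close>. For
  compound Poisson laws this is Panjer's recursion.
\<close>

fun panjer :: "real \<Rightarrow> (nat \<Rightarrow> real) \<Rightarrow> nat \<Rightarrow> real" where
  "panjer c f 0 = c"
| "panjer c f (Suc n) = (\<Sum>i\<le>n. f i * panjer c f (n - i)) / real (Suc n)"

lemma panjer_conv: "real (Suc n) * panjer c f (Suc n) = conv f (panjer c f) n"
  by (simp add: conv_def)

lemma panjer_nonneg: "0 \<le> c \<Longrightarrow> (\<And>i. 0 \<le> f i) \<Longrightarrow> 0 \<le> panjer c f n"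
proof (induction n rule: less_induct)
  case (less n)
  then show ?case by (cases n) (auto intro!: sum_nonneg divide_nonneg_pos)
qed

lemma panjer_mono: "0 \<le> c \<Longrightarrow> (\<And>i. 0 \<le> f i) \<Longrightarrow> (\<And>i. f i \<le> g i) \<Longrightarrow> panjer c f n \<le> panjer c g n"
proof (induction n rule: less_induct)
  case (less n)
  show ?case
  proof (cases n)
    case (Suc m)
    have "(\<Sum>i\<le>m. f i * panjer c f (m - i)) \<le> (\<Sum>i\<le>m. g i * panjer c g (m - i))"
      using less Suc by (intro sum_mono mult_mono panjer_nonneg) (auto intro: order_trans)
    then show ?thesis using Suc by (simp add: divide_right_mono)
  qed simp
qed

text \<open>
  Exponential moments of a Panjer sequence are ordinary sums of another one.
\<close>

lemma panjer_scale: "panjer c (\<lambda>i. f i * R ^ Suc i) n = panjer c f n * R ^ n"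
proof (induction n rule: less_induct)
  case (less n)
  show ?case
  proof (cases n)
    case (Suc m)
    have "(\<Sum>i\<le>m. f i * R ^ Suc i * panjer c (\<lambda>i. f i * R ^ Suc i) (m - i)) = (\<Sum>i\<le>m. f i * panjer c f (m - i) * R ^ Suc m)"
    proof (intro sum.cong refl)
      fix i assume i: "i \<in> {..m}"
      have "panjer c (\<lambda>i. f i * R ^ Suc i) (m - i) = panjer c f (m - i) * R ^ (m - i)"
        by (rule less) (use Suc in auto)
      moreover have "R ^ Suc m = R ^ Suc i * R ^ (m - i)" using i by (simp add: power_add[symmetric])
      ultimately show "f i * R ^ Suc i * panjer c (\<lambda>i. f i * R ^ Suc i) (m - i) = f i * panjer c f (m - i) * R ^ Suc m"
        by (simp only: mult_ac)
    qed
    then show ?thesis using Suc by (simp add: sum_distrib_right)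
  qed simp
qed

lemma panjer_bounded:
  assumes "0 \<le> c" "\<And>i. 0 \<le> f i" "summable f"
  shows "\<exists>M. \<forall>n. panjer c f n \<le> M"
proof (rule bounded_by_contraction[where \<theta> = "1/2" and C = 0])
  have "\<forall>\<^sub>F j in sequentially. 2 * suminf f \<le> real j"
    using filterlim_real_sequentially by (simp add: filterlim_at_top)
  then show "\<forall>\<^sub>F j in sequentially. \<forall>M. (\<forall>i<j. panjer c f i \<le> M) \<longrightarrow> panjer c f j \<le> 0 + 1/2 * M"
    using eventually_gt_at_top[of 0]
  proof eventually_elim
    case (elim j)
    show ?case
    proof (intro allI impI)
      fix M assume M: "\<forall>i<j. panjer c f i \<le> M"
      obtain n where n: "j = Suc n" using elim by (cases j) auto
      have "0 \<le> panjer c f 0" using assms(1) by simp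
      then have M0: "0 \<le> M" using M elim by (meson order_trans)
      have "real j * panjer c f j = (\<Sum>i\<le>n. f i * panjer c f (n - i))" by (simp add: n)
      also have "\<dots> \<le> (\<Sum>i\<le>n. f i * M)" using M n assms(2) by (intro sum_mono mult_left_mono) auto
      also have "\<dots> \<le> suminf f * M"
        unfolding sum_distrib_right[symmetric] using assms M0 by (intro mult_right_mono sum_le_suminf) auto
      also have "\<dots> \<le> (real j / 2) * M" using elim M0 by (intro mult_right_mono) auto
      finally show "panjer c f j \<le> 0 + 1/2 * M" using elim by (simp add: field_simps)
    qed
  qed
qed auto

text \<open>
  The quotient of the two sides has derivative zero on the open unit interval, by the differential
  equation that the recursion encodes.
\<close>

lemma panjer_sums_open:
  assumes c: "0 \<le> c" and f: "\<And>i. 0 \<le> f i" "summable f" and z: "0 \<le> z" "z < 1"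
  shows "(\<lambda>n. panjer c f n * z ^ n) sums (c * exp (\<Sum>i. f i / real (Suc i) * z ^ Suc i))"
proof -
  let ?q = "panjer c f"
  define p where "p = (\<lambda>n. case n of 0 \<Rightarrow> 0 | Suc i \<Rightarrow> f i / real (Suc i))"
  obtain M where M: "\<And>n. ?q n \<le> M" using panjer_bounded[OF c f] by blast
  have q0: "0 \<le> ?q n" for n by (rule panjer_nonneg[OF c f(1)])
  have sumq: "summable (\<lambda>n. ?q n * x ^ n)" if "\<bar>x\<bar> < 1" for x
  proof (rule summable_comparison_test'[of "\<lambda>n. M * \<bar>x\<bar> ^ n" 0])
    show "norm (?q n * x ^ n) \<le> M * \<bar>x\<bar> ^ n" for n
      using M[of n] q0[of n] by (auto simp: abs_mult power_abs intro!: mult_right_mono)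
  qed (use that in \<open>auto intro!: summable_mult summable_geometric\<close>)
  have sumf: "summable (\<lambda>n. f n * x ^ n)" if "\<bar>x\<bar> < 1" for x
    by (rule summable_comparison_test'[OF f(2), of 0])
       (use that f in \<open>auto simp: abs_mult power_abs intro!: mult_left_le power_le_one\<close>)
  have sump: "summable (\<lambda>n. p n * x ^ n)" if x: "\<bar>x\<bar> < 1" for x
  proof (subst summable_Suc_iff[symmetric], rule summable_comparison_test'[OF f(2), of 0])
    fix n
    have "\<bar>p (Suc n) * x ^ Suc n\<bar> = f n / real (Suc n) * \<bar>x\<bar> ^ Suc n"
      using f(1)[of n] by (simp add: p_def abs_mult power_abs)
    also have "\<dots> \<le> f n / real (Suc n) * 1"
      using x f(1)[of n] power_le_one[of "\<bar>x\<bar>" "Suc n"] by (intro mult_left_mono) auto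
    also have "\<dots> \<le> f n / 1" using f(1)[of n] by (simp only: mult_1_right) (intro divide_left_mono, auto)
    finally show "norm (p (Suc n) * x ^ Suc n) \<le> f n" by simp
  qed
  have dp: "diffs p = f" by (auto simp: diffs_def p_def)
  have dq: "diffs ?q = conv f ?q" by (intro ext) (simp only: diffs_def panjer_conv)
  define G where "G = (\<lambda>x. (\<Sum>n. ?q n * x ^ n) * exp (- (\<Sum>n. p n * x ^ n)))"
  have dG: "(G has_real_derivative 0) (at x)" if x: "\<bar>x\<bar> < 1" for x
  proof -
    define K where "K = (\<bar>x\<bar> + 1) / 2"
    have K: "\<bar>K\<bar> < 1" "norm x < norm K" using x by (auto simp: K_def)
    have 1: "((\<lambda>x. \<Sum>n. ?q n * x ^ n) has_real_derivative (\<Sum>n. diffs ?q n * x ^ n)) (at x)"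
      by (rule termdiffs_strong[OF sumq[OF K(1)] K(2)])
    have 2: "((\<lambda>x. \<Sum>n. p n * x ^ n) has_real_derivative (\<Sum>n. diffs p n * x ^ n)) (at x)"
      by (rule termdiffs_strong[OF sump[OF K(1)] K(2)])
    have ax: "\<bar>\<bar>x\<bar>\<bar> < 1" using x by simp
    have "(\<lambda>n. conv (\<lambda>n. f n * x ^ n) (\<lambda>n. ?q n * x ^ n) n) sums ((\<Sum>n. f n * x ^ n) * (\<Sum>n. ?q n * x ^ n))"
      unfolding conv_def
      by (rule Cauchy_product_sums)
         (use sumf[OF ax] sumq[OF ax] f(1) q0 in \<open>auto simp: abs_mult power_abs\<close>)
    then have 3: "(\<Sum>n. diffs ?q n * x ^ n) = (\<Sum>n. f n * x ^ n) * (\<Sum>n. ?q n * x ^ n)"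
      unfolding dq conv_power by (simp add: sums_iff)
    show ?thesis
      unfolding G_def
      by (rule DERIV_cong[OF DERIV_mult[OF 1 DERIV_chain2[OF DERIV_exp DERIV_minus[OF 2]]]])
         (simp add: 3 dp)
  qed
  have "\<exists>k. \<forall>x\<in>{-1<..<1}. G x = k"
    by (rule has_field_derivative_zero_constant)
       (auto intro!: has_field_derivative_at_within dG)
  then obtain k where k: "\<And>x. -1 < x \<Longrightarrow> x < 1 \<Longrightarrow> G x = k" by auto
  have "G z = G 0" using k[of z] k[of 0] z by simp
  moreover have "G 0 = c"
    by (simp add: G_def p_def powser_zero)
  moreover have "(\<Sum>n. p n * z ^ n) = (\<Sum>i. f i / real (Suc i) * z ^ Suc i)"
    using suminf_split_head[OF sump[of z]] z by (simp add: p_def)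
  ultimately have "(\<Sum>n. ?q n * z ^ n) * exp (- (\<Sum>i. f i / real (Suc i) * z ^ Suc i)) = c"
    by (simp add: G_def)
  then have "(\<Sum>n. ?q n * z ^ n) = c * exp (\<Sum>i. f i / real (Suc i) * z ^ Suc i)"
    by (simp add: exp_minus field_simps)
  then show ?thesis using sumq[of z] z by (simp add: sums_iff)
qed

text \<open>
  The point \<open>1\<close> is reached from the left: nonnegativity bounds the partial sums there by the limit,
  and both sides are then continuous.
\<close>

lemma panjer_sums:
  assumes c: "0 \<le> c" and f: "\<And>i. 0 \<le> f i" "summable f" and z: "0 \<le> z" "z \<le> 1"
  shows "(\<lambda>n. panjer c f n * z ^ n) sums (c * exp (\<Sum>i. f i / real (Suc i) * z ^ Suc i))"
proof (cases "z = 1")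
  case False
  then show ?thesis using panjer_sums_open[OF c f] z by auto
next
  case True
  let ?q = "panjer c f"
  define p where "p = (\<lambda>i. f i / real (Suc i))"
  have p: "summable p" "0 \<le> p i" for i
    by (rule summable_comparison_test'[OF f(2), of 0]) (use f in \<open>auto simp: p_def field_simps\<close>)
  have q0: "0 \<le> ?q n" for n by (rule panjer_nonneg[OF c f(1)])
  define E where "E = (\<lambda>z. c * exp (z * (\<Sum>i. p i * z ^ i)))"
  have E: "(\<lambda>n. ?q n * x ^ n) sums E x" if "0 \<le> x" "x < 1" for x
  proof -
    have "(\<Sum>i. p i * x ^ Suc i) = x * (\<Sum>i. p i * x ^ i)"
      using suminf_mult[OF summable_power_le_1[OF p], of x x] that by (simp add: mult_ac)
    then show ?thesis using panjer_sums_open[OF c f that] by (simp add: E_def p_def)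
  qed
  have Elim: "(E \<longlongrightarrow> E 1) (at_left 1)"
    unfolding E_def power_one mult_1_right mult_1
    by (rule tendsto_mult[OF tendsto_const tendsto_exp])
       (use tendsto_mult[OF tendsto_ident_at power_series_at_left_1[OF p]] in simp)
  have ev: "\<forall>\<^sub>F x in at_left 1. 0 \<le> x \<and> x < (1::real)"
    by (intro eventually_at_leftI[of 0]) auto
  have bound: "sum ?q {..<N} \<le> E 1" for N
  proof (rule tendsto_le[OF _ Elim])
    have "((\<lambda>x. \<Sum>n<N. ?q n * x ^ n) \<longlongrightarrow> (\<Sum>n<N. ?q n * 1 ^ n)) (at_left 1)" by (intro tendsto_intros)
    then show "((\<lambda>x. \<Sum>n<N. ?q n * x ^ n) \<longlongrightarrow> sum ?q {..<N}) (at_left 1)" by simp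
    show "\<forall>\<^sub>F x in at_left 1. (\<Sum>n<N. ?q n * x ^ n) \<le> E x"
      using ev
    proof eventually_elim
      case (elim x)
      then have "(\<Sum>n<N. ?q n * x ^ n) \<le> (\<Sum>n. ?q n * x ^ n)"
        using E[of x] q0 by (intro sum_le_suminf) (auto simp: sums_iff)
      then show ?case using E[of x] elim by (simp add: sums_iff)
    qed
  qed auto
  have sq: "summable ?q"
    by (rule summableI_nonneg_bounded[OF q0 bound])
  have "((\<lambda>x. \<Sum>n. ?q n * x ^ n) \<longlongrightarrow> E 1) (at_left 1)"
    by (rule Lim_transform_eventually[OF Elim]) (use ev in eventually_elim, use E in \<open>auto simp: sums_iff\<close>)
  from tendsto_unique[OF _ this power_series_at_left_1[OF sq q0]]
  have "suminf ?q = E 1" by simp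
  then show ?thesis using sq True by (simp add: sums_iff E_def p_def)
qed

text \<open>
  The weight \<open>y i\<close> is the probability that a batch has size \<open>i + 1\<close>. With this shift \<open>tail y j\<close> is the
  probability of a size exceeding \<open>j\<close>, and \<open>y\<close> is itself the law of the number of customers that join the
  orbit when a batch finds the server free.
\<close>

locale batch =
  fixes y :: "nat \<Rightarrow> real"
  assumes y_nonneg: "0 \<le> y i" and y_sums: "y sums 1"
    and summable_size: "summable (\<lambda>i. real (Suc i) * y i)"
begin

definition chi :: real where
  "chi = (\<Sum>i. real (Suc i) * y i)"

definition gf :: "real \<Rightarrow> real" where
  "gf z = (\<Sum>i. y i * z ^ Suc i)"

text \<open>
  The law of the number of customers that arrive while the expected number of batches is \<open>u\<close>,
  a compound Poisson law.
\<close>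

definition cp :: "real \<Rightarrow> nat \<Rightarrow> real" where
  "cp u = panjer (exp (- u)) (\<lambda>i. u * (real (Suc i) * y i))"

lemma y_summable: "summable y" using y_sums by (simp add: sums_iff)

lemma size_nonneg: "0 \<le> real (Suc i) * y i"
  using y_nonneg by simp

lemma tail_y_sums: "tail y sums chi"
  unfolding chi_def by (rule tail_of_tail(2)[OF summable_size y_nonneg])

lemma tail_y_nonneg: "0 \<le> tail y j" by (rule tail_nonneg[OF y_summable y_nonneg])

lemma chi_ge_1: "1 \<le> chi"
proof -
  have "suminf y \<le> chi" unfolding chi_def
    by (rule suminf_le[OF _ y_summable summable_size]) (use y_nonneg in \<open>simp add: algebra_simps\<close>)
  then show ?thesis using y_sums by (simp add: sums_iff)
qed

lemma gf_1: "gf 1 = 1" using y_sums by (simp add: gf_def sums_iff)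

lemma gf_summable: "0 \<le> z \<Longrightarrow> z \<le> 1 \<Longrightarrow> summable (\<lambda>i. y i * z ^ Suc i)"
  using summable_mult[OF summable_power_le_1[OF y_summable y_nonneg], of z z] by (simp add: mult_ac)

lemma gf_le_1: "0 \<le> z \<Longrightarrow> z \<le> 1 \<Longrightarrow> gf z \<le> 1"
proof -
  assume z: "0 \<le> z" "z \<le> 1"
  have "gf z \<le> suminf y"
    unfolding gf_def
    by (intro suminf_le gf_summable y_summable mult_left_le power_le_one y_nonneg z)
  then show ?thesis using y_sums by (simp add: sums_iff)
qed

lemma cp_nonneg: "0 \<le> u \<Longrightarrow> 0 \<le> cp u n"
  unfolding cp_def by (intro panjer_nonneg mult_nonneg_nonneg size_nonneg) auto

lemma cp_sums:
  assumes "0 \<le> u" "0 \<le> z" "z \<le> 1"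
  shows "(\<lambda>n. cp u n * z ^ n) sums exp (- u * (1 - gf z))"
proof -
  have "(\<lambda>n. cp u n * z ^ n) sums (exp (- u) * exp (\<Sum>i. u * (real (Suc i) * y i) / real (Suc i) * z ^ Suc i))"
    unfolding cp_def using assms
    by (intro panjer_sums mult_nonneg_nonneg size_nonneg summable_mult summable_size) auto
  also have "(\<lambda>i. u * (real (Suc i) * y i) / real (Suc i) * z ^ Suc i) = (\<lambda>i. u * (y i * z ^ Suc i))"
    by auto
  also have "(\<Sum>i. u * (y i * z ^ Suc i)) = u * gf z"
    unfolding gf_def using assms by (intro suminf_mult gf_summable)
  finally show ?thesis by (simp add: exp_add[symmetric] algebra_simps)
qed

lemma cp_total: "0 \<le> u \<Longrightarrow> cp u sums 1"
  using cp_sums[of u 1] by (simp add: gf_1)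

lemma cp_summable: "0 \<le> u \<Longrightarrow> summable (cp u)"
  using cp_total by (simp add: sums_iff)

lemma tail_cp_bounds: "0 \<le> u \<Longrightarrow> 0 \<le> tail (cp u) j" "0 \<le> u \<Longrightarrow> tail (cp u) j \<le> 1"
  using tail_nonneg[OF cp_summable cp_nonneg, of u j] tail_le_suminf[OF cp_summable cp_nonneg, of u j] cp_total[of u]
  by (auto simp: sums_iff)

lemma tail_cp_eq: "0 \<le> u \<Longrightarrow> tail (cp u) j = 1 - sum (cp u) {..<j}"
  using tail_eq_diff[OF cp_summable, of u j] cp_total[of u] by (auto simp: sums_iff)

lemma cp_conv: "real (Suc n) * cp u (Suc n) = conv (\<lambda>i. u * (real (Suc i) * y i)) (cp u) n"
  unfolding cp_def by (rule panjer_conv)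

lemma cp_mean:
  assumes u: "0 \<le> u"
  shows "(\<lambda>n. tail (cp u) (Suc n)) sums (u * chi)"
proof -
  have f: "summable (\<lambda>i. u * (real (Suc i) * y i))" "0 \<le> u * (real (Suc i) * y i)" for i
    using u by (auto intro!: summable_mult summable_size mult_nonneg_nonneg size_nonneg simp del: of_nat_Suc)
  note c = conv_sums[OF f(1) cp_summable[OF u] f(2) cp_nonneg[OF u]]
  have "(\<lambda>n. real (Suc n) * cp u (Suc n)) sums (u * chi)"
    unfolding cp_conv using c cp_total[OF u] suminf_mult[OF summable_size, of u]
    by (simp add: sums_iff chi_def)
  then show ?thesis
    using tail_of_tail(2)[of "\<lambda>n. cp u (Suc n)"] cp_nonneg[OF u] by (simp add: sums_iff tail_shift)
qed

lemma continuous_cp: "continuous_on UNIV (\<lambda>u. cp u n)"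
proof (induction n rule: less_induct)
  case (less n)
  show ?case
  proof (cases n)
    case 0
    then show ?thesis by (auto simp: cp_def intro!: continuous_intros)
  next
    case (Suc m)
    have "cp u n = (\<Sum>i\<le>m. u * (real (Suc i) * y i) * cp u (m - i)) / real (Suc m)" for u
      by (simp only: Suc cp_def panjer.simps)
    moreover have "continuous_on UNIV (\<lambda>u. (\<Sum>i\<le>m. u * (real (Suc i) * y i) * cp u (m - i)) / real (Suc m))"
      by (intro continuous_intros less.IH) (auto simp: Suc)
    ultimately show ?thesis by simp
  qed
qed

lemma size_tail_asymp:
  assumes r: "regvar (- a) r" and a: "a > 1" and ly: "(\<lambda>j. tail y j / r (real j)) \<longlonglongrightarrow> c"
  shows "(\<lambda>j. tail (\<lambda>i. real (Suc i) * y i) j / (real j * r (real j))) \<longlonglongrightarrow> c * a / (a - 1)"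
proof -
  have "(\<lambda>j. tail y j / r (real j) + tail (tail y) j / (real j * r (real j))) \<longlonglongrightarrow> c + c / (a - 1)"
    by (intro tendsto_add ly karamata_sum(2)[OF r a])
  also have "c + c / (a - 1) = c * a / (a - 1)" using a by (simp add: field_simps)
  finally show ?thesis
    by (rule Lim_transform_eventually)
       (use eventually_gt_at_top[of 0] in eventually_elim,
         simp add: tail_of_tail(3)[OF summable_size y_nonneg] add_divide_distrib del: of_nat_Suc)
qed

text \<open>
  One big jump: for fixed \<open>u\<close> the sum is large because one of its \<open>u\<close> expected batches is. The factor
  \<open>1 - 1 / a\<close> of the general result on such recursions cancels \<open>a / (a - 1)\<close> from the size-biased
  batch law.
\<close>

lemma cp_tail_asymp:
  assumes r: "regvar (- a) r" and a: "a > 1" and ly: "(\<lambda>j. tail y j / r (real j)) \<longlonglongrightarrow> c" and u: "0 \<le> u"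
  shows "(\<lambda>j. tail (cp u) j / r (real j)) \<longlonglongrightarrow> u * c"
proof -
  have "(\<lambda>j. tail (cp u) j / r (real j)) \<longlonglongrightarrow> (1 - 1 / a) * (u * (c * a / (a - 1))) * suminf (cp u)"
  proof (rule tail_panjer_asymp[OF r a _ _ cp_summable[OF u] cp_nonneg[OF u] cp_conv])
    show "summable (\<lambda>i. u * (real (Suc i) * y i))" by (intro summable_mult summable_size)
    show "0 \<le> u * (real (Suc i) * y i)" for i using u size_nonneg by (rule mult_nonneg_nonneg)
    show "(\<lambda>j. tail (\<lambda>i. u * (real (Suc i) * y i)) j / (real j * r (real j))) \<longlonglongrightarrow> u * (c * a / (a - 1))"
      unfolding tail_cmult[OF summable_size] times_divide_eq_right[symmetric]
      by (intro tendsto_mult tendsto_const size_tail_asymp[OF r a ly, unfolded times_divide_eq_right[symmetric]])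
  qed
  also have "(1 - 1 / a) * (u * (c * a / (a - 1))) * suminf (cp u) = u * c"
    using a cp_total[OF u] by (simp add: sums_iff field_simps)
  finally show ?thesis .
qed

text \<open>
  A bound uniform in \<open>u\<close>. Batches larger than \<open>K\<close> are removed from the recursion while its initial
  value is kept; the result \<open>q\<close> is the (defective) law of the number of arrivals on the event that no such
  batch occurs. The missing mass is at most \<open>u * tail y K\<close>, and \<open>q\<close> has all exponential moments.
\<close>

lemma cp_tail_chernoff:
  assumes u: "0 \<le> u" and s: "0 \<le> s"
  shows "tail (cp u) j \<le> u * tail y K + exp (- s * real j + u * (\<Sum>i<K. y i * (exp (s * real (Suc i)) - 1)))"
proof -
  define f where "f = (\<lambda>i. if i < K then u * (real (Suc i) * y i) else 0)"
  define q where "q = panjer (exp (- u)) f"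
  have f0: "0 \<le> f i" for i unfolding f_def using u size_nonneg[of i] by (auto intro: mult_nonneg_nonneg simp del: of_nat_Suc)
  have fle: "f i \<le> u * (real (Suc i) * y i)" for i
    unfolding f_def using u size_nonneg[of i] by (auto intro: mult_nonneg_nonneg simp del: of_nat_Suc)
  have ffin: "f i = 0" if "i \<notin> {..<K}" for i using that by (simp add: f_def)
  have R: "(\<lambda>n. q n * R ^ n) sums exp (u * (\<Sum>i<K. y i * R ^ Suc i) - u)" if R: "0 \<le> R" for R
  proof -
    let ?g = "\<lambda>i. f i * R ^ Suc i"
    have "(\<lambda>n. panjer (exp (- u)) ?g n * 1 ^ n) sums (exp (- u) * exp (\<Sum>i. ?g i / real (Suc i) * 1 ^ Suc i))"
    proof (rule panjer_sums)
      show "summable ?g" by (rule summable_finite[of "{..<K}"]) (auto simp: ffin)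
    qed (use R f0 in auto)
    also have "(\<Sum>i. ?g i / real (Suc i) * 1 ^ Suc i) = (\<Sum>i<K. ?g i / real (Suc i) * 1 ^ Suc i)"
      by (rule suminf_finite) (auto simp: ffin)
    also have "\<dots> = u * (\<Sum>i<K. y i * R ^ Suc i)"
      unfolding sum_distrib_left by (intro sum.cong) (auto simp: f_def)
    finally show ?thesis
      by (simp add: panjer_scale q_def exp_add[symmetric] del: power_Suc)
  qed
  have q0: "0 \<le> q n" for n unfolding q_def by (intro panjer_nonneg f0) simp
  have qle: "q n \<le> cp u n" for n unfolding q_def cp_def by (intro panjer_mono f0 fle) simp
  have "tail y K = 1 - sum y {..<K}"
    using tail_eq_diff[OF y_summable, of K] y_sums by (simp add: sums_iff)
  then have q1: "q sums exp (- u * tail y K)"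
    using R[of 1] by (simp add: right_diff_distrib)
  have sq: "summable q" using q1 by (simp add: sums_iff)
  have "tail (cp u) j \<le> 1 - sum q {..<j}"
    unfolding tail_cp_eq[OF u] by (intro diff_left_mono sum_mono qle)
  also have "\<dots> = 1 - exp (- u * tail y K) + tail q j"
    using tail_eq_diff[OF sq, of j] q1 by (simp add: sums_iff)
  also have "1 - exp (- u * tail y K) \<le> u * tail y K"
    using exp_ge_add_one_self[of "- u * tail y K"] by simp
  also have "tail q j \<le> exp (- s * real j + u * (\<Sum>i<K. y i * (exp (s * real (Suc i)) - 1)))"
  proof -
    let ?T = "\<lambda>n. exp (- s * real j) * (q n * exp s ^ n)"
    note RR = R[of "exp s"]
    have sT: "summable ?T" using RR by (intro summable_mult) (simp add: sums_iff)
    have T0: "0 \<le> ?T n" for n using q0 by simp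
    have "tail q j \<le> tail ?T j"
    proof (rule tail_mono[OF sT sq])
      fix n assume "n \<ge> j"
      then have "1 \<le> exp (- s * real j) * exp s ^ n"
        using s by (simp add: exp_of_nat_mult[symmetric] exp_add[symmetric] mult_right_mono algebra_simps mult_left_mono)
      from mult_left_mono[OF this q0[of n]] show "q n \<le> ?T n" by (simp add: mult_ac)
    qed
    also have "\<dots> \<le> suminf ?T" by (rule tail_le_suminf[OF sT T0])
    also have "\<dots> = exp (- s * real j) * exp (u * (\<Sum>i<K. y i * exp s ^ Suc i) - u)"
      using RR by (subst suminf_mult) (simp_all add: sums_iff)
    also have "\<dots> = exp (- s * real j + u * ((\<Sum>i<K. y i * exp s ^ Suc i) - 1))"
      by (simp add: exp_add[symmetric] algebra_simps)
    also have "\<dots> \<le> exp (- s * real j + u * (\<Sum>i<K. y i * (exp (s * real (Suc i)) - 1)))"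
    proof -
      have "(\<Sum>i<K. y i * exp s ^ Suc i) - 1 \<le> (\<Sum>i<K. y i * exp s ^ Suc i) - sum y {..<K}"
        using sum_le_suminf[OF y_summable, of "{..<K}"] y_nonneg y_sums by (simp add: sums_iff)
      also have "\<dots> = (\<Sum>i<K. y i * (exp (s * real (Suc i)) - 1))"
        unfolding sum_subtractf[symmetric]
        by (intro sum.cong refl) (simp only: exp_of_nat_mult[symmetric] mult.commute[of s] right_diff_distrib mult_1_right)
      finally show ?thesis using u by (simp add: mult_left_mono)
    qed
    finally show ?thesis .
  qed
  finally show ?thesis by simp
qed

text \<open>
  Batches of size up to \<open>k\<close> and those between \<open>k\<close> and \<open>K\<close> are estimated separately, so that \<open>s * K\<close>
  may grow like a logarithm as long as the size-biased tail beyond \<open>k\<close> decays like a power.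
\<close>

lemma exp_moment_bound:
  assumes s: "0 \<le> s"
  shows "(\<Sum>i<K. y i * (exp (s * real (Suc i)) - 1))
    \<le> s * (chi * exp (s * real k) + exp (s * real K) * tail (\<lambda>i. real (Suc i) * y i) k)"
proof -
  let ?f = "\<lambda>i. real (Suc i) * y i"
  have sum_le: "sum ?f A \<le> chi" if "finite A" for A
    unfolding chi_def by (rule sum_le_suminf[OF summable_size that]) (use size_nonneg in auto)
  have "(\<Sum>i<K. y i * (exp (s * real (Suc i)) - 1)) \<le> (\<Sum>i<K. s * (?f i * exp (s * real (Suc i))))"
  proof (rule sum_mono)
    fix i
    let ?v = "s * real (Suc i)"
    have "1 - ?v \<le> exp (- ?v)" using exp_ge_add_one_self[of "- ?v"] by simp
    then have "(1 - ?v) * exp ?v \<le> exp (- ?v) * exp ?v" by (intro mult_right_mono) auto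
    moreover have "exp (- ?v) * exp ?v = 1" by (simp only: exp_add[symmetric]) simp
    ultimately have "exp ?v - 1 \<le> ?v * exp ?v" by (simp only: left_diff_distrib mult_1)
    from mult_left_mono[OF this y_nonneg[of i]]
    show "y i * (exp ?v - 1) \<le> s * (?f i * exp ?v)" by (simp add: mult_ac)
  qed
  also have "\<dots> = s * (\<Sum>i<K. ?f i * exp (s * real (Suc i)))" by (simp add: sum_distrib_left)
  also have "\<dots> \<le> s * (chi * exp (s * real k) + exp (s * real K) * tail ?f k)"
  proof (rule mult_left_mono[OF _ s])
    have "(\<Sum>i<K. ?f i * exp (s * real (Suc i))) \<le> (\<Sum>i<K. ?f i * exp (s * real k) * indicator {..<k} i + ?f i * exp (s * real K) * indicator {k..<k + K} i)"
    proof (rule sum_mono)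
      fix i assume i: "i \<in> {..<K}"
      have "exp (s * real (Suc i)) \<le> exp (s * real k)" if "i < k"
        using that s by (simp add: mult_left_mono del: of_nat_Suc)
      moreover have "exp (s * real (Suc i)) \<le> exp (s * real K)"
        using i s by (simp add: mult_left_mono del: of_nat_Suc)
      ultimately show "?f i * exp (s * real (Suc i)) \<le> ?f i * exp (s * real k) * indicator {..<k} i + ?f i * exp (s * real K) * indicator {k..<k + K} i"
        using i size_nonneg[of i] y_nonneg[of i] by (cases "i < k") (auto intro!: mult_left_mono simp del: of_nat_Suc)
    qed
    also have "\<dots> = (\<Sum>i<K. ?f i * indicator {..<k} i) * exp (s * real k) + exp (s * real K) * (\<Sum>i<K. ?f i * indicator {k..<k + K} i)"
      by (simp add: sum.distrib sum_distrib_left sum_distrib_right mult_ac)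
    also have "(\<Sum>i<K. ?f i * indicator {..<k} i) = sum ?f ({..<K} \<inter> {..<k})"
      by (simp add: sum.inter_restrict indicator_def if_distrib cong: if_cong)
    also have "(\<Sum>i<K. ?f i * indicator {k..<k + K} i) = sum ?f ({..<K} \<inter> {k..<k + K})"
      by (simp add: sum.inter_restrict indicator_def if_distrib cong: if_cong)
    also have "sum ?f ({..<K} \<inter> {..<k}) * exp (s * real k) + exp (s * real K) * sum ?f ({..<K} \<inter> {k..<k + K})
        \<le> chi * exp (s * real k) + exp (s * real K) * tail ?f k"
    proof (intro add_mono mult_right_mono mult_left_mono sum_le)
      have "sum ?f ({..<K} \<inter> {k..<k + K}) \<le> sum ?f {k..<k + K}"
        by (rule sum_mono2) (use size_nonneg in auto)
      also have "\<dots> \<le> tail ?f k"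
        using tail_nonneg[OF summable_size size_nonneg, of "k + K"] by (subst tail_diff[OF summable_size]) auto
      finally show "sum ?f ({..<K} \<inter> {k..<k + K}) \<le> tail ?f k" .
    qed auto
    finally show "(\<Sum>i<K. ?f i * exp (s * real (Suc i))) \<le> chi * exp (s * real k) + exp (s * real K) * tail ?f k" .
  qed
  finally show ?thesis .
qed

text \<open>
  The weak law of large numbers from below, exponentially fast and uniformly in the number of
  batches. A single \<open>z\<close> close to \<open>1\<close> in the bound of the head sum by \<open>exp (- u * (1 - gf z)) / z ^ j\<close>
  suffices, because \<open>(1 - gf z) / (1 - z)\<close> tends to \<open>chi\<close>.
\<close>

lemma cp_head_small:
  assumes d: "0 < \<delta>"
  shows "\<exists>\<gamma>. 0 \<le> \<gamma> \<and> \<gamma> < 1 \<and> (\<forall>j u. (1 + \<delta>) * real j \<le> u * chi \<longrightarrow> 1 - \<gamma> ^ j \<le> tail (cp u) j)"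
proof -
  have chi: "0 < chi" using chi_ge_1 by simp
  have lim: "((\<lambda>z::real. (1 + \<delta>) * z * (\<Sum>n. tail y n * z ^ n)) \<longlongrightarrow> (1 + \<delta>) * 1 * suminf (tail y)) (at_left 1)"
    using tail_y_sums
    by (intro tendsto_mult tendsto_const tendsto_ident_at power_series_at_left_1 tail_y_nonneg) (simp add: sums_iff)
  have "\<forall>\<^sub>F z in at_left 1. chi < (1 + \<delta>) * z * (\<Sum>n. tail y n * z ^ n)"
    by (rule order_tendstoD(1)[OF lim]) (use tail_y_sums chi d in \<open>simp add: sums_iff algebra_simps\<close>)
  moreover have "\<forall>\<^sub>F z in at_left 1. 0 < z \<and> z < (1::real)"
    by (intro eventually_at_leftI[of 0]) auto
  ultimately have "\<forall>\<^sub>F z in at_left 1. chi < (1 + \<delta>) * z * (\<Sum>n. tail y n * z ^ n) \<and> 0 < z \<and> z < 1"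
    by (rule eventually_conj)
  then obtain z :: real where z: "chi < (1 + \<delta>) * z * (\<Sum>n. tail y n * z ^ n)" "0 < z" "z < 1"
    using eventually_happens'[of "at_left (1::real)"] trivial_limit_at_left_real by blast
  \<comment> \<open>The \<open>j\<close>-th root of the bound for the least admissible \<open>u\<close>.\<close>
  define \<gamma> where "\<gamma> = exp (- (1 + \<delta>) * (1 - gf z) / chi) / z"
  have ty: "(\<Sum>n. tail y n * z ^ n) = (1 - gf z) / (1 - z)"
  proof -
    \<comment> \<open>The law of the batch size itself.\<close>
    define x where "x = (\<lambda>n. case n of 0 \<Rightarrow> 0 | Suc i \<Rightarrow> y i)"
    have sx: "summable x" using y_summable by (subst summable_Suc_iff[symmetric]) (simp add: x_def)
    have x0: "0 \<le> x n" for n using y_nonneg by (simp add: x_def split: nat.split)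
    have "summable (\<lambda>n. x n * z ^ n)" by (rule summable_power_le_1[OF sx x0]) (use z in auto)
    then have "(\<Sum>n. x n * z ^ n) = gf z" using suminf_split_head[of "\<lambda>n. x n * z ^ n"] by (simp add: x_def gf_def)
    moreover have "suminf x = 1" using suminf_split_head[OF sx] y_sums by (simp add: x_def sums_iff)
    moreover have "tail x (Suc n) = tail y n" for n by (simp add: tail_shift) (simp add: x_def)
    ultimately show ?thesis using tail_gf_sums[OF sx x0, of z] z by (simp add: sums_iff)
  qed
  have "- ln z \<le> 1 / z - 1" using ln_le_minus_one[of "1 / z"] z by (simp add: ln_div)
  also have "\<dots> = (1 - z) / z" using z by (simp add: field_simps)
  also have "\<dots> < (1 + \<delta>) * (1 - gf z) / chi"
    using z(1) z(2,3) chi unfolding ty by (simp add: field_simps)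
  finally have "- ((1 + \<delta>) * (1 - gf z) / chi) < ln z" by simp
  then have "exp (- ((1 + \<delta>) * (1 - gf z) / chi)) < exp (ln z)" by (subst exp_less_cancel_iff)
  then have "exp (- (1 + \<delta>) * (1 - gf z) / chi) < z"
    using z by (simp only: exp_ln mult_minus_left minus_divide_left)
  then have g: "0 \<le> \<gamma>" "\<gamma> < 1" using z by (auto simp: \<gamma>_def)
  have "1 - \<gamma> ^ j \<le> tail (cp u) j" if u: "(1 + \<delta>) * real j \<le> u * chi" for j u
  proof -
    have "0 \<le> u * chi" using u d by (intro order_trans[OF _ u]) auto
    then have u0: "0 \<le> u" using chi by (simp add: zero_le_mult_iff)
    note cs = cp_sums[OF u0, of z]
    have "sum (cp u) {..<j} * z ^ j \<le> (\<Sum>n<j. cp u n * z ^ n)"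
      unfolding sum_distrib_right
      by (intro sum_mono mult_left_mono power_decreasing cp_nonneg u0) (use z in auto)
    also have "\<dots> \<le> exp (- u * (1 - gf z))"
      using cs z cp_nonneg[OF u0] sum_le_suminf[of "\<lambda>n. cp u n * z ^ n" "{..<j}"] by (simp add: sums_iff)
    also have "\<dots> \<le> exp (- ((1 + \<delta>) * real j / chi) * (1 - gf z))"
    proof -
      have "(1 + \<delta>) * real j / chi \<le> u" using u chi by (simp add: pos_divide_le_eq)
      then have "(1 + \<delta>) * real j / chi * (1 - gf z) \<le> u * (1 - gf z)"
        using gf_le_1[of z] z by (intro mult_right_mono) auto
      then show ?thesis by simp
    qed
    also have "- ((1 + \<delta>) * real j / chi) * (1 - gf z) = real j * (- (1 + \<delta>) * (1 - gf z) / chi)"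
      by (simp only: mult_minus_left mult_minus_right minus_divide_left[symmetric] times_divide_eq_left
          times_divide_eq_right mult_ac)
    also have "exp \<dots> = (\<gamma> * z) ^ j" unfolding exp_of_nat_mult using z by (simp add: \<gamma>_def)
    also have "\<dots> = \<gamma> ^ j * z ^ j" by (rule power_mult_distrib)
    finally have "sum (cp u) {..<j} \<le> \<gamma> ^ j" using z by simp
    then show ?thesis by (simp add: tail_cp_eq[OF u0])
  qed
  then show ?thesis using g by blast
qed

end

section \<open>Arrivals during a service\<close>

context batch
begin

text \<open>
  As long as the mean \<open>u * chi\<close> stays below \<open>j\<close> by a fixed proportion, the tail is at most of the order
  of a single batch tail, with a constant linear in \<open>u\<close>: this is the majorant for integrating over a
  random service time. The exponential bound is used with \<open>s\<close> of order \<open>ln j / j\<close>, large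
  enough to turn the deficit \<open>\<delta> * j\<close> into the power \<open>j powr - (a + 1)\<close>, and with batches cut at
  \<open>\<eta> * j\<close>, small enough that \<open>exp (s * \<eta> * j)\<close> is a smaller power of \<open>j\<close> than the size-biased tail
  at \<open>sqrt j\<close> can absorb.
\<close>

lemma cp_tail_uniform:
  assumes r: "regvar (- a) r" and a: "a > 1" and ly: "(\<lambda>j. tail y j / r (real j)) \<longlonglongrightarrow> c"
    and d: "0 < \<delta>" "\<delta> < 1"
  shows "\<exists>C. \<forall>\<^sub>F j in sequentially. \<forall>u. 0 \<le> u \<longrightarrow> u * chi \<le> (1 - \<delta>) * real j \<longrightarrow>
    tail (cp u) j \<le> C * (u + 1) * r (real j)"
proof -
  let ?f = "\<lambda>i. real (Suc i) * y i"
  \<comment> \<open>With \<open>\<kappa>\<close> as below, \<open>\<delta> / 2 * s j * j = (a + 1) * ln j\<close>; and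
    \<open>exp (s j * K j) \<le> j powr ((a - 1) / 8)\<close>, while the size-biased tail at \<open>k j\<close> is at most of order
    \<open>j powr (- (a - 1) / 4)\<close>.\<close>
  define \<kappa> where "\<kappa> = 2 * (a + 1) / \<delta>"
  define \<eta> where "\<eta> = (a - 1) / (8 * \<kappa>)"
  have \<kappa>: "\<kappa> > 0" using a d by (simp add: \<kappa>_def)
  have "2 * (a + 1) * \<delta> \<le> 2 * (a + 1)" using a d by (intro mult_left_le) auto
  then have "\<kappa> \<ge> 2 * (a + 1)" unfolding \<kappa>_def using d by (simp add: pos_le_divide_eq)
  then have \<eta>: "0 < \<eta>" "\<eta> < 1" using a \<kappa> by (auto simp: \<eta>_def)
  define K where "K = (\<lambda>j. nat \<lfloor>\<eta> * real j\<rfloor>)"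
  define k where "k = (\<lambda>j. nat \<lfloor>sqrt (real j)\<rfloor>)"
  define s where "s = (\<lambda>j. \<kappa> * ln (real j) / real j)"
  have Kr: "(\<lambda>j. real (K j) / real j) \<longlonglongrightarrow> \<eta>" unfolding K_def by (rule nat_floor_ratio(1)[OF \<eta>])
  have chi: "0 < chi" using chi_ge_1 by simp
  define C where "C = max 1 (c * \<eta> powr (- a) + 1)"
  have "\<forall>\<^sub>F j in sequentially. tail y (K j) / r (real j) < c * \<eta> powr (- a) + 1"
    by (rule order_tendstoD(2)[OF quot_reindex[OF r ly Kr \<eta>(1)]]) simp
  then have ev1: "\<forall>\<^sub>F j in sequentially. tail y (K j) \<le> C * r (real j)"
    using regvar_pos_nat[OF r]
  proof eventually_elim
    case (elim j)
    then have "tail y (K j) \<le> (c * \<eta> powr (- a) + 1) * r (real j)" by (simp add: pos_divide_less_eq)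
    also have "\<dots> \<le> C * r (real j)" using elim by (intro mult_right_mono) (auto simp: C_def)
    finally show ?case .
  qed
  define r1 where "r1 = (\<lambda>x. x powr 1 * r x)"
  have r1: "regvar (1 + - a) r1" unfolding r1_def by (rule regvar_powr_mult[OF r])
  define D where "D = max 0 (c * a / (a - 1) + 1)"
  have "\<forall>\<^sub>F i in sequentially. tail ?f i / (real i * r (real i)) < c * a / (a - 1) + 1"
    by (rule order_tendstoD(2)[OF size_tail_asymp[OF r a ly]]) simp
  moreover have "\<forall>\<^sub>F i in sequentially. r1 (real i) \<le> real i powr (- (a - 1) / 2)"
    using regvar_le_powr[OF r1, of "- (a - 1) / 2"] a by (intro eventually_compose_filterlim[OF _ filterlim_real_sequentially]) auto
  ultimately have "\<forall>\<^sub>F i in sequentially. tail ?f i \<le> D * real i powr (- (a - 1) / 2)"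
    using regvar_pos_nat[OF r1]
  proof eventually_elim
    case (elim i)
    have r1i: "r1 (real i) = real i * r (real i)" by (simp add: r1_def)
    have "tail ?f i \<le> (c * a / (a - 1) + 1) * r1 (real i)"
      using elim unfolding r1i by (simp add: pos_divide_less_eq)
    also have "\<dots> \<le> D * r1 (real i)" using elim by (intro mult_right_mono) (auto simp: D_def)
    also have "\<dots> \<le> D * real i powr (- (a - 1) / 2)" using elim by (intro mult_left_mono) (auto simp: D_def)
    finally show ?case .
  qed
  moreover have kt: "filterlim k sequentially sequentially"
  proof -
    have "filterlim (\<lambda>j. \<lfloor>sqrt (real j)\<rfloor>) at_top sequentially"
      by (rule filterlim_compose[OF filterlim_floor_sequentially]) (real_asymp)
    then show ?thesis unfolding k_def by (rule filterlim_compose[OF filterlim_nat_sequentially])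
  qed
  ultimately have ev2: "\<forall>\<^sub>F j in sequentially. tail ?f (k j) \<le> D * real (k j) powr (- (a - 1) / 2)"
    by (rule eventually_compose_filterlim)
  let ?br = "\<lambda>j. chi * exp (\<kappa> * ln (real j) / sqrt (real j)) + real j powr ((a - 1) / 8) * (D * (sqrt (real j) - 1) powr (- (a - 1) / 2))"
  have "?br \<longlonglongrightarrow> chi * 1 + D * 0"
  proof -
    have "(\<lambda>j. exp (\<kappa> * ln (real j) / sqrt (real j))) \<longlonglongrightarrow> 1" by real_asymp
    moreover have "(\<lambda>j. real j powr ((a - 1) / 8) * (sqrt (real j) - 1) powr (- (a - 1) / 2)) \<longlonglongrightarrow> 0"
    proof -
      define p where "p = (a - 1) / 8"
      have p: "p > 0" "(a - 1) / 8 = p" "- (a - 1) / 2 = - (4 * p)"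
        using a by (simp_all add: p_def field_simps)
      show ?thesis unfolding p(2,3) using p(1) by real_asymp
    qed
    ultimately have "(\<lambda>j. chi * exp (\<kappa> * ln (real j) / sqrt (real j)) + D * (real j powr ((a - 1) / 8) * (sqrt (real j) - 1) powr (- (a - 1) / 2))) \<longlonglongrightarrow> chi * 1 + D * 0"
      by (intro tendsto_add tendsto_mult tendsto_const)
    then show ?thesis by (simp add: mult_ac)
  qed
  then have ev3: "\<forall>\<^sub>F j in sequentially. ?br j < chi * (1 + \<delta> / 2)"
    using chi d by (intro order_tendstoD(2)) auto
  have ev4: "\<forall>\<^sub>F j in sequentially. real j powr (- (a + 1)) \<le> r (real j)"
    using regvar_ge_powr[OF r, of "- (a + 1)"] by (intro eventually_compose_filterlim[OF _ filterlim_real_sequentially]) auto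
  have "\<forall>\<^sub>F j in sequentially. \<forall>u. 0 \<le> u \<longrightarrow> u * chi \<le> (1 - \<delta>) * real j \<longrightarrow> tail (cp u) j \<le> C * (u + 1) * r (real j)"
    using ev1 ev2 ev3 ev4 eventually_ge_at_top[of 2] regvar_pos_nat[OF r]
  proof eventually_elim
    case (elim j)
    have lnj: "0 < ln (real j)" using elim by simp
    have sj: "0 \<le> s j" using lnj \<kappa> elim by (simp add: s_def)
    have sq: "1 < sqrt (real j)" using elim by simp
    have kle: "real (k j) \<le> sqrt (real j)" "sqrt (real j) - 1 \<le> real (k j)"
      unfolding k_def using sq by linarith+
    have "s j * real (k j) \<le> s j * sqrt (real j)" using kle sj by (intro mult_left_mono)
    also have "\<dots> = \<kappa> * ln (real j) / sqrt (real j)"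
      using elim by (simp add: s_def field_simps)
    finally have e1: "exp (s j * real (k j)) \<le> exp (\<kappa> * ln (real j) / sqrt (real j))" by simp
    have "s j * real (K j) \<le> s j * (\<eta> * real j)"
      unfolding K_def using sj nat_floor_ratio(3)[OF \<eta>] by (intro mult_left_mono)
    also have "\<dots> = ((a - 1) / 8) * ln (real j)"
      using elim \<kappa> by (simp add: s_def \<eta>_def field_simps)
    finally have e2: "exp (s j * real (K j)) \<le> real j powr ((a - 1) / 8)"
      using elim by (simp add: powr_def)
    have "real (k j) powr (- (a - 1) / 2) \<le> (sqrt (real j) - 1) powr (- (a - 1) / 2)"
      using kle sq a by (intro powr_mono2') auto
    then have e3: "tail ?f (k j) \<le> D * (sqrt (real j) - 1) powr (- (a - 1) / 2)"
      using elim(2) by (elim order_trans) (intro mult_left_mono, auto simp: D_def)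
    have "chi * exp (s j * real (k j)) + exp (s j * real (K j)) * tail ?f (k j) \<le> ?br j"
      using e1 e2 e3 chi tail_nonneg[OF summable_size size_nonneg] by (intro add_mono mult_mono) auto
    also have "\<dots> \<le> chi * (1 + \<delta> / 2)" using elim by simp
    finally have br: "chi * exp (s j * real (k j)) + exp (s j * real (K j)) * tail ?f (k j) \<le> chi * (1 + \<delta> / 2)" .
    show ?case
    proof (intro allI impI)
      fix u :: real assume u: "0 \<le> u" "u * chi \<le> (1 - \<delta>) * real j"
      have "u * (\<Sum>i<K j. y i * (exp (s j * real (Suc i)) - 1))
          \<le> u * (s j * (chi * exp (s j * real (k j)) + exp (s j * real (K j)) * tail ?f (k j)))"
        using u by (intro mult_left_mono exp_moment_bound sj)
      also have "\<dots> \<le> u * (s j * (chi * (1 + \<delta> / 2)))"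
        using u sj br by (intro mult_left_mono)
      also have "\<dots> = u * chi * (s j * (1 + \<delta> / 2))" by simp
      also have "\<dots> \<le> (1 - \<delta>) * real j * (s j * (1 + \<delta> / 2))"
        using u sj d by (intro mult_right_mono) auto
      also have "\<dots> = s j * real j * ((1 - \<delta>) * (1 + \<delta> / 2))" by simp
      also have "\<dots> \<le> s j * real j * (1 - \<delta> / 2)"
        using sj d by (intro mult_left_mono) (auto simp: algebra_simps)
      finally have "- s j * real j + u * (\<Sum>i<K j. y i * (exp (s j * real (Suc i)) - 1)) \<le> - (\<delta> / 2 * (s j * real j))"
        by (simp add: algebra_simps)
      also have "\<delta> / 2 * (s j * real j) = (a + 1) * ln (real j)"
        using elim d by (simp add: s_def \<kappa>_def)
      finally have "exp (- s j * real j + u * (\<Sum>i<K j. y i * (exp (s j * real (Suc i)) - 1))) \<le> exp (- ((a + 1) * ln (real j)))"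
        by (simp only: exp_le_cancel_iff)
      also have "\<dots> = real j powr (- (a + 1))" using elim by (simp only: powr_def mult_minus_left) simp
      also have "\<dots> \<le> r (real j)" by fact
      finally have "tail (cp u) j \<le> u * tail y (K j) + r (real j)"
        using cp_tail_chernoff[OF u(1) sj, of j "K j"] by linarith
      also have "\<dots> \<le> u * (C * r (real j)) + C * r (real j)"
      proof (rule add_mono)
        show "u * tail y (K j) \<le> u * (C * r (real j))" using u elim by (intro mult_left_mono)
        have "1 * r (real j) \<le> C * r (real j)" using elim by (intro mult_right_mono) (auto simp: C_def)
        then show "r (real j) \<le> C * r (real j)" by simp
      qed
      also have "\<dots> = C * (u + 1) * r (real j)" by (simp add: algebra_simps)
      finally show "tail (cp u) j \<le> C * (u + 1) * r (real j)" .
    qed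
  qed
  then show ?thesis ..
qed

end

lemma integral_sums_nonneg:
  fixes h :: "nat \<Rightarrow> 'a \<Rightarrow> real"
  assumes meas: "\<And>n. h n \<in> borel_measurable M" and nonneg: "\<And>n x. 0 \<le> h n x"
    and sums: "\<And>x. (\<lambda>n. h n x) sums H x" and H: "integrable M H"
  shows "(\<lambda>n. \<integral>x. h n x \<partial>M) sums (\<integral>x. H x \<partial>M)"
proof -
  have part: "(\<Sum>n<N. h n x) \<le> H x" for N x
    using sum_le_suminf[of "\<lambda>n. h n x" "{..<N}"] sums[of x] nonneg by (simp add: sums_iff)
  have int: "integrable M (h n)" for n
  proof (rule Bochner_Integration.integrable_bound[OF H meas], rule AE_I2)
    fix x
    have "h n x \<le> (\<Sum>i<Suc n. h i x)" using nonneg by (simp add: sum_nonneg)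
    also have "\<dots> \<le> H x" by (rule part)
    finally show "norm (h n x) \<le> norm (H x)" using nonneg[of n x] by simp
  qed
  have bnd: "(\<Sum>n<N. \<integral>x. h n x \<partial>M) \<le> (\<integral>x. H x \<partial>M)" for N
  proof -
    have "(\<Sum>n<N. \<integral>x. h n x \<partial>M) = (\<integral>x. (\<Sum>n<N. h n x) \<partial>M)" by (simp add: int)
    also have "\<dots> \<le> (\<integral>x. H x \<partial>M)" by (rule integral_mono) (auto simp: int H part)
    finally show ?thesis .
  qed
  have "summable (\<lambda>n. \<integral>x. h n x \<partial>M)"
    by (rule summableI_nonneg_bounded[OF _ bnd]) (auto intro!: integral_nonneg simp: nonneg)
  then have "(\<lambda>n. \<integral>x. h n x \<partial>M) sums (\<integral>x. (\<Sum>n. h n x) \<partial>M)"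
    by (intro sums_integral int AE_I2) (use sums nonneg in \<open>auto simp: sums_iff\<close>)
  moreover have "(\<Sum>n. h n x) = H x" for x using sums[of x] by (simp add: sums_iff)
  ultimately show ?thesis by simp
qed

locale batch_service = batch y + real_distribution S for y and S :: "real measure" +
  fixes lam :: real
  assumes lam: "0 < lam" and S_pos: "AE b in S. 0 < b" and S_integrable: "integrable S (\<lambda>b. b)"
begin

text \<open>
  The law of the number of customers that arrive during a service. The truncation at \<open>0\<close> makes
  the rate nonnegative everywhere and not only almost everywhere.
\<close>

definition arr :: "nat \<Rightarrow> real" where
  "arr n = (\<integral>b. cp (lam * max 0 b) n \<partial>S)"

definition beta :: real where "beta = (\<integral>b. b \<partial>S)"

lemma rate_nonneg: "0 \<le> lam * max 0 b" using lam by simp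

lemma integral_max_0: "integrable S (\<lambda>b. max 0 b)" "(\<integral>b. max 0 b \<partial>S) = beta"
proof -
  show "integrable S (\<lambda>b. max 0 b)" using S_integrable by simp
  show "(\<integral>b. max 0 b \<partial>S) = beta"
    unfolding beta_def by (rule integral_cong_AE) (use S_pos in auto)
qed

lemma cp_measurable [measurable]: "(\<lambda>b. cp (lam * max 0 b) n) \<in> borel_measurable S"
proof -
  have "(\<lambda>u. cp u n) \<in> borel_measurable borel"
    by (rule borel_measurable_continuous_onI[OF continuous_cp])
  then show ?thesis by measurable
qed

lemma tail_cp_measurable [measurable]: "(\<lambda>b. tail (cp (lam * max 0 b)) j) \<in> borel_measurable S"
  unfolding tail_cp_eq[OF rate_nonneg] by measurable

lemma cp_integrable: "integrable S (\<lambda>b. cp (lam * max 0 b) n)"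
proof (rule integrable_const_bound[where B = 1])
  have "cp (lam * max 0 b) n \<le> 1" for b
    using sum_le_suminf[OF cp_summable[OF rate_nonneg], of "{n}" b] cp_nonneg[OF rate_nonneg] cp_total[OF rate_nonneg, of b]
    by (simp add: sums_iff)
  then show "AE b in S. norm (cp (lam * max 0 b) n) \<le> 1" using cp_nonneg[OF rate_nonneg] by simp
qed measurable

lemma tail_cp_integrable: "integrable S (\<lambda>b. tail (cp (lam * max 0 b)) j)"
  by (rule integrable_const_bound[where B = 1]) (auto simp: tail_cp_bounds rate_nonneg)

lemma arr_nonneg: "0 \<le> arr n"
  unfolding arr_def by (intro Bochner_Integration.integral_nonneg cp_nonneg rate_nonneg)

lemma arr_gf:
  assumes z: "0 \<le> z" "z \<le> 1"
  shows "(\<lambda>n. arr n * z ^ n) sums lst S (lam * (1 - gf z))"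
proof -
  have "(\<lambda>n. \<integral>b. cp (lam * max 0 b) n * z ^ n \<partial>S) sums (\<integral>b. exp (- (lam * max 0 b) * (1 - gf z)) \<partial>S)"
  proof (rule integral_sums_nonneg)
    show "integrable S (\<lambda>b. exp (- (lam * max 0 b) * (1 - gf z)))"
      by (rule integrable_const_bound[where B = 1])
         (use lam gf_le_1[OF z] in \<open>auto intro!: mult_nonneg_nonneg\<close>)
  qed (use z cp_sums[OF rate_nonneg] cp_nonneg[OF rate_nonneg] in auto)
  also have "(\<integral>b. exp (- (lam * max 0 b) * (1 - gf z)) \<partial>S) = lst S (lam * (1 - gf z))"
    unfolding lst_def
  proof (rule integral_cong_AE)
    show "AE b in S. exp (- (lam * max 0 b) * (1 - gf z)) = exp (- (lam * (1 - gf z)) * b)"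
      using S_pos by eventually_elim simp
  qed measurable
  finally show ?thesis by (simp add: arr_def)
qed

lemma arr_sums: "arr sums 1"
  using arr_gf[of 1] prob_space by (simp add: gf_1 lst_def)

lemma arr_summable: "summable arr"
  using arr_sums by (simp add: sums_iff)

lemma tail_arr: "tail arr j = (\<integral>b. tail (cp (lam * max 0 b)) j \<partial>S)"
  using tail_eq_diff[OF arr_summable, of j] arr_sums prob_space
  by (simp add: tail_cp_eq[OF rate_nonneg] arr_def cp_integrable sums_iff)

lemma arr_mean: "(\<lambda>n. tail arr (Suc n)) sums (lam * beta * chi)"
proof -
  have "(\<lambda>n. \<integral>b. tail (cp (lam * max 0 b)) (Suc n) \<partial>S) sums (\<integral>b. lam * max 0 b * chi \<partial>S)"
    by (rule integral_sums_nonneg)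
       (use cp_mean[OF rate_nonneg] tail_cp_bounds(1)[OF rate_nonneg] integral_max_0 in auto)
  also have "(\<integral>b. lam * max 0 b * chi \<partial>S) = lam * beta * chi"
    using integral_max_0 by simp
  finally show ?thesis by (simp add: tail_arr)
qed

text \<open>
  More than \<open>j\<close> customers arrive during a service either because the service lasts longer than about
  \<open>j / (lam * chi)\<close>, or because a service of ordinary length contains a single large batch. Service times
  below and above this level by a proportion \<open>e\<close> are treated by dominated convergence and by the law
  of large numbers; the window in between contributes nothing as \<open>e\<close> tends to \<open>0\<close>.
\<close>

lemma arr_tail_asymp:
  assumes r: "regvar (- a) r" and a: "a > 1" and ly: "(\<lambda>j. tail y j / r (real j)) \<longlonglongrightarrow> c"
    and lS: "((\<lambda>x. measure S {x<..} / r x) \<longlongrightarrow> cB) at_top"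
  shows "(\<lambda>j. tail arr j / r (real j)) \<longlonglongrightarrow> lam * beta * c + cB * (lam * chi) powr a"
proof -
  have chi: "0 < chi" using chi_ge_1 by simp
  define m where "m = lam * chi"
  have m: "m > 0" using lam chi by (simp add: m_def)
  let ?V = "\<lambda>j b. tail (cp (lam * max 0 b)) j"
  define I where "I = (\<lambda>t j. \<integral>b. ?V j b * indicator {..t * real j / m} b \<partial>S)"
  have V: "0 \<le> ?V j b" "?V j b \<le> 1" for j b using tail_cp_bounds rate_nonneg by auto
  have Vint: "integrable S (\<lambda>b. ?V j b * indicator {..t} b)" for j t
    by (rule integrable_const_bound[where B = 1]) (auto simp: V abs_mult indicator_def)
  have small: "(\<lambda>j. I (1 - \<delta>) j / r (real j)) \<longlonglongrightarrow> lam * beta * c" if d: "0 < \<delta>" "\<delta> < 1" for \<delta>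
  proof -
    obtain C where "\<forall>\<^sub>F j in sequentially. \<forall>u. 0 \<le> u \<longrightarrow> u * chi \<le> (1 - \<delta>) * real j \<longrightarrow> tail (cp u) j \<le> C * (u + 1) * r (real j)"
      using cp_tail_uniform[OF r a ly d] by blast
    then have "\<forall>\<^sub>F j in sequentially. (\<forall>u. 0 \<le> u \<longrightarrow> u * chi \<le> (1 - \<delta>) * real j \<longrightarrow> tail (cp u) j \<le> C * (u + 1) * r (real j)) \<and> 0 < r (real j)"
      by (rule eventually_conj[OF _ regvar_pos_nat[OF r]])
    then obtain j0 where j0: "\<And>j u. j \<ge> j0 \<Longrightarrow> 0 \<le> u \<Longrightarrow> u * chi \<le> (1 - \<delta>) * real j \<Longrightarrow> tail (cp u) j \<le> C * (u + 1) * r (real j)"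
      "\<And>j. j \<ge> j0 \<Longrightarrow> 0 < r (real j)"
      by (auto simp: eventually_sequentially)
    let ?s = "\<lambda>j b. ?V j b * indicator {..(1 - \<delta>) * real j / m} b / r (real j)"
    have "(\<lambda>j. \<integral>b. ?s (j + j0) b \<partial>S) \<longlonglongrightarrow> (\<integral>b. lam * max 0 b * c \<partial>S)"
    proof (rule integral_dominated_convergence[where w = "\<lambda>b. \<bar>C\<bar> * (lam * max 0 b + 1)"])
      show "integrable S (\<lambda>b. \<bar>C\<bar> * (lam * max 0 b + 1))"
        using integral_max_0 by simp
      show "AE b in S. (\<lambda>j. ?s (j + j0) b) \<longlonglongrightarrow> lam * max 0 b * c"
      proof (rule AE_I2)
        fix b
        have "(\<lambda>j. ?V j b / r (real j)) \<longlonglongrightarrow> lam * max 0 b * c"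
          by (rule cp_tail_asymp[OF r a ly rate_nonneg])
        moreover have "\<forall>\<^sub>F j in sequentially. b \<le> (1 - \<delta>) * real j / m"
        proof -
          have "filterlim (\<lambda>j. (1 - \<delta>) / m * real j) at_top sequentially"
            using d m by (intro filterlim_tendsto_pos_mult_at_top[OF tendsto_const _ filterlim_real_sequentially]) auto
          then show ?thesis by (simp add: filterlim_at_top)
        qed
        ultimately have "(\<lambda>j. ?s j b) \<longlonglongrightarrow> lam * max 0 b * c"
          by (rule Lim_transform_eventually[OF _ eventually_mono]) auto
        then show "(\<lambda>j. ?s (j + j0) b) \<longlonglongrightarrow> lam * max 0 b * c"
          by (rule LIMSEQ_ignore_initial_segment)
      qed
      show "AE b in S. norm (?s (j + j0) b) \<le> \<bar>C\<bar> * (lam * max 0 b + 1)" for j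
      proof (rule AE_I2)
        fix b
        have rp: "0 < r (real (j + j0))" by (rule j0(2)) simp
        have nn: "0 \<le> \<bar>C\<bar> * (lam * max 0 b + 1)" using lam by (intro mult_nonneg_nonneg) auto
        show "norm (?s (j + j0) b) \<le> \<bar>C\<bar> * (lam * max 0 b + 1)"
        proof (cases "b \<le> (1 - \<delta>) * real (j + j0) / m")
          case True
          have "lam * max 0 b * chi \<le> (1 - \<delta>) * real (j + j0)"
          proof (cases "b \<ge> 0")
            case True': True
            then show ?thesis using True m by (simp add: m_def pos_le_divide_eq mult_ac)
          next
            case False
            then show ?thesis using d by simp
          qed
          then have "?V (j + j0) b \<le> C * (lam * max 0 b + 1) * r (real (j + j0))"
            by (intro j0(1) rate_nonneg) simp
          also have "\<dots> \<le> \<bar>C\<bar> * (lam * max 0 b + 1) * r (real (j + j0))"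
            using rp lam by (intro mult_right_mono) auto
          finally have "?V (j + j0) b / r (real (j + j0)) \<le> \<bar>C\<bar> * (lam * max 0 b + 1)"
            using rp by (simp only: pos_divide_le_eq)
          moreover have "0 \<le> ?V (j + j0) b" by (rule V)
          ultimately show ?thesis using True rp by (simp add: abs_mult)
        next
          case False
          then show ?thesis using nn by simp
        qed
      qed
    qed auto
    then have "(\<lambda>j. \<integral>b. ?s j b \<partial>S) \<longlonglongrightarrow> (\<integral>b. lam * max 0 b * c \<partial>S)"
      by (rule LIMSEQ_offset)
    then show ?thesis using integral_max_0 by (simp add: I_def)
  qed
  have large: "(\<lambda>j. measure S {t * real j / m<..} / r (real j)) \<longlonglongrightarrow> cB * (t / m) powr (- a)" if t: "t > 0" for t
  proof -
    have tm: "t / m > 0" using t m by simp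
    have lim: "(\<lambda>j. (t * real j / m) / real j) \<longlonglongrightarrow> t / m"
      by (rule Lim_transform_eventually[OF tendsto_const]) (use eventually_gt_at_top[of 0] in eventually_elim, simp)
    have tt: "filterlim (\<lambda>j. t * real j / m) at_top sequentially"
      by (rule ratio_at_top[OF filterlim_real_sequentially lim tm])
    have "(\<lambda>j. measure S {t * real j / m<..} / r (t * real j / m) * (r (t * real j / m) / r (real j))) \<longlonglongrightarrow> cB * (t / m) powr (- a)"
      by (intro tendsto_mult filterlim_compose[OF lS tt] regvar_ratio[OF r filterlim_real_sequentially tm lim])
    then show ?thesis
      by (rule Lim_transform_eventually)
         (use eventually_compose_filterlim[OF regvar_pos[OF r] tt] in eventually_elim, simp)
  qed
  have meas: "(\<integral>b. indicator {t<..} b \<partial>S) = measure S {t<..}" for t :: real by simp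
  have iint: "integrable S (indicator {t<..} :: real \<Rightarrow> real)" for t :: real
    by (rule integrable_const_bound[where B = 1]) (auto simp: indicator_def)
  have e_small: "\<forall>\<^sub>F e in at_right 0. 0 < e \<and> e < (1 :: real)"
    by (intro eventually_at_rightI[of 0 1]) auto
  have lim_powr: "((\<lambda>e. lam * beta * c + cB * ((1 + k * e) / m) powr (- a)) \<longlongrightarrow> lam * beta * c + cB * (lam * chi) powr a) (at_right 0)" for k
  proof -
    have "((\<lambda>e. lam * beta * c + cB * ((1 + k * e) / m) powr (- a)) \<longlongrightarrow> lam * beta * c + cB * ((1 + k * 0) / m) powr (- a)) (at_right 0)"
      using m by (intro tendsto_intros) auto
    moreover have "(1 / m) powr (- a) = m powr a" using m by (simp add: powr_divide powr_minus field_simps)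
    ultimately show ?thesis by (simp add: m_def)
  qed
  show ?thesis
  proof (rule tendsto_by_bounds)
    show "\<forall>\<^sub>F e in at_right 0. \<exists>h. h \<longlonglongrightarrow> lam * beta * c + cB * ((1 + (- 1) * e) / m) powr (- a)
        \<and> (\<forall>\<^sub>F j in sequentially. tail arr j / r (real j) \<le> h j)"
      using e_small
    proof eventually_elim
      case (elim e)
      let ?h = "\<lambda>j. I (1 - e) j / r (real j) + measure S {(1 - e) * real j / m<..} / r (real j)"
      have "?h \<longlonglongrightarrow> lam * beta * c + cB * ((1 - e) / m) powr (- a)"
        by (intro tendsto_add small large) (use elim in auto)
      moreover have "\<forall>\<^sub>F j in sequentially. tail arr j / r (real j) \<le> ?h j"
        using regvar_pos_nat[OF r]
      proof eventually_elim
        case (elim j)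
        have "tail arr j \<le> (\<integral>b. ?V j b * indicator {..(1 - e) * real j / m} b + indicator {(1 - e) * real j / m<..} b \<partial>S)"
          unfolding tail_arr
          by (intro integral_mono tail_cp_integrable Bochner_Integration.integrable_add Vint iint)
             (auto simp: indicator_def V)
        also have "\<dots> = I (1 - e) j + measure S {(1 - e) * real j / m<..}"
          unfolding I_def by (subst Bochner_Integration.integral_add[OF Vint iint]) (simp add: meas)
        finally show ?case using elim by (simp add: add_divide_distrib[symmetric] divide_right_mono)
      qed
      ultimately show ?case by auto
    qed
    show "\<forall>\<^sub>F e in at_right 0. \<exists>h. h \<longlonglongrightarrow> lam * beta * c + cB * ((1 + 1 * e) / m) powr (- a)
        \<and> (\<forall>\<^sub>F j in sequentially. h j \<le> tail arr j / r (real j))"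
      using e_small
    proof eventually_elim
      case (elim e)
      note eps = elim
      obtain \<gamma> where \<gamma>: "0 \<le> \<gamma>" "\<gamma> < 1" "\<And>j u. (1 + e) * real j \<le> u * chi \<Longrightarrow> 1 - \<gamma> ^ j \<le> tail (cp u) j"
        using cp_head_small elim by blast
      let ?h = "\<lambda>j. I (1 - e) j / r (real j) + (1 - \<gamma> ^ j) * (measure S {(1 + e) * real j / m<..} / r (real j))"
      have "?h \<longlonglongrightarrow> lam * beta * c + (1 - 0) * (cB * ((1 + e) / m) powr (- a))"
        by (intro tendsto_add tendsto_mult tendsto_diff tendsto_const small large LIMSEQ_power_zero) (use elim \<gamma> in auto)
      moreover have "\<forall>\<^sub>F j in sequentially. ?h j \<le> tail arr j / r (real j)"
        using regvar_pos_nat[OF r]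
      proof eventually_elim
        case (elim j)
        have "I (1 - e) j + (1 - \<gamma> ^ j) * measure S {(1 + e) * real j / m<..}
          = (\<integral>b. ?V j b * indicator {..(1 - e) * real j / m} b + (1 - \<gamma> ^ j) * indicator {(1 + e) * real j / m<..} b \<partial>S)"
          unfolding I_def by (subst Bochner_Integration.integral_add[OF Vint]) (simp_all add: meas iint)
        also have "\<dots> \<le> tail arr j"
          unfolding tail_arr
        proof (intro integral_mono tail_cp_integrable Bochner_Integration.integrable_add Vint integrable_mult_right iint)
          fix b
          have "(1 - e) * real j / m \<le> (1 + e) * real j / m"
            using m eps by (intro divide_right_mono mult_right_mono) auto
          moreover have "1 - \<gamma> ^ j \<le> ?V j b" if "(1 + e) * real j / m < b"
          proof (rule \<gamma>(3))
            have "0 \<le> (1 + e) * real j / m" using eps m by simp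
            then have "max 0 b = b" using that by simp
            then show "(1 + e) * real j \<le> lam * max 0 b * chi"
              using that m by (simp add: m_def pos_divide_less_eq mult_ac)
          qed
          ultimately show "?V j b * indicator {..(1 - e) * real j / m} b + (1 - \<gamma> ^ j) * indicator {(1 + e) * real j / m<..} b \<le> ?V j b"
            using V(1)[of b j] by (auto simp: indicator_def)
        qed
        finally show ?case using elim by (simp add: add_divide_distrib[symmetric] divide_right_mono)
      qed
      ultimately show ?case by auto
    qed
  qed (rule lim_powr)+
qed

end

section \<open>The idle orbit law\<close>

text \<open>
  Values at positive arguments suffice: if \<open>n\<close> is the first index where the coefficients may differ,
  their difference is the limit from the right at \<open>0\<close> of the difference of the series divided by \<open>z ^ n\<close>.
\<close>

lemma power_series_unique:
  fixes a b :: "nat \<Rightarrow> real"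
  assumes a: "summable a" "\<And>n. 0 \<le> a n" and b: "summable b" "\<And>n. 0 \<le> b n"
    and eq: "\<And>z. 0 < z \<Longrightarrow> z < 1 \<Longrightarrow> (\<Sum>n. a n * z ^ n) = (\<Sum>n. b n * z ^ n)"
  shows "a n = b n"
proof (induction n rule: less_induct)
  case (less n)
  define d where "d = (\<lambda>k. a k - b k)"
  have sd: "summable (\<lambda>k. d k * x ^ k)" if "\<bar>x\<bar> < 1" for x
  proof (rule summable_comparison_test'[of "\<lambda>k. a k + b k" 0])
    show "summable (\<lambda>k. a k + b k)" by (intro summable_add a b)
    fix k
    have "\<bar>d k\<bar> * \<bar>x ^ k\<bar> \<le> (a k + b k) * 1"
      using a(2)[of k] b(2)[of k] that by (intro mult_mono) (auto simp: d_def power_abs intro!: power_le_one)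
    then show "norm (d k * x ^ k) \<le> a k + b k" by (simp add: abs_mult)
  qed
  have low: "d k = 0" if "k < n" for k using less that by (simp add: d_def)
  define G where "G = (\<lambda>x. \<Sum>k. d (k + n) * x ^ k)"
  have Gs: "(\<lambda>k. d (k + n) * x ^ k) sums G x" if x: "\<bar>x\<bar> < 1" for x
  proof -
    have "summable (\<lambda>k. d (k + n) * x ^ (k + n))" by (rule summable_ignore_initial_segment[OF sd[OF x]])
    then have "summable (\<lambda>k. d (k + n) * x ^ k)" if "x \<noteq> 0"
      using that summable_mult[of "\<lambda>k. d (k + n) * x ^ (k + n)" "1 / x ^ n"] by (simp add: power_add)
    moreover have "summable (\<lambda>k. d (k + n) * 0 ^ k)" by (rule summable_finite[of "{0}"]) auto
    ultimately show ?thesis unfolding G_def by (cases "x = 0") (auto intro: summable_sums)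
  qed
  have "(G \<longlongrightarrow> d (0 + n)) (at 0)"
    by (rule powser_limit_0[of 1]) (use Gs in auto)
  then have "(G \<longlongrightarrow> d n) (at_right 0)" by (simp add: filterlim_at_split)
  moreover have "\<forall>\<^sub>F x in at_right 0. G x = 0"
  proof -
    have "\<forall>\<^sub>F x in at_right 0. 0 < x \<and> x < (1::real)" by (intro eventually_at_rightI[of 0 1]) auto
    then show ?thesis
    proof eventually_elim
      case (elim x)
      then have x: "\<bar>x\<bar> < 1" by simp
      have "(\<Sum>k. d k * x ^ k) = (\<Sum>k. a k * x ^ k) - (\<Sum>k. b k * x ^ k)"
        unfolding d_def left_diff_distrib using elim
        by (intro suminf_diff[symmetric] summable_power_le_1 a b) auto
      then have "(\<Sum>k. d k * x ^ k) = 0" using eq[of x] elim by simp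
      moreover have "(\<Sum>k<n. d k * x ^ k) = 0" using low by simp
      ultimately have "(\<Sum>k. d (k + n) * x ^ (k + n)) = 0"
        using suminf_minus_initial_segment[OF sd[OF x], of n] by simp
      moreover have "(\<Sum>k. d (k + n) * x ^ (k + n)) = x ^ n * G x"
        using sums_unique[OF sums_mult[OF Gs[OF x], of "x ^ n"]] by (simp add: power_add mult_ac)
      ultimately show ?case using elim by simp
    qed
  qed
  then have "(G \<longlongrightarrow> 0) (at_right 0)" by (rule tendsto_eventually)
  ultimately have "d n = 0" by (intro tendsto_unique[of "at_right (0::real)"]) simp_all
  then show ?case by (simp add: d_def)
qed

context batch_service
begin

text \<open>
  Dividing numerator and denominator of the known integrand \<open>(1 - A Y) / (A - u)\<close> by \<open>1 - u\<close> (with \<open>A\<close>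
  and \<open>Y\<close> the generating functions of \<open>arr\<close> and \<open>y\<close>) turns it into \<open>gbar / (1 - abar)\<close>, in which
  both series have nonnegative coefficients, namely tail probabilities.
\<close>

definition abar :: "nat \<Rightarrow> real" where "abar n = tail arr (Suc n)"

definition gbar :: "nat \<Rightarrow> real" where "gbar n = tail (conv arr y) (Suc n)"

text \<open>
  The power series coefficients of the integrand in the formula for the idle orbit law.
\<close>

definition flux :: "nat \<Rightarrow> real" where
  "flux = fps_nth (Abs_fps gbar * inverse (1 - Abs_fps abar))"

lemma abar_sums: "abar sums (lam * beta * chi)" and abar_nonneg: "0 \<le> abar n"
  unfolding abar_def using arr_mean by (auto intro: tail_nonneg arr_summable arr_nonneg)

lemma conv_arr_y: "conv arr y sums 1" "0 \<le> conv arr y n"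
  using conv_sums[OF arr_summable y_summable arr_nonneg y_nonneg] arr_sums y_sums
  by (auto simp: sums_iff intro: conv_nonneg arr_nonneg y_nonneg)

lemma gbar_nonneg: "0 \<le> gbar n"
  unfolding gbar_def using conv_arr_y by (intro tail_nonneg) (auto simp: sums_iff)

text \<open>
  The splitting of \<open>gbar\<close> used here separates the pairs whose first entry alone exceeds \<open>n\<close>; the total
  is the expectation of the sum of the two variables.
\<close>

lemma gbar_sums: "gbar sums (lam * beta * chi + chi - 1)"
proof -
  have ys: "(\<lambda>m. tail y (Suc m)) sums (chi - 1)"
    using tail_y_sums y_sums sums_Suc_iff[of "tail y" "chi - 1"] by (simp add: sums_iff)
  have eq: "gbar n = abar n + conv arr (\<lambda>m. tail y (Suc m)) n" for n
  proof -
    have "(\<Sum>i<Suc n. arr i * tail y (Suc n - i)) = conv arr (\<lambda>m. tail y (Suc m)) n"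
      unfolding conv_def lessThan_Suc_atMost by (intro sum.cong) (auto simp: Suc_diff_le)
    then show ?thesis
      using tail_conv[OF arr_summable arr_nonneg y_summable y_nonneg, of "Suc n"] y_sums
      by (simp add: gbar_def abar_def sums_iff)
  qed
  have "conv arr (\<lambda>m. tail y (Suc m)) sums (1 * (chi - 1))"
    using conv_sums[of arr "\<lambda>m. tail y (Suc m)"] arr_summable arr_nonneg arr_sums ys tail_y_nonneg
    by (simp add: sums_iff)
  from sums_add[OF abar_sums this] show ?thesis by (simp add: eq[symmetric] algebra_simps)
qed

context
  assumes stable: "lam * beta * chi < 1"
begin

lemma abar_0: "abar 0 < 1"
proof -
  have "sum abar {..<1} \<le> suminf abar"
    using abar_sums abar_nonneg by (intro sum_le_suminf) (auto simp: sums_iff)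
  then show ?thesis using abar_sums stable by (simp add: sums_iff)
qed

lemma flux_eq: "flux n = gbar n + conv abar flux n"
proof -
  define G A where "G = Abs_fps gbar" and "A = Abs_fps abar"
  have "fps_nth (1 - A) 0 \<noteq> 0" using abar_0 by (simp add: A_def)
  then have "G * inverse (1 - A) * (1 - A) = G"
    by (simp add: mult.assoc inverse_mult_eq_1)
  then have "G * inverse (1 - A) = G + A * (G * inverse (1 - A))"
    by (simp add: algebra_simps)
  then have "fps_nth (G * inverse (1 - A)) n = fps_nth (G + A * (G * inverse (1 - A))) n" by simp
  then show ?thesis
    unfolding fps_add_nth fps_mult_nth[of A "G * inverse (1 - A)"] conv_def atMost_atLeast0
    by (simp only: flux_def G_def A_def fps_nth_Abs_fps)
qed

lemma flux_nonneg: "0 \<le> flux n"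
proof (induction n rule: less_induct)
  case (less n)
  have "conv abar flux n = abar 0 * flux n + (\<Sum>i\<in>{..n} - {0}. abar i * flux (n - i))"
    unfolding conv_def by (subst sum.remove[of _ 0]) auto
  moreover have "0 \<le> (\<Sum>i\<in>{..n} - {0}. abar i * flux (n - i))"
    by (intro sum_nonneg mult_nonneg_nonneg abar_nonneg less) auto
  ultimately have "0 \<le> flux n * (1 - abar 0)"
    using flux_eq[of n] gbar_nonneg[of n] by (simp add: algebra_simps)
  then show ?case using abar_0 by (simp add: zero_le_mult_iff)
qed

lemma flux_sums: "flux sums ((lam * beta * chi + chi - 1) / (1 - lam * beta * chi))"
proof -
  let ?\<rho> = "lam * beta * chi" and ?G = "lam * beta * chi + chi - 1"
  \<comment> \<open>The fixed point equation, summed up to \<open>N\<close>, already bounds the partial sums.\<close>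
  have bnd: "sum flux {..<N} \<le> ?G / (1 - ?\<rho>)" for N
  proof -
    have "sum flux {..<N} = sum gbar {..<N} + sum (conv abar flux) {..<N}"
      unfolding sum.distrib[symmetric] by (rule sum.cong[OF refl flux_eq])
    also have "sum gbar {..<N} \<le> ?G"
      using sum_le_suminf[of gbar "{..<N}"] gbar_sums gbar_nonneg by (simp add: sums_iff)
    also have "sum (conv abar flux) {..<N} \<le> ?\<rho> * sum flux {..<N}"
    proof -
      have "sum (conv abar flux) {..<N} \<le> (\<Sum>i<N. abar i * sum flux {..<N})"
        unfolding sum_conv_lessThan
        by (intro sum_mono mult_left_mono sum_mono2 abar_nonneg flux_nonneg) auto
      also have "\<dots> = sum abar {..<N} * sum flux {..<N}" by (simp add: sum_distrib_right)
      also have "\<dots> \<le> ?\<rho> * sum flux {..<N}"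
        using sum_le_suminf[of abar "{..<N}"] abar_sums abar_nonneg flux_nonneg
        by (intro mult_right_mono) (auto simp: sums_iff intro: sum_nonneg)
      finally show ?thesis .
    qed
    finally show ?thesis using stable by (simp add: field_simps)
  qed
  have s: "summable flux" by (rule summableI_nonneg_bounded[OF flux_nonneg bnd])
  note c = conv_sums[of abar flux]
  have "suminf flux = suminf gbar + suminf (conv abar flux)"
  proof -
    have "suminf flux = (\<Sum>n. gbar n + conv abar flux n)" by (rule suminf_cong[OF flux_eq])
    also have "\<dots> = suminf gbar + suminf (conv abar flux)"
      using suminf_add[of gbar "conv abar flux"] c s abar_sums gbar_sums abar_nonneg flux_nonneg
      by (simp add: sums_iff)
    finally show ?thesis .
  qed
  also have "\<dots> = ?G + ?\<rho> * suminf flux"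
    using c s abar_sums gbar_sums abar_nonneg flux_nonneg by (simp add: sums_iff)
  finally have "suminf flux * (1 - ?\<rho>) = ?G" by algebra
  then have "suminf flux = ?G / (1 - ?\<rho>)" using stable by (simp add: eq_divide_eq)
  then show ?thesis using s by (simp add: sums_iff)
qed

lemma flux_summable: "summable flux"
  using flux_sums by (simp add: sums_iff)

lemma flux_gf:
  assumes u: "0 < u" "u < 1"
  shows "(\<Sum>n. flux n * u ^ n) =
    (1 - lst S (lam * (1 - gf u)) * (gf u / u)) / (lst S (lam * (1 - gf u)) - u)"
proof -
  define A where "A = lst S (lam * (1 - gf u))"
  have A: "(\<lambda>n. arr n * u ^ n) sums A" unfolding A_def by (rule arr_gf) (use u in auto)
  have sm: "summable (\<lambda>n. h n * u ^ n)" if "summable h" "\<And>n. 0 \<le> h n" for h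
    by (rule summable_power_le_1[OF that]) (use u in auto)
  have Y: "(\<lambda>n. y n * u ^ n) sums (gf u / u)"
  proof -
    have "gf u = u * (\<Sum>n. y n * u ^ n)"
      unfolding gf_def using suminf_mult[OF sm[OF y_summable y_nonneg], of u] by (simp add: mult_ac)
    then show ?thesis using sm[OF y_summable y_nonneg] u by (simp add: sums_iff)
  qed
  have cv: "(\<Sum>n. conv f g n * u ^ n) = (\<Sum>n. f n * u ^ n) * (\<Sum>n. g n * u ^ n)"
    if "summable f" "\<And>n. 0 \<le> f n" "summable g" "\<And>n. 0 \<le> g n" for f g
    unfolding conv_power using that u by (intro conv_sums sm) auto
  have ab: "(\<Sum>n. abar n * u ^ n) = (1 - A) / (1 - u)"
    using tail_gf_sums[OF arr_summable arr_nonneg, of u] u A arr_sums by (simp add: abar_def sums_iff)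
  have gb: "(\<Sum>n. gbar n * u ^ n) = (1 - A * (gf u / u)) / (1 - u)"
    using tail_gf_sums[of "conv arr y" u] conv_arr_y u A Y cv[OF arr_summable arr_nonneg y_summable y_nonneg]
    by (simp add: gbar_def sums_iff)
  have sc: "summable (conv abar flux)"
    using conv_sums(1)[of abar flux] abar_sums abar_nonneg flux_summable flux_nonneg by (simp add: sums_iff)
  have "(\<Sum>n. flux n * u ^ n) = (\<Sum>n. gbar n * u ^ n + conv abar flux n * u ^ n)"
  proof (rule suminf_cong)
    show "flux n * u ^ n = gbar n * u ^ n + conv abar flux n * u ^ n" for n
      using arg_cong[OF flux_eq[of n], of "\<lambda>x. x * u ^ n"] by (simp only: distrib_right)
  qed
  also have "\<dots> = (\<Sum>n. gbar n * u ^ n) + (\<Sum>n. conv abar flux n * u ^ n)"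
    using gbar_sums gbar_nonneg abar_nonneg flux_nonneg
    by (intro suminf_add[symmetric] sm sc conv_nonneg) (auto simp: sums_iff)
  also have "(\<Sum>n. conv abar flux n * u ^ n) = (1 - A) / (1 - u) * (\<Sum>n. flux n * u ^ n)"
    using cv[of abar flux] abar_sums abar_nonneg flux_summable flux_nonneg by (simp add: ab sums_iff)
  finally have eq: "(\<Sum>n. flux n * u ^ n) = (1 - A * (gf u / u)) / (1 - u) + (1 - A) / (1 - u) * (\<Sum>n. flux n * u ^ n)"
    unfolding gb .
  have "(1 - A) / (1 - u) \<le> lam * beta * chi"
    unfolding ab[symmetric] sums_unique[OF abar_sums]
  proof (rule suminf_le)
    show "abar n * u ^ n \<le> abar n" for n
      using abar_nonneg[of n] u by (intro mult_left_le power_le_one) auto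
  qed (use sm abar_sums abar_nonneg in \<open>auto simp: sums_iff\<close>)
  then have "(1 - A) / (1 - u) < 1" using stable by linarith
  then have "A - u > 0" using u by (simp add: field_simps)
  moreover have "(\<Sum>n. flux n * u ^ n) * (A - u) = 1 - A * (gf u / u)"
  proof -
    have "F * (A - u) = g" if F: "F = g / (1 - u) + (1 - A) / (1 - u) * F" for F g
    proof -
      have "F * (1 - u) = (g / (1 - u) + (1 - A) / (1 - u) * F) * (1 - u)"
        by (rule arg_cong[OF F])
      also have "\<dots> = g + (1 - A) * F" using u by (simp add: distrib_right)
      finally show ?thesis by algebra
    qed
    from this[OF eq] show ?thesis .
  qed
  ultimately show ?thesis by (simp add: A_def[symmetric] eq_divide_eq)
qed

lemma flux_tail_asymp:
  assumes r: "regvar (- a) r" and a: "a > 1" and ly: "(\<lambda>j. tail y j / r (real j)) \<longlonglongrightarrow> c"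
    and lS: "((\<lambda>x. measure S {x<..} / r x) \<longlongrightarrow> cB) at_top"
  shows "(\<lambda>j. tail flux j / (real j * r (real j))) \<longlonglongrightarrow>
    (chi * (cB * (lam * chi) powr a) + c) / ((a - 1) * (1 - lam * beta * chi)\<^sup>2)"
proof -
  let ?\<rho> = "lam * beta * chi"
  define k where "k = cB * (lam * chi) powr a"
  define r1 where "r1 = (\<lambda>x. x powr 1 * r x)"
  have r1: "regvar (1 + - a) r1" unfolding r1_def by (rule regvar_powr_mult[OF r])
  have r1n: "r1 (real j) = real j * r (real j)" for j by (simp add: r1_def)
  have la: "(\<lambda>j. tail arr j / r (real j)) \<longlonglongrightarrow> lam * beta * c + k"
    unfolding k_def by (rule arr_tail_asymp[OF r a ly lS])
  have "(\<lambda>n. abar n / r (real n)) \<longlonglongrightarrow> lam * beta * c + k"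
    unfolding abar_def using la by (simp add: quot_Suc_iff[OF r])
  from karamata_sum(2)[OF r a this]
  have lab: "(\<lambda>j. tail abar j / r1 (real j)) \<longlonglongrightarrow> (lam * beta * c + k) / (a - 1)" by (simp add: r1n)
  have "(\<lambda>j. tail (conv arr y) j / r (real j)) \<longlonglongrightarrow> suminf arr * c + suminf y * (lam * beta * c + k)"
    by (rule tail_conv_asymp[OF r arr_summable arr_nonneg y_summable y_nonneg la ly])
  then have "(\<lambda>j. tail (conv arr y) j / r (real j)) \<longlonglongrightarrow> c + (lam * beta * c + k)"
    using arr_sums y_sums by (simp add: sums_iff)
  then have "(\<lambda>n. gbar n / r (real n)) \<longlonglongrightarrow> c + (lam * beta * c + k)"
    unfolding gbar_def by (simp add: quot_Suc_iff[OF r])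
  from karamata_sum(2)[OF r a this]
  have lgb: "(\<lambda>j. tail gbar j / r1 (real j)) \<longlonglongrightarrow> (c + (lam * beta * c + k)) / (a - 1)" by (simp add: r1n)
  have "(\<lambda>j. tail flux j / r1 (real j)) \<longlonglongrightarrow>
      ((c + (lam * beta * c + k)) / (a - 1) + suminf flux * ((lam * beta * c + k) / (a - 1))) / (1 - suminf abar)"
    by (rule tail_fixed_point_asymp[OF r1 flux_summable flux_nonneg _ gbar_nonneg _ abar_nonneg _ flux_eq lgb lab])
       (use gbar_sums abar_sums stable in \<open>auto simp: sums_iff\<close>)
  also have "((c + (lam * beta * c + k)) / (a - 1) + suminf flux * ((lam * beta * c + k) / (a - 1))) / (1 - suminf abar)
      = (chi * k + c) / ((a - 1) * (1 - ?\<rho>)\<^sup>2)"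
  proof -
    have sums: "suminf flux = (?\<rho> + chi - 1) / (1 - ?\<rho>)" "suminf abar = ?\<rho>"
      using flux_sums abar_sums by (auto simp: sums_iff)
    \<comment> \<open>The contributions \<open>x * c\<close> of large batches during a service cancel, \<open>x\<close> being \<open>lam * beta\<close>.\<close>
    have aux: "((c + (x * c + k)) / e + (x * chi + chi - 1) / q * ((x * c + k) / e)) / q = (chi * k + c) / (e * q\<^sup>2)"
      if "q = 1 - x * chi" "q \<noteq> 0" "e \<noteq> 0" for x e q
    proof -
      have "((c + (x * c + k)) / e + (x * chi + chi - 1) / q * ((x * c + k) / e)) / q
          = ((c + (x * c + k)) * q + (x * chi + chi - 1) * (x * c + k)) / (e * q\<^sup>2)"
        using that(2,3) by (simp add: field_simps power2_eq_square)
      also have "(c + (x * c + k)) * q + (x * chi + chi - 1) * (x * c + k) = chi * k + c"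
        unfolding that(1) by (simp add: algebra_simps)
      finally show ?thesis .
    qed
    from aux[of "1 - ?\<rho>" "lam * beta" "a - 1"] show ?thesis unfolding sums using stable a by simp
  qed
  finally show ?thesis by (simp add: r1n k_def)
qed

text \<open>
  Integrating \<open>flux\<close> identifies \<open>p\<close> with the Panjer sequence of \<open>lam / mu * flux\<close>; uniqueness of power
  series on the interval suffices for that. The tail then passes from \<open>flux\<close> to \<open>p\<close>.
\<close>

lemma idle_tail_asymp:
  assumes mu: "mu > 0"
    and r: "regvar (- a) r" and a: "a > 1" and ly: "(\<lambda>j. tail y j / r (real j)) \<longlonglongrightarrow> c"
    and lS: "((\<lambda>x. measure S {x<..} / r x) \<longlongrightarrow> cB) at_top"
    and p: "p sums 1" "\<And>n. 0 \<le> p n"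
    and gf_p: "\<And>z. 0 < z \<Longrightarrow> z < 1 \<Longrightarrow> (\<Sum>n. p n * z ^ n) = exp (- (lam / mu) * integral {z..1} (\<lambda>u.
        (1 - lst S (lam * (1 - gf u)) * (gf u / u)) / (lst S (lam * (1 - gf u)) - u)))"
  shows "(\<lambda>j. tail p j / r (real j)) \<longlonglongrightarrow>
    lam * (chi * (cB * (lam * chi) powr a) + c) / (a * mu * (1 - lam * beta * chi)\<^sup>2)"
proof -
  define \<nu> where "\<nu> = lam / mu"
  have \<nu>: "\<nu> > 0" using lam mu by (simp add: \<nu>_def)
  define \<phi> where "\<phi> = (\<lambda>i. flux i / real (Suc i))"
  have \<phi>0: "0 \<le> \<phi> i" "\<phi> i \<le> flux i" for i
    using flux_nonneg[of i] by (auto simp: \<phi>_def field_simps)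
  have \<phi>: "summable \<phi>" "0 \<le> \<phi> i" for i
    by (rule summable_comparison_test'[OF flux_summable, of 0]) (simp_all add: \<phi>0)
  define Phi where "Phi = (\<lambda>z. \<Sum>i. \<phi> i * z ^ Suc i)"
  have Phi_alt: "Phi z = z * (\<Sum>i. \<phi> i * z ^ i)" if "0 \<le> z" "z \<le> 1" for z
    unfolding Phi_def using suminf_mult[OF summable_power_le_1[OF \<phi> that], of z] by (simp add: mult_ac)
  define nf where "nf = (\<lambda>i. \<nu> * flux i)"
  have nf: "summable nf" "0 \<le> nf i" for i
    using \<nu> flux_nonneg flux_summable by (auto simp: nf_def intro: summable_mult)
  define q where "q = panjer (exp (- \<nu> * Phi 1)) nf"
  have q: "(\<lambda>n. q n * z ^ n) sums exp (- \<nu> * (Phi 1 - Phi z))" if z: "0 \<le> z" "z \<le> 1" for z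
  proof -
    have "(\<lambda>n. q n * z ^ n) sums (exp (- \<nu> * Phi 1) * exp (\<Sum>i. nf i / real (Suc i) * z ^ Suc i))"
      unfolding q_def by (intro panjer_sums nf z) simp
    also have "(\<lambda>i. nf i / real (Suc i) * z ^ Suc i) = (\<lambda>i. \<nu> * (\<phi> i * z ^ Suc i))"
      by (simp add: nf_def \<phi>_def mult_ac)
    also have "(\<Sum>i. \<nu> * (\<phi> i * z ^ Suc i)) = \<nu> * Phi z"
      unfolding Phi_def using summable_mult[OF summable_power_le_1[OF \<phi> z], of z]
      by (intro suminf_mult) (simp add: mult_ac)
    finally show ?thesis by (simp add: exp_add[symmetric] algebra_simps)
  qed
  have q1: "q sums 1" using q[of 1] by simp
  have q0: "0 \<le> q n" for n unfolding q_def by (intro panjer_nonneg nf) simp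
  have dPhi: "(Phi has_real_derivative (\<Sum>n. flux n * u ^ n)) (at u)" if u: "0 < u" "u < 1" for u
  proof -
    define t where "t = (\<lambda>n. case n of 0 \<Rightarrow> 0 | Suc i \<Rightarrow> \<phi> i)"
    have st: "summable t" using \<phi>(1) by (subst summable_Suc_iff[symmetric]) (simp add: t_def)
    have t0: "0 \<le> t n" for n using \<phi>(2) by (simp add: t_def split: nat.split)
    have "summable (\<lambda>n. t n * 1 ^ n)" using st by simp
    moreover have "norm u < norm (1::real)" using u by simp
    ultimately have "((\<lambda>x. \<Sum>n. t n * x ^ n) has_real_derivative (\<Sum>n. diffs t n * u ^ n)) (at u)"
      by (rule termdiffs_strong)
    moreover have "diffs t = flux" by (auto simp: diffs_def t_def \<phi>_def)
    moreover have "\<forall>\<^sub>F x in nhds u. (\<Sum>n. t n * x ^ n) = Phi x"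
    proof -
      have "\<forall>\<^sub>F x in nhds u. x \<in> {0<..<1}" using u by (intro eventually_nhds_in_open) auto
      then show ?thesis
      proof eventually_elim
        case (elim x)
        have "summable (\<lambda>n. t n * x ^ n)" by (rule summable_power_le_1[OF st t0]) (use elim in auto)
        then show ?case using suminf_split_head[of "\<lambda>n. t n * x ^ n"] by (simp add: t_def Phi_def)
      qed
    qed
    ultimately show ?thesis using DERIV_cong_ev[OF refl] by fastforce
  qed
  have integ: "integral {z..1} (\<lambda>u. (1 - lst S (lam * (1 - gf u)) * (gf u / u)) / (lst S (lam * (1 - gf u)) - u)) = Phi 1 - Phi z"
    if z: "0 < z" "z < 1" for z
  proof (rule integral_unique, rule fundamental_theorem_of_calculus_interior)
    show "continuous_on {z..1} Phi"
    proof -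
      have "continuous_on {0..1} (\<lambda>z. z * (\<Sum>i. \<phi> i * z ^ i))"
        by (intro continuous_intros power_series_continuous \<phi>)
      then have "continuous_on {0..1} Phi" by (rule continuous_on_eq) (simp add: Phi_alt)
      then show ?thesis by (rule continuous_on_subset) (use z in auto)
    qed
    fix u assume "u \<in> {z<..<1}"
    then have u: "0 < u" "u < 1" using z by auto
    show "(Phi has_vector_derivative (1 - lst S (lam * (1 - gf u)) * (gf u / u)) / (lst S (lam * (1 - gf u)) - u)) (at u)"
      using dPhi[OF u] unfolding flux_gf[OF u] by (simp add: has_real_derivative_iff_has_vector_derivative)
  qed (use z in auto)
  have pq: "p n = q n" for n
  proof (rule power_series_unique)
    show "(\<Sum>n. p n * z ^ n) = (\<Sum>n. q n * z ^ n)" if "0 < z" "z < 1" for z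
      using gf_p[OF that] integ[OF that] q[of z] that by (simp add: \<nu>_def sums_iff)
  qed (use p q1 q0 in \<open>auto simp: sums_iff\<close>)
  then have pe: "p = q" by auto
  let ?K = "(chi * (cB * (lam * chi) powr a) + c) / ((a - 1) * (1 - lam * beta * chi)\<^sup>2)"
  have "(\<lambda>j. tail q j / r (real j)) \<longlonglongrightarrow> (1 - 1 / a) * (\<nu> * ?K) * suminf q"
  proof (rule tail_panjer_asymp[OF r a nf _ q0])
    show "summable q" using q1 by (simp add: sums_iff)
    show "real (Suc n) * q (Suc n) = conv nf q n" for n unfolding q_def by (rule panjer_conv)
    show "(\<lambda>j. tail nf j / (real j * r (real j))) \<longlonglongrightarrow> \<nu> * ?K"
      unfolding nf_def tail_cmult[OF flux_summable] times_divide_eq_right[symmetric]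
      by (intro tendsto_mult tendsto_const flux_tail_asymp[OF r a ly lS, unfolded times_divide_eq_right[symmetric]])
  qed
  also have "(1 - 1 / a) * (\<nu> * ?K) * suminf q = lam * (chi * (cB * (lam * chi) powr a) + c) / (a * mu * (1 - lam * beta * chi)\<^sup>2)"
  proof -
    have aux: "(1 - 1 / a) * (lam / mu * (X / ((a - 1) * Y))) = lam * X / (a * mu * Y)" for X Y
    proof -
      have "1 - 1 / a = (a - 1) / a" using a by (simp add: field_simps)
      then show ?thesis using a by simp
    qed
    have "suminf q = 1" using q1 by (simp add: sums_iff)
    then show ?thesis unfolding \<nu>_def by (simp only: aux mult_1_right)
  qed
  finally show ?thesis by (simp only: pe)
qed

end

end

section \<open>Reduction of the queue to sequences\<close>

text \<open>
  The normalising function inherits local uniformity from the monotone service time tail to which it is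
  equivalent.
\<close>

lemma service_tail_regvar:
  assumes S: "real_distribution S" and L: "slowly_varying L"
    and A1: "(\<lambda>x. measure S {x<..}) \<sim>[at_top] (\<lambda>x. x powr (- d) * L x)"
  shows "regvar (- d) (\<lambda>x. x powr (- d) * L x)"
    and "((\<lambda>x. measure S {x<..} / (x powr (- d) * L x)) \<longlongrightarrow> 1) at_top"
proof -
  interpret S: real_distribution S by fact
  let ?T = "\<lambda>x. measure S {x<..}" and ?s = "\<lambda>x. x powr (- d) * L x"
  have Lp: "L x > 0" if "x > 0" for x using L that by (auto simp: slowly_varying_def)
  have sp: "\<forall>\<^sub>F x in at_top. 0 < ?s x"
    using eventually_gt_at_top[of 0] by eventually_elim (simp add: Lp)
  show lim: "((\<lambda>x. ?T x / ?s x) \<longlongrightarrow> 1) at_top"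
    using asymp_equivD[OF A1]
  proof (rule Lim_transform_eventually)
    show "\<forall>\<^sub>F x in at_top. (if ?T x = 0 \<and> ?s x = 0 then 1 else ?T x / ?s x) = ?T x / ?s x"
      using sp
    proof eventually_elim
      case (elim x)
      then have "?s x \<noteq> 0" by linarith
      then show ?case by (simp only: simp_thms if_False)
    qed
  qed
  have Tp: "\<forall>\<^sub>F x in at_top. 0 < ?T x"
    using order_tendstoD(1)[OF lim zero_less_one] sp
  proof eventually_elim
    case (elim x)
    then show ?case by (metis divide_pos_pos measure_nonneg zero_less_divide_iff less_irrefl less_le)
  qed
  have "regvar (- d) ?T"
  proof (rule regvar_of_antimono[OF _ Tp])
    show "?T y \<le> ?T x" if "x \<le> y" for x y using that by (intro S.finite_measure_mono) auto
    fix t :: real assume t: "t > 0"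
    have tt: "filterlim (\<lambda>x. t * x) at_top at_top"
      by (rule filterlim_tendsto_pos_mult_at_top[OF tendsto_const t filterlim_ident])
    have "((\<lambda>x. ?T (t * x) / ?s (t * x) * (t powr (- d) * (L (t * x) / L x)) / (?T x / ?s x)) \<longlongrightarrow> 1 * (t powr (- d) * 1) / 1) at_top"
      using L t by (intro tendsto_divide tendsto_mult tendsto_const lim filterlim_compose[OF lim tt]) (auto simp: slowly_varying_def)
    then show "((\<lambda>x. ?T (t * x) / ?T x) \<longlongrightarrow> t powr (- d)) at_top"
      unfolding mult_1 div_by_1 mult_1_right
    proof (rule Lim_transform_eventually)
      show "\<forall>\<^sub>F x in at_top. ?T (t * x) / ?s (t * x) * (t powr (- d) * (L (t * x) / L x)) / (?T x / ?s x) = ?T (t * x) / ?T x"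
        using Tp eventually_gt_at_top[of 0]
      proof eventually_elim
        case (elim x)
        have "0 < L x" "0 < L (t * x)" using Lp elim t by auto
        then show ?case using elim t by (simp add: powr_mult field_simps)
      qed
    qed
  qed
  then show "regvar (- d) ?s" by (rule regvar_equiv[OF _ sp lim])
qed

lemma pmf_tail:
  assumes "pmf p 0 = 0"
  shows "tail (\<lambda>i. pmf p (Suc i)) j = measure_pmf.prob p {j<..}" "(\<lambda>i. pmf p (Suc i)) sums 1"
proof -
  have "(\<lambda>n. pmf p n) sums 1" using pmf_nat_sums[of p "\<lambda>_. 1"] by simp
  then show s: "(\<lambda>i. pmf p (Suc i)) sums 1" by (subst sums_Suc_iff) (simp add: assms)
  have "{j<..} = UNIV - {..j}" by auto
  then have "measure_pmf.prob p {j<..} = 1 - measure_pmf.prob p {..j}"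
    using measure_pmf.prob_compl[of "{..j}" p] by simp
  also have "measure_pmf.prob p {..j} = (\<Sum>n\<le>j. pmf p n)" by (simp add: measure_measure_pmf_finite)
  also have "\<dots> = (\<Sum>i<j. pmf p (Suc i))" by (subst sum.atMost_shift) (simp add: assms)
  finally show "tail (\<lambda>i. pmf p (Suc i)) j = measure_pmf.prob p {j<..}"
    using s tail_eq_diff[of "\<lambda>i. pmf p (Suc i)" j] by (simp add: sums_iff)
qed

theorem theorem5p1:
  fixes lam mu beta1 chi1 rho psi a dB dX cX :: real
    and L :: "real \<Rightarrow> real"
    and PX :: "nat pmf" and SB :: "real measure"
    and M :: "'a measure" and Cser Norb :: "'a \<Rightarrow> nat" and Res :: "'a \<Rightarrow> real"
    and Q :: "'b measure" and D0 :: "'b \<Rightarrow> nat"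
  assumes rates: "lam > 0" "mu > 0"
    and batch: "set_pmf PX \<subseteq> {1..}" "integrable (measure_pmf PX) real"
    and chi1: "chi1 = (\<integral>k. real k \<partial>measure_pmf PX)"
    and service: "real_distribution SB" "cdf SB 0 = 0" "integrable SB (\<lambda>x. x)"
    and beta1: "beta1 = (\<integral>x. x \<partial>SB)"
    and rho: "rho = lam * beta1 * chi1"
    and stable: "rho < 1"
    and stationary: "retrial_stationary lam mu PX SB M Cser Norb Res"
    and D0: "prob_space Q" "D0 \<in> measurable Q (count_space UNIV)"
      "distr Q (count_space UNIV) D0 = idle_orbit_law M Cser Norb"
    and L: "slowly_varying L"
    and A1: "dB > 1"
      "(\<lambda>x. measure SB {x<..}) \<sim>[at_top] (\<lambda>x. x powr (- dB) * L x)"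
    and A2: "dX > 1" "cX \<ge> 0"
      "if cX = 0
       then (\<lambda>j. measure_pmf.prob PX {j<..} / (real j powr (- dX) * L (real j))) \<longlonglongrightarrow> 0
       else (\<lambda>j. measure_pmf.prob PX {j<..}) \<sim>[at_top] (\<lambda>j. cX * real j powr (- dX) * L (real j))"
    and cases: "dX > dB \<or> (dX < dB \<and> cX > 0) \<or> (dX = dB \<and> cX > 0)"
    and a: "a = min dB dX"
    and psi: "psi = lam * (rho + chi1 - 1) / (mu * (1 - rho))"
  shows "((\<lambda>j::nat. measure Q {x \<in> space Q. D0 x > j}) \<sim>[at_top]
            (\<lambda>j. (1 - 1 / a) * c_K lam chi1 rho dB dX cX * psi * real j powr (- a) * L (real j)))
       \<and> (1 - 1 / a) * c_K lam chi1 rho dB dX cX * psi = c_D0 lam mu chi1 rho dB dX cX"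
proof -
  interpret Q: prob_space Q by fact
  note [measurable] = D0(2)
  define y where "y = (\<lambda>i. pmf PX (Suc i))"
  have pmf0: "pmf PX 0 = 0" using batch(1) by (auto simp: pmf_eq_0_set_pmf)
  have chi_sums: "(\<lambda>i. real (Suc i) * y i) sums chi1"
  proof -
    have "(\<lambda>n. pmf PX n * real n) sums chi1" unfolding chi1 by (rule pmf_nat_sums[OF batch(2)])
    then have "(\<lambda>n. pmf PX (Suc n) * real (Suc n)) sums chi1" by (subst sums_Suc_iff) simp
    then show ?thesis by (simp add: y_def mult.commute)
  qed
  have S_pos: "AE b in SB. 0 < b" by (rule lst_bounds(1)[OF service, of 0]) simp
  interpret SB: real_distribution SB by fact
  interpret B: batch_service y SB lam
    by unfold_locales
       (use rates service S_pos pmf_tail(2)[OF pmf0] chi_sums in \<open>auto simp: y_def sums_iff\<close>)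
  have chi: "B.chi = chi1" using chi_sums by (simp add: B.chi_def sums_iff)
  have beta: "B.beta = beta1" by (simp add: B.beta_def beta1)
  have gf: "B.gf u = pgf PX u" if u: "0 < u" "u < 1" for u
  proof -
    have "(\<lambda>n. pmf PX n * u ^ n) sums pgf PX u"
      unfolding pgf_def by (rule pmf_nat_sums) (rule pgf_bounds(4)[OF batch u])
    then have "(\<lambda>i. y i * u ^ Suc i) sums pgf PX u"
      unfolding y_def by (subst sums_Suc_iff) (simp add: pmf0)
    then show ?thesis unfolding B.gf_def by (rule sums_unique[symmetric])
  qed
  have beta1_pos: "beta1 > 0"
  proof -
    have "beta1 \<ge> 0" unfolding beta1 using S_pos by (intro integral_nonneg_AE) auto
    moreover have "beta1 \<noteq> 0"
    proof
      assume "beta1 = 0"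
      moreover have "AE b in SB. 0 \<le> b" using S_pos by eventually_elim simp
      ultimately have "AE b in SB. b = 0"
        unfolding beta1 using integral_nonneg_eq_0_iff_AE[OF service(3)] by simp
      with S_pos have "AE b in SB. False" by eventually_elim auto
      then show False by (simp add: SB.AE_False)
    qed
    ultimately show ?thesis by simp
  qed
  have rho_pos: "rho > 0" and chi1_ge: "chi1 \<ge> 1"
    using beta1_pos rates B.chi_ge_1 by (auto simp: rho chi)
  have a1: "a > 1" using A1(1) A2(1) by (simp add: a)
  define s where "s = (\<lambda>x. x powr (- dB) * L x)"
  have st: "regvar (- dB) s" "((\<lambda>x. measure SB {x<..} / s x) \<longlongrightarrow> 1) at_top"
    unfolding s_def by (rule service_tail_regvar[OF service(1) L A1(2)])+
  define r where "r = (\<lambda>x. x powr (- a) * L x)"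
  have r_alt: "r = (\<lambda>x. x powr (dB - a) * s x)"
    unfolding r_def s_def by (simp add: powr_add[symmetric] mult.assoc[symmetric])
  have r: "regvar (- a) r"
    using regvar_powr_mult[OF st(1), of "dB - a"] unfolding r_alt[symmetric] by simp
  have Lp: "L x > 0" if "x > 0" for x using L that by (auto simp: slowly_varying_def)
  \<comment> \<open>Constants of the two tails relative to \<open>r\<close>; the lighter one gets \<open>0\<close>, which unites the three cases.\<close>
  define cB where "cB = (if dB \<le> dX then 1 else 0 :: real)"
  define c where "c = (if dX \<le> dB then cX else 0)"
  have lS: "((\<lambda>x. measure SB {x<..} / r x) \<longlongrightarrow> cB) at_top"
  proof (cases "dB \<le> dX")
    case True
    then have "r = s" by (simp add: r_def s_def a min_def)
    then show ?thesis using st(2) True by (simp add: cB_def)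
  next
    case False
    then have "((\<lambda>x::real. x powr (dX - dB)) \<longlongrightarrow> 0) at_top" by real_asymp
    from tendsto_mult[OF st(2) this]
    have "((\<lambda>x. measure SB {x<..} / s x * x powr (dX - dB)) \<longlongrightarrow> 0) at_top" by simp
    then have "((\<lambda>x. measure SB {x<..} / r x) \<longlongrightarrow> 0) at_top"
    proof (rule Lim_transform_eventually)
      show "\<forall>\<^sub>F x in at_top. measure SB {x<..} / s x * x powr (dX - dB) = measure SB {x<..} / r x"
        using eventually_gt_at_top[of 0]
      proof eventually_elim
        case (elim x)
        have "x powr (dX - dB) = 1 / x powr (dB - dX)" using powr_minus_divide[of x "dB - dX"] by simp
        then show ?case using False by (simp add: r_alt a min_def)
      qed
    qed
    then show ?thesis using False by (simp add: cB_def)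
  qed
  have ty: "tail y j = measure_pmf.prob PX {j<..}" for j unfolding y_def by (rule pmf_tail(1)[OF pmf0])
  have lX: "(\<lambda>j. tail y j / (real j powr (- dX) * L (real j))) \<longlonglongrightarrow> cX"
  proof (cases "cX = 0")
    case True
    then show ?thesis using A2(3) by (simp add: ty)
  next
    case False
    then have "(\<lambda>j. tail y j) \<sim>[at_top] (\<lambda>j. cX * real j powr (- dX) * L (real j))" using A2(3) by (simp add: ty)
    from tendsto_mult[OF asymp_equivD[OF this] tendsto_const[of cX]]
    have "(\<lambda>j. (if tail y j = 0 \<and> cX * real j powr (- dX) * L (real j) = 0 then 1 else tail y j / (cX * real j powr (- dX) * L (real j))) * cX) \<longlonglongrightarrow> cX"
      by simp
    then show ?thesis
    proof (rule Lim_transform_eventually)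
      show "\<forall>\<^sub>F j in sequentially. (if tail y j = 0 \<and> cX * real j powr (- dX) * L (real j) = 0 then 1 else tail y j / (cX * real j powr (- dX) * L (real j))) * cX
          = tail y j / (real j powr (- dX) * L (real j))"
        using eventually_gt_at_top[of 0]
      proof eventually_elim
        case (elim j)
        then have "L (real j) > 0" by (intro Lp) simp
        then show ?case using elim False by simp
      qed
    qed
  qed
  have ly: "(\<lambda>j. tail y j / r (real j)) \<longlonglongrightarrow> c"
  proof (cases "dX \<le> dB")
    case True
    then show ?thesis using lX by (simp add: r_def a c_def min_def split: if_splits)
  next
    case False
    then have "(\<lambda>j. real j powr (dB - dX)) \<longlonglongrightarrow> 0" by real_asymp
    from tendsto_mult[OF lX this]
    have "(\<lambda>j. tail y j / (real j powr (- dX) * L (real j)) * real j powr (dB - dX)) \<longlonglongrightarrow> 0" by simp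
    moreover have "tail y j / (real j powr (- dX) * L (real j)) * real j powr (dB - dX) = tail y j / r (real j)" for j
    proof -
      have "real j powr (- dX) = real j powr (- dB) * real j powr (dB - dX)" by (simp add: powr_add[symmetric])
      then show ?thesis using False by (cases "j = 0") (auto simp: r_def a min_def)
    qed
    ultimately show ?thesis using False by (simp add: c_def)
  qed
  define p where "p = (\<lambda>n. measure Q {x \<in> space Q. D0 x = n})"
  have gen: "(\<lambda>n. p n * g n) sums (\<integral>x. g (D0 x) \<partial>Q)" if g: "\<And>n. 0 \<le> g n" "\<And>n. g n \<le> 1" for g :: "nat \<Rightarrow> real"
  proof -
    have "(\<lambda>n. \<integral>x. g n * indicator {n} (D0 x) \<partial>Q) sums (\<integral>x. g (D0 x) \<partial>Q)"
    proof (rule integral_sums_nonneg)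
      show "integrable Q (\<lambda>x. g (D0 x))"
        by (rule Q.integrable_const_bound[where B = 1]) (use g in auto)
      have "(\<lambda>n. g n * indicator {n} (D0 x)) = (\<lambda>n. if n = D0 x then g n else 0)" for x
        by (auto simp: indicator_def)
      then show "(\<lambda>n. g n * indicator {n} (D0 x)) sums g (D0 x)" for x
        by (simp only: sums_single)
      show "(\<lambda>x. g n * indicator {n} (D0 x)) \<in> borel_measurable Q" for n
        by (rule measurable_compose[OF D0(2)]) simp
    qed (use g in \<open>auto\<close>)
    moreover have "(\<integral>x. indicator {n} (D0 x) \<partial>Q) = p n" for n
    proof -
      have "(\<lambda>x. indicator {n} (D0 x) :: real) = indicator (D0 -` {n})" by (auto simp: indicator_def)
      moreover have "D0 -` {n} \<inter> space Q = {x \<in> space Q. D0 x = n}" by auto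
      ultimately show ?thesis by (simp add: p_def)
    qed
    ultimately show ?thesis by (simp add: mult.commute)
  qed
  have p: "p sums 1" "0 \<le> p n" for n using gen[of "\<lambda>_. 1"] Q.prob_space by (auto simp: p_def)
  have gf_p: "(\<Sum>n. p n * z ^ n) = exp (- (lam / mu) * integral {z..1} (\<lambda>u.
        (1 - lst SB (lam * (1 - B.gf u)) * (B.gf u / u)) / (lst SB (lam * (1 - B.gf u)) - u)))"
    if z: "0 < z" "z < 1" for z
  proof -
    have "(\<Sum>n. p n * z ^ n) = (\<integral>x. z ^ D0 x \<partial>Q)"
      using gen[of "\<lambda>n. z ^ n"] z by (auto simp: sums_iff power_le_one)
    also have "\<dots> = exp (- (lam / mu) * integral {z..1} (\<lambda>u.
      (1 - lst SB (lam - lam * pgf PX u) * (pgf PX u / u)) / (lst SB (lam - lam * pgf PX u) - u)))"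
      using stable z
      by (intro idle_orbit_pgf[OF rates batch service _ stationary D0]) (auto simp: rho beta1 chi1)
    also have "integral {z..1} (\<lambda>u.
      (1 - lst SB (lam - lam * pgf PX u) * (pgf PX u / u)) / (lst SB (lam - lam * pgf PX u) - u))
      = integral {z..1} (\<lambda>u. (1 - lst SB (lam * (1 - B.gf u)) * (B.gf u / u)) / (lst SB (lam * (1 - B.gf u)) - u))"
    proof (rule integral_cong)
      fix u assume u: "u \<in> {z..1}"
      have "B.gf u = pgf PX u"
        using gf[of u] u z B.gf_1 by (cases "u = 1") (auto simp: pgf_def)
      then show "(1 - lst SB (lam - lam * pgf PX u) * (pgf PX u / u)) / (lst SB (lam - lam * pgf PX u) - u)
        = (1 - lst SB (lam * (1 - B.gf u)) * (B.gf u / u)) / (lst SB (lam * (1 - B.gf u)) - u)"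
        by (simp add: right_diff_distrib)
    qed
    finally show ?thesis .
  qed
  have stable': "lam * B.beta * B.chi < 1" using stable by (simp add: rho beta chi)
  note lim = B.idle_tail_asymp[OF stable' rates(2) r a1 ly lS p gf_p, unfolded beta chi rho[symmetric]]
  let ?c = "c_D0 lam mu chi1 rho dB dX cX"
  have m_pos: "lam * chi1 > 0" using rates chi1_ge by simp
  have const: "lam * (chi1 * (cB * (lam * chi1) powr a) + c) / (a * mu * (1 - rho)\<^sup>2) = ?c"
    using rates chi1_ge by (auto simp: c_D0_def Let_def a[symmetric] cB_def c_def powr_add algebra_simps)
  have powr_Suc: "(lam * chi1) powr (a + 1) = lam * ((lam * chi1) powr a * chi1)"
    using m_pos by (simp add: powr_add)
  have ident: "(1 - 1 / a) * c_K lam chi1 rho dB dX cX * psi = ?c"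
  proof -
    have aux: "(1 - 1 / a) * (X / ((a - 1) * (1 - rho) * (rho + chi1 - 1))) * psi = lam * X / (a * mu * (1 - rho)\<^sup>2)" for X
    proof -
      have 1: "1 - 1 / a = (a - 1) / a" using a1 by (simp add: field_simps)
      define w where "w = rho + chi1 - 1"
      have nz: "a - 1 \<noteq> 0" "1 - rho \<noteq> 0" "w \<noteq> 0"
        using a1 stable rho_pos chi1_ge by (auto simp: w_def)
      show ?thesis unfolding psi 1 w_def[symmetric] power2_eq_square using nz by (simp add: mult_ac)
    qed
    show ?thesis
      unfolding c_K_def c_D0_def Let_def a[symmetric]
      by (simp only: aux powr_Suc distrib_left[symmetric] split: if_split) simp
  qed
  have c_pos: "?c > 0"
  proof -
    have "0 < (lam * chi1) powr (a + 1)" using rates chi1_ge by simp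
    moreover have "0 < a * mu * (1 - rho)\<^sup>2" using a1 rates stable by simp
    ultimately show ?thesis
      unfolding c_D0_def Let_def a[symmetric] using cases rates A2(2)
      by (auto intro!: divide_pos_pos add_pos_pos)
  qed
  have tq: "measure Q {x \<in> space Q. D0 x > j} = tail p (Suc j)" for j
  proof -
    have "tail p (Suc j) = 1 - (\<Sum>n\<le>j. p n)"
      using tail_eq_diff[of p "Suc j"] p by (simp add: sums_iff lessThan_Suc_atMost)
    also have "(\<Sum>n\<le>j. p n) = measure Q (\<Union>n\<in>{..j}. {x \<in> space Q. D0 x = n})"
      unfolding p_def by (rule Q.finite_measure_finite_Union[symmetric]) (auto simp: disjoint_family_on_def)
    also have "1 - \<dots> = measure Q (space Q - (\<Union>n\<in>{..j}. {x \<in> space Q. D0 x = n}))"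
      by (rule Q.prob_compl[symmetric]) auto
    also have "space Q - (\<Union>n\<in>{..j}. {x \<in> space Q. D0 x = n}) = {x \<in> space Q. D0 x > j}" by auto
    finally show ?thesis by simp
  qed
  have "(\<lambda>j. tail p (Suc j) / r (real j)) \<longlonglongrightarrow> ?c"
    using lim by (simp add: quot_Suc_iff[OF r] const)
  from tendsto_mult[OF this tendsto_const[of "1 / ?c"]]
  have "(\<lambda>j. tail p (Suc j) / (?c * r (real j))) \<longlonglongrightarrow> 1"
    using c_pos by (simp add: mult.commute)
  then have "(\<lambda>j. tail p (Suc j)) \<sim>[at_top] (\<lambda>j. ?c * r (real j))" by (rule asymp_equivI')
  then show ?thesis unfolding ident tq by (simp add: r_def mult.assoc)
qed

end
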